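(* Let $\alpha\geq1$ and let $\sigma:\mathbb{R}\to[-1,1]$ be monotone non-decreasing, $1$-Lipschitz, and satisfy $\sigma(z)=\mathrm{sign}(z)$ whenever $|z|\geq\alpha$. Then there exists an algorithm $\mathcal{A}^{\sigma}_{\mathrm{misspGLM}}(\varepsilon,\alpha,w_{\max},D)$ that: (i) draws $O\big(\frac{\Delta\alpha^2}{\varepsilon^2}\ln\frac{\Delta\alpha}{\varepsilon}\big)$ samples from a distribution $D$ over $\{\mathbf x\in\mathbb{R}^{\Delta}:\|\mathbf x\|_2\leq\sqrt{\Delta}\}\times\{\pm1\}$ and outputs a vector in $\mathbb{R}^{\Delta}$; (ii) runs in time $\mathrm{poly}\big(\frac{\alpha\Delta}{\varepsilon}\log w_{\max}\big)$; (iii) whenever $D$ is a generalized linear model with an arbitrary $\mathbb{R}^{\Delta}$-marginal $D_X$ supported on $\{\mathbf x\in\mathbb{R}^{\Delta}:\|\mathbf x\|_2\leq\sqrt{\Delta}\}$ and $\mathbb{E}[y\mid\mathbf x]=\sigma'(\mathbf v^*\cdot\mathbf x)$ for a monotone activation $\sigma'$ and vector $\mathbf v^*$ such that $\|\mathbf v^*\|_2\leq w_{\max}$, $\sigma'(z)=\mathrm{sign}(z)$ whenever $|z|\geq\alpha$, and $|\sigma'(z)-\sigma(z)|\leq\varepsilon$ for all $z\in\mathbb{R}$, then with probability at least $0.99$ the algorithm outputs $\mathbf v_0$ with \[ \mathbb{E}_{\mathbf x\sim D_X}\Big[\big(\sigma'(\mathbf x\cdot\mathbf v^* )-\sigma'(\mathbf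 x\cdot\mathbf v_0)\big)^2\Big]\leq 24\alpha\varepsilon . \] (No further assumption is made on $D_X$.)
   Context: $\mathrm{sign}:\mathbb{R}\to\{\pm1\}$ is the sign function. A generalized linear model here is a distribution over $(\mathbf x,y)\in\mathbb{R}^\Delta\times\{\pm1\}$ with $\mathbb{E}[y\mid\mathbf x]$ given by the stated activation applied to $\mathbf v^*\cdot\mathbf x$. *)

theory Defs
  imports "HOL-Probability.Probability" "HOL-Computational_Algebra.Polynomial"
begin

section \<open>Real RAM programs with an activation oracle and access to labelled examples\<close>

text \<open>
  Time is counted in the usual unit-cost real RAM model: one step for each exact field operation or
  comparison on reals, and for each addition, truncated subtraction or comparison on indices.
  There is no rounding instruction and no multiplication of indices, so that unit-cost arithmetic
  cannot be used to pack several numbers into one, and all constants are integers.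
  Programs reach the activation \<open>\<sigma>\<close> only by evaluating it (\<open>Act\<close>, one step), and
  the distribution only by drawing examples (\<open>Draw\<close>).
\<close>

datatype nexp =
    NConst nat
  | NVar string
  | NPlus nexp nexp
  | NMinus nexp nexp

datatype rexp =
    RConst int
  | OfNat nexp
  | Arr string nexp
  | RPlus rexp rexp
  | RMinus rexp rexp
  | RTimes rexp rexp
  | RDivide rexp rexp
  | Act rexp

datatype bexp =
    NLess nexp nexp
  | RLess rexp rexp
  | BNot bexp
  | BAnd bexp bexp

datatype com =
    Skip
  | NAssign string nexp
  | RAssign string nexp rexp
  | Draw string string
  | Seq com com
  | Cond bexp com com
  | While bexp com

text \<open>A real scalar is a one-element array; \<open>draws\<close> counts the examples drawn so far.\<close>

record state =
  nats :: "string \<Rightarrow> nat"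
  reals :: "string \<Rightarrow> nat \<Rightarrow> real"
  draws :: nat

primrec nval :: "nexp \<Rightarrow> state \<Rightarrow> nat" where
  "nval (NConst n) s = n"
| "nval (NVar x) s = nats s x"
| "nval (NPlus a b) s = nval a s + nval b s"
| "nval (NMinus a b) s = nval a s - nval b s"

primrec rval :: "(real \<Rightarrow> real) \<Rightarrow> rexp \<Rightarrow> state \<Rightarrow> real" where
  "rval \<sigma> (RConst c) s = of_int c"
| "rval \<sigma> (OfNat i) s = of_nat (nval i s)"
| "rval \<sigma> (Arr a i) s = reals s a (nval i s)"
| "rval \<sigma> (RPlus e f) s = rval \<sigma> e s + rval \<sigma> f s"
| "rval \<sigma> (RMinus e f) s = rval \<sigma> e s - rval \<sigma> f s"
| "rval \<sigma> (RTimes e f) s = rval \<sigma> e s * rval \<sigma> f s"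
| "rval \<sigma> (RDivide e f) s = rval \<sigma> e s / rval \<sigma> f s"
| "rval \<sigma> (Act e) s = \<sigma> (rval \<sigma> e s)"

primrec bval :: "(real \<Rightarrow> real) \<Rightarrow> bexp \<Rightarrow> state \<Rightarrow> bool" where
  "bval \<sigma> (NLess i j) s = (nval i s < nval j s)"
| "bval \<sigma> (RLess e f) s = (rval \<sigma> e s < rval \<sigma> f s)"
| "bval \<sigma> (BNot b) s = (\<not> bval \<sigma> b s)"
| "bval \<sigma> (BAnd b c) s = (bval \<sigma> b s \<and> bval \<sigma> c s)"

primrec ncost :: "nexp \<Rightarrow> nat" where
  "ncost (NConst n) = 1"
| "ncost (NVar x) = 1"
| "ncost (NPlus a b) = 1 + ncost a + ncost b"
| "ncost (NMinus a b) = 1 + ncost a + ncost b"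

primrec rcost :: "rexp \<Rightarrow> nat" where
  "rcost (RConst c) = 1"
| "rcost (OfNat i) = 1 + ncost i"
| "rcost (Arr a i) = 1 + ncost i"
| "rcost (RPlus e f) = 1 + rcost e + rcost f"
| "rcost (RMinus e f) = 1 + rcost e + rcost f"
| "rcost (RTimes e f) = 1 + rcost e + rcost f"
| "rcost (RDivide e f) = 1 + rcost e + rcost f"
| "rcost (Act e) = 1 + rcost e"

primrec bcost :: "bexp \<Rightarrow> nat" where
  "bcost (NLess i j) = 1 + ncost i + ncost j"
| "bcost (RLess e f) = 1 + rcost e + rcost f"
| "bcost (BNot b) = 1 + bcost b"
| "bcost (BAnd b c) = 1 + bcost b + bcost c"

text \<open>
  \<open>exec \<sigma> \<Delta> \<omega> c s t s'\<close>: started in \<open>s\<close>, program \<open>c\<close> halts in \<open>s'\<close> after \<open>t\<close> steps,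
  where \<open>\<omega> k\<close> is the \<open>k\<close>-th example to be drawn. Drawing an example stores its \<open>\<Delta>\<close> coordinates
  in the array \<open>a\<close> and its label in the scalar \<open>b\<close>, and is charged for all of these writes.
\<close>

inductive exec ::
  "(real \<Rightarrow> real) \<Rightarrow> nat \<Rightarrow> (nat \<Rightarrow> (nat \<Rightarrow> real) \<times> real) \<Rightarrow> com \<Rightarrow> state \<Rightarrow> nat \<Rightarrow> state \<Rightarrow> bool"
  for \<sigma> :: "real \<Rightarrow> real" and \<Delta> :: nat and \<omega> :: "nat \<Rightarrow> (nat \<Rightarrow> real) \<times> real"
where
  Skip: "exec \<sigma> \<Delta> \<omega> Skip s 1 s"
| NAssign: "exec \<sigma> \<Delta> \<omega> (NAssign x i) s (1 + ncost i) (s\<lparr>nats := (nats s)(x := nval i s)\<rparr>)"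
| RAssign: "exec \<sigma> \<Delta> \<omega> (RAssign a i e) s (1 + ncost i + rcost e)
    (s\<lparr>reals := (reals s)(a := (reals s a)(nval i s := rval \<sigma> e s))\<rparr>)"
| Draw: "exec \<sigma> \<Delta> \<omega> (Draw a b) s (2 + \<Delta>)
    (s\<lparr>reals := (reals s)
          (a := (\<lambda>i. if i < \<Delta> then fst (\<omega> (draws s)) i else reals s a i),
           b := (reals s b)(0 := snd (\<omega> (draws s)))),
       draws := Suc (draws s)\<rparr>)"
| Seq: "exec \<sigma> \<Delta> \<omega> c s t s' \<Longrightarrow> exec \<sigma> \<Delta> \<omega> d s' u s'' \<Longrightarrow> exec \<sigma> \<Delta> \<omega> (Seq c d) s (t + u) s''"
| CondTrue: "bval \<sigma> b s \<Longrightarrow> exec \<sigma> \<Delta> \<omega> c s t s' \<Longrightarrow> exec \<sigma> \<Delta> \<omega> (Cond b c d) s (bcost b + t) s'"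
| CondFalse: "\<not> bval \<sigma> b s \<Longrightarrow> exec \<sigma> \<Delta> \<omega> d s t s' \<Longrightarrow> exec \<sigma> \<Delta> \<omega> (Cond b c d) s (bcost b + t) s'"
| WhileFalse: "\<not> bval \<sigma> b s \<Longrightarrow> exec \<sigma> \<Delta> \<omega> (While b c) s (bcost b) s"
| WhileTrue: "bval \<sigma> b s \<Longrightarrow> exec \<sigma> \<Delta> \<omega> c s t s' \<Longrightarrow> exec \<sigma> \<Delta> \<omega> (While b c) s' u s'' \<Longrightarrow>
    exec \<sigma> \<Delta> \<omega> (While b c) s (bcost b + t + u) s''"

inductive_cases SkipE: "exec \<sigma> \<Delta> \<omega> Skip s t s'"
inductive_cases NAssignE: "exec \<sigma> \<Delta> \<omega> (NAssign x i) s t s'"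
inductive_cases RAssignE: "exec \<sigma> \<Delta> \<omega> (RAssign a i e) s t s'"
inductive_cases DrawE: "exec \<sigma> \<Delta> \<omega> (Draw a b) s t s'"
inductive_cases SeqE: "exec \<sigma> \<Delta> \<omega> (Seq c d) s t s'"
inductive_cases CondE: "exec \<sigma> \<Delta> \<omega> (Cond b c d) s t s'"
inductive_cases WhileE: "exec \<sigma> \<Delta> \<omega> (While b c) s t s'"

lemma exec_deterministic:
  "exec \<sigma> \<Delta> \<omega> c s t s' \<Longrightarrow> exec \<sigma> \<Delta> \<omega> c s u s'' \<Longrightarrow> t = u \<and> s' = s''"
proof (induction arbitrary: u s'' rule: exec.induct)
  case (Skip s)
  then show ?case by (auto elim: SkipE)
next
  case (NAssign x i s)
  then show ?case by (auto elim: NAssignE)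
next
  case (RAssign a i e s)
  then show ?case by (auto elim: RAssignE)
next
  case (Draw a b s)
  then show ?case by (auto elim: DrawE)
next
  case (Seq c s t s' d v s3)
  show ?case by (rule SeqE[OF Seq.prems]) (use Seq.IH in blast)
next
  case (CondTrue b s c t s' d)
  show ?case by (rule CondE[OF CondTrue.prems]) (use CondTrue.hyps CondTrue.IH in blast)+
next
  case (CondFalse b s d t s' c)
  show ?case by (rule CondE[OF CondFalse.prems]) (use CondFalse.hyps CondFalse.IH in blast)+
next
  case (WhileFalse b s c)
  show ?case by (rule WhileE[OF WhileFalse.prems]) (use WhileFalse.hyps in blast)+
next
  case (WhileTrue b s c t s' v s3)
  show ?case by (rule WhileE[OF WhileTrue.prems]) (use WhileTrue.hyps WhileTrue.IH in blast)+
qed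

text \<open>
  The arguments of the algorithm are found in the index variable \<open>Delta\<close> and in the real scalars
  \<open>eps\<close>, \<open>alpha\<close>, \<open>wmax\<close>; the rest of the memory is zero.
\<close>

definition initial :: "nat \<Rightarrow> real \<Rightarrow> real \<Rightarrow> real \<Rightarrow> state" where
  "initial \<Delta> \<epsilon> \<alpha> w =
    \<lparr>nats = (\<lambda>_. 0)(''Delta'' := \<Delta>),
     reals = (\<lambda>_ _. 0)(''eps'' := (\<lambda>_. 0)(0 := \<epsilon>),
                       ''alpha'' := (\<lambda>_. 0)(0 := \<alpha>),
                       ''wmax'' := (\<lambda>_. 0)(0 := w)),
     draws = 0\<rparr>"

definition out_vec :: "nat \<Rightarrow> state \<Rightarrow> nat \<Rightarrow> real" where
  "out_vec \<Delta> s = restrict (reals s ''out'') {..<\<Delta>}"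


section \<open>Generalized linear models\<close>

text \<open>
  Since the dimension \<open>\<Delta>\<close> is an argument of the algorithm, \<open>\<real>\<^sup>\<Delta>\<close> is the product of copies of
  \<open>\<real>\<close> indexed by \<open>{..<\<Delta>}\<close>.
\<close>

definition instance_space :: "nat \<Rightarrow> (nat \<Rightarrow> real) measure" where
  "instance_space \<Delta> =
    restrict_space (\<Pi>\<^sub>M i\<in>{..<\<Delta>}. borel) {x. L2_set x {..<\<Delta>} \<le> sqrt \<Delta>}"

definition example_space :: "nat \<Rightarrow> ((nat \<Rightarrow> real) \<times> real) measure" where
  "example_space \<Delta> = instance_space \<Delta> \<Otimes>\<^sub>M count_space {-1, 1}"

definition example_distribution :: "nat \<Rightarrow> ((nat \<Rightarrow> real) \<times> real) measure \<Rightarrow> bool" where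
  "example_distribution \<Delta> D \<longleftrightarrow> prob_space D \<and> sets D = sets (example_space \<Delta>)"

definition dot :: "nat \<Rightarrow> (nat \<Rightarrow> real) \<Rightarrow> (nat \<Rightarrow> real) \<Rightarrow> real" where
  "dot \<Delta> v x = (\<Sum>i<\<Delta>. v i * x i)"

definition marginal :: "nat \<Rightarrow> ((nat \<Rightarrow> real) \<times> real) measure \<Rightarrow> (nat \<Rightarrow> real) measure" where
  "marginal \<Delta> D = distr D (instance_space \<Delta>) fst"

text \<open>The conditional expectation of the label is taken given the \<sigma>-algebra generated by the instance.\<close>

definition glm ::
  "nat \<Rightarrow> ((nat \<Rightarrow> real) \<times> real) measure \<Rightarrow> (real \<Rightarrow> real) \<Rightarrow> (nat \<Rightarrow> real) \<Rightarrow> bool" where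
  "glm \<Delta> D g v \<longleftrightarrow> example_distribution \<Delta> D \<and>
    (AE z in D. real_cond_exp D (vimage_algebra (space D) fst (instance_space \<Delta>)) snd z
      = g (dot \<Delta> v (fst z)))"

lemma subalgebra_instance:
  assumes "example_distribution \<Delta> D"
  shows "subalgebra D (vimage_algebra (space D) fst (instance_space \<Delta>))"
proof -
  have sets: "sets D = sets (instance_space \<Delta> \<Otimes>\<^sub>M count_space {-1, 1})"
    using assms by (simp add: example_distribution_def example_space_def)
  have "fst \<in> measurable (instance_space \<Delta> \<Otimes>\<^sub>M count_space {-1, 1 :: real}) (instance_space \<Delta>)"
    by simp
  then have "fst \<in> measurable D (instance_space \<Delta>)"
    using measurable_cong_sets[OF sets refl] by blast
  then show ?thesis
    by (simp add: subalgebra_def measurable_iff_sets)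
qed

text \<open>
  In the sign condition \<open>z\<close> is nonzero because \<open>\<alpha> > 0\<close>, so it is immaterial that \<open>sgn 0 = 0\<close>.
\<close>

definition saturates_at :: "real \<Rightarrow> (real \<Rightarrow> real) \<Rightarrow> bool" where
  "saturates_at \<alpha> g \<longleftrightarrow> (\<forall>z. \<bar>z\<bar> \<ge> \<alpha> \<longrightarrow> g z = sgn z)"

end

theory Submission
  imports Defs "Jordan_Normal_Form.Determinant"
begin

text \<open>
  The learner runs the ellipsoid method on a fixed sample with the cuts
  \<open>g(u) = \<Sum>i. (\<sigma>(u \<cdot> x\<^sub>i) - y\<^sub>i) x\<^sub>i\<close>, the gradients of a convex surrogate loss. A small ball around \<open>v\<close>
  cannot survive all cuts, so some iterate \<open>u\<close> has an empirical first-order gap, the average of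
  \<open>(\<sigma>(u \<cdot> x) - y) (u \<cdot> x - v \<cdot> x)\<close>, of at most \<open>\<epsilon>\<close>; the iterate with the least empirical square loss is
  returned. The logarithm of \<open>w\<close> enters only through the number of iterations.

  Since \<open>\<sigma>\<close> and the labels saturate at \<open>\<alpha>\<close>, clipping the scores to \<open>[-\<alpha>, \<alpha>]\<close> only decreases the gap. The
  clipped gap and the square loss are bounded Lipschitz functions of the clipped score \<open>u \<cdot> x\<close>, so
  they converge uniformly over all \<open>u\<close>, no matter how long, at a rate governed by the number of patterns
  that halfspaces cut out of a finite set. In expectation, monotonicity and the Lipschitz condition
  bound the clipped gap from below by \<open>E (\<sigma>(u \<cdot> x) - \<sigma>(v \<cdot> x))\<^sup>2 - 2 \<alpha> \<epsilon>\<close>, and replacing \<open>\<sigma>\<close> by \<open>\<sigma>'\<close>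
  costs another \<open>O(\<epsilon>)\<close>.
\<close>

section \<open>Symmetrization\<close>

text \<open>The gap refers to the unknown \<open>v\<close> and cannot be computed, so the iterate
  with a small gap cannot be recognised by it. It need not be: it takes part in a comparison of
  square losses, which can be computed and which estimate, up to a term shared by all vectors, the
  squared distance to the true regression function. An iterate whose cut removes part of the ball of
  radius \<open>r\<close> around \<open>v\<close> has
  \<open>g \<cdot> (u - v) \<le> r * |g|\<close>, so failing to keep the ball is exactly what the
  method waits for.

  The machine offers neither square roots nor logarithms. The ellipsoid is therefore kept as the
  image of the unit ball under \<open>z \<mapsto> c + B z\<close>, with updates made of field
  operations and comparisons, and logarithms are obtained by counting doublings. Volume is replaced
  by the absolute value of the determinant of \<open>B\<close>, so that no measure of ellipsoids
  enters.\<close>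

lemma sum_sgn_exp_le:
  fixes d :: "nat \<Rightarrow> real"
  assumes d: "\<And>i. i < m \<Longrightarrow> \<bar>d i\<bar> \<le> 2"
  shows "(\<Sum>J\<in>Pow {..<m}. exp (l * ((\<Sum>i\<in>J. d i) - (\<Sum>i\<in>{..<m}-J. d i)))) \<le> 2 ^ m * exp (2 * l\<^sup>2 * m)"
proof -
  \<comment> \<open>The two power series are compared term by term, which comes down to
    \<open>2 ^ n * fact n \<le> fact (2 * n)\<close>.\<close>
  have cosh_le: "exp x + exp (-x) \<le> 2 * exp (x\<^sup>2 / 2)" for x :: real
  proof -
    have c: "(\<lambda>n. x ^ (2 * n) / fact (2 * n)) sums cosh x"
    proof -
      have "(\<lambda>n. if even n then x ^ n /\<^sub>R fact n else 0) sums cosh x" by (rule cosh_converges)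
      then have "(\<lambda>n. (\<lambda>n. if even n then x ^ n /\<^sub>R fact n else 0) (2 * n)) sums cosh x"
        by (subst sums_mono_reindex) (auto simp: strict_mono_def elim!: evenE)
      then show ?thesis by (simp add: field_simps)
    qed
    have e: "(\<lambda>n. (x\<^sup>2 / 2) ^ n / fact n) sums exp (x\<^sup>2 / 2)"
      using exp_converges[of "x\<^sup>2 / 2"] by (simp add: field_simps)
    have "x ^ (2 * n) / fact (2 * n) \<le> (x\<^sup>2 / 2) ^ n / fact n" for n
    proof -
      have "2 ^ n * fact n \<le> (fact (2 * n) :: real)"
      proof (induction n)
        case (Suc n)
        have "2 ^ Suc n * fact (Suc n) = (2 * (1 + real n)) * (2 ^ n * fact n)" by simp
        also have "\<dots> \<le> ((2 + 2 * real n) * (1 + 2 * real n)) * fact (2 * n)"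
          by (intro mult_mono Suc.IH) auto
        finally show ?case by (simp add: algebra_simps)
      qed simp
      then have "x ^ (2 * n) / fact (2 * n) \<le> x ^ (2 * n) / (2 ^ n * fact n)"
        by (intro divide_left_mono) auto
      then show ?thesis by (simp add: power_mult power_divide)
    qed
    then have "cosh x \<le> exp (x\<^sup>2 / 2)" using sums_le[OF _ c e] by blast
    then show ?thesis by (simp add: cosh_def)
  qed
  have "(\<Sum>J\<in>Pow {..<m}. exp (l * ((\<Sum>i\<in>J. d i) - (\<Sum>i\<in>{..<m}-J. d i))))
     = (\<Sum>J\<in>Pow {..<m}. (\<Prod>i\<in>J. exp (l * d i)) * (\<Prod>i\<in>{..<m}-J. exp (- (l * d i))))"
  proof (intro sum.cong refl)
    fix J assume "J \<in> Pow {..<m}"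
    then have f: "finite J" "finite ({..<m}-J)" by (auto intro: finite_subset)
    show "exp (l * ((\<Sum>i\<in>J. d i) - (\<Sum>i\<in>{..<m}-J. d i))) = (\<Prod>i\<in>J. exp (l * d i)) * (\<Prod>i\<in>{..<m}-J. exp (- (l * d i)))"
      using f by (simp add: exp_sum[symmetric] exp_add[symmetric] sum_negf sum_distrib_left right_diff_distrib)
  qed
  also have "\<dots> = (\<Prod>i<m. exp (l * d i) + exp (- (l * d i)))"
    by (simp add: prod_add)
  also have "\<dots> \<le> (\<Prod>i<m. 2 * exp (2 * l\<^sup>2))"
  proof (intro prod_mono conjI)
    fix i assume "i \<in> {..<m}"
    then have "\<bar>d i\<bar>^2 \<le> 2^2" using d[of i] by (intro power_mono) auto
    then have "l\<^sup>2 * (d i)\<^sup>2 \<le> l\<^sup>2 * 4" by (intro mult_left_mono) auto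
    then have "(l * d i)\<^sup>2 / 2 \<le> 2 * l\<^sup>2"
      by (simp add: power_mult_distrib)
    then show "exp (l * d i) + exp (- (l * d i)) \<le> 2 * exp (2 * l\<^sup>2)"
      using cosh_le[of "l * d i"] by (meson exp_le_cancel_iff mult_le_cancel_left_pos order_trans zero_less_numeral)
  qed (simp add: add_nonneg_nonneg)
  also have "\<dots> = 2 ^ m * exp (2 * l\<^sup>2 * m)"
    by (simp add: power_mult_distrib exp_of_nat_mult[symmetric] mult_ac)
  finally show ?thesis .
qed

text \<open>Hoeffding's inequality for uniformly random signs, \<open>J\<close> being the set of indices with sign \<open>+1\<close>.\<close>
lemma card_large_signed_sums:
  fixes d :: "nat \<Rightarrow> real"
  assumes d: "\<And>i. i < m \<Longrightarrow> \<bar>d i\<bar> \<le> 2" and t: "0 \<le> t"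
  shows "card {J \<in> Pow {..<m}. m * t < (\<Sum>i\<in>J. d i) - (\<Sum>i\<in>{..<m}-J. d i)} \<le> 2 ^ m * exp (- (m * t\<^sup>2 / 8))"
proof -
  let ?S = "\<lambda>J. (\<Sum>i\<in>J. d i) - (\<Sum>i\<in>{..<m}-J. d i)"
  let ?G = "{J \<in> Pow {..<m}. m * t < ?S J}"
  have fin: "finite (Pow {..<m})" by simp
  \<comment> \<open>Markov's inequality for the exponential moment with parameter l = t / 4, the
    minimiser of 2 l^2 m - l m t.\<close>
  have "card ?G * exp (t / 4 * (m * t)) = (\<Sum>J\<in>?G. exp (t / 4 * (m * t)))" by simp
  also have "\<dots> \<le> (\<Sum>J\<in>?G. exp (t / 4 * ?S J))"
    using t by (intro sum_mono) (auto intro!: mult_left_mono divide_right_mono)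
  also have "\<dots> \<le> (\<Sum>J\<in>Pow {..<m}. exp (t / 4 * ?S J))"
    by (intro sum_mono2) auto
  also have "\<dots> \<le> 2 ^ m * exp (2 * (t / 4)\<^sup>2 * m)"
    by (rule sum_sgn_exp_le[OF d])
  finally have "card ?G \<le> 2 ^ m * exp (2 * (t / 4)\<^sup>2 * m) * exp (- (t / 4 * (m * t)))"
    by (simp add: exp_minus field_simps)
  also have "\<dots> = 2 ^ m * exp (- (m * t\<^sup>2 / 8))"
    unfolding mult.assoc exp_add[symmetric] by (simp add: power2_eq_square field_simps)
  finally show ?thesis .
qed

context sequence_space
begin

text \<open>Hoeffding's inequality bounds the probability by exp (- m t^2 / 8), which the condition
  \<open>8 \<le> m * t\<^sup>2\<close> keeps below 1 / e. In the symmetrization it guarantees that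
  the ghost sample is typical at least half of the time.\<close>

lemma prob_average_ge:
  fixes g :: "'a \<Rightarrow> real" and t :: real and m :: nat
  assumes g: "g \<in> borel_measurable M" and b: "\<And>z. z \<in> space M \<Longrightarrow> \<bar>g z\<bar> \<le> 1"
    and t: "t > 0" "8 \<le> m * t\<^sup>2"
  shows "measure S {\<omega> \<in> space S. (\<Sum>i<m. g (\<omega> i)) \<le> m * (\<integral>z. g z \<partial>M) - m * t / 2} \<le> 1 / 2"
proof -
  have m: "m > 0" using t by (cases "m = 0") auto
  have ind0: "P.indep_vars (\<lambda>_. M) (\<lambda>i \<omega>. \<omega> i) (UNIV :: nat set)"
    by (subst P.indep_vars_iff_distr_eq_PiM) (auto simp: PiM_component restrict_UNIV cong: PiM_cong)
  have ind: "P.indep_vars (\<lambda>_. borel) (\<lambda>i \<omega>. g (\<omega> i)) {..<m}"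
    using P.indep_vars_compose2[OF ind0, of "\<lambda>_. g" "\<lambda>_. borel"] g P.indep_vars_subset by blast
  have E: "(\<integral>\<omega>. g (\<omega> i) \<partial>S) = (\<integral>z. g z \<partial>M)" for i
  proof -
    have "(\<integral>z. g z \<partial>M) = (\<integral>z. g z \<partial>distr S M (\<lambda>\<omega>. \<omega> i))"
      by (subst PiM_component) auto
    also have "\<dots> = (\<integral>\<omega>. g (\<omega> i) \<partial>S)" using g by (subst integral_distr) auto
    finally show ?thesis by simp
  qed
  interpret H: Hoeffding_ineq S "{..<m}" "\<lambda>i \<omega>. g (\<omega> i)" "\<lambda>_. -1" "\<lambda>_. 1" "\<Sum>i<m. (\<integral>\<omega>. g (\<omega> i) \<partial>S)"
  proof (unfold_locales, goal_cases)
    case (3 i)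
    then show ?case by (intro AE_I2) (use b in \<open>force simp: space_PiM abs_le_iff\<close>)
  qed (auto simp: ind)
  have "measure S {\<omega> \<in> space S. (\<Sum>i<m. g (\<omega> i)) \<le> m * (\<integral>z. g z \<partial>M) - m * t / 2} \<le> exp (-2 * (m * t / 2)\<^sup>2 / (m * 4))"
    using H.Hoeffding_ineq_le[of "m * t / 2"] m t by (simp add: E mult_ac)
  also have "\<dots> = exp (- (m * t\<^sup>2 / 8))"
    using m by (simp add: power2_eq_square field_simps)
  also have "\<dots> \<le> exp (- 1)" using t by simp
  also have "\<dots> \<le> 1 / 2"
    using exp_ge_add_one_self[of 1] by (simp add: exp_minus field_simps)
  finally show ?thesis .
qed


text \<open>Random signs are realised without further randomness: a permutation of the coordinates
  preserves the product measure, and exchanging sample and ghost sample at the positions in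
  \<open>J\<close> flips the signs of exactly those differences.\<close>

definition swap_block :: "nat \<Rightarrow> nat set \<Rightarrow> nat \<Rightarrow> nat" where
  "swap_block m J n = (if n < m \<and> n \<in> J then n + m else if m \<le> n \<and> n - m \<in> J then n - m else n)"

lemma swap_block_involution: "J \<subseteq> {..<m} \<Longrightarrow> swap_block m J (swap_block m J n) = n"
  by (auto simp: swap_block_def)

lemma distr_swap_block:
  assumes "J \<subseteq> {..<m}"
  shows "distr S S (\<lambda>\<omega> n. \<omega> (swap_block m J n)) = S"
proof -
  have "inj (swap_block m J)"
    using swap_block_involution[OF assms] by (metis injI)
  then show ?thesis
    using distr_PiM_reindex[of UNIV "\<lambda>_. M" "swap_block m J" UNIV] M.prob_space_axioms
    by (simp add: restrict_UNIV)
qed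

lemma measurable_swap_block: "(\<lambda>\<omega> n. \<omega> (swap_block m J n)) \<in> measurable S S"
  by (intro measurable_PiM_single') (auto simp: space_PiM)

text \<open>The first \<open>m\<close> coordinates are the sample and the next \<open>m\<close> coordinates the ghost sample.\<close>
lemma symmetrization:
  fixes h :: "'v \<Rightarrow> 'a \<Rightarrow> real" and t :: real and m :: nat
  assumes V: "countable V"
    and h[measurable]: "\<And>v. v \<in> V \<Longrightarrow> h v \<in> borel_measurable M"
    and b: "\<And>v z. v \<in> V \<Longrightarrow> z \<in> space M \<Longrightarrow> \<bar>h v z\<bar> \<le> 1"
    and t: "t > 0" "8 \<le> m * t\<^sup>2"
  shows "measure S {\<omega> \<in> space S. \<exists>v\<in>V. m * t < m * (\<integral>z. h v z \<partial>M) - (\<Sum>i<m. h v (\<omega> i))}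
    \<le> 2 * measure S {\<omega> \<in> space S. \<exists>v\<in>V. m * t / 2 < (\<Sum>i<m. h v (\<omega> (i + m)) - h v (\<omega> i))}"
    (is "measure S ?A \<le> 2 * measure S ?B")
proof -
  have hc[measurable]: "(\<lambda>\<omega>. h v (\<omega> i)) \<in> borel_measurable S" if "v \<in> V" for v i
    using that by measurable
  have A[measurable]: "?A \<in> sets S"
    by (intro sets.sets_Collect_countable_Ex'[OF _ V]) measurable
  have B[measurable]: "?B \<in> sets S"
    by (intro sets.sets_Collect_countable_Ex'[OF _ V]) measurable
  interpret SS: pair_sigma_finite S S ..
  have "emeasure S ?B = emeasure (distr (S \<Otimes>\<^sub>M S) S (\<lambda>(\<omega>, \<omega>'). comb_seq m \<omega> \<omega>')) ?B"
    by (simp only: PiM_comb_seq)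
  also have "\<dots> = emeasure (S \<Otimes>\<^sub>M S) ((\<lambda>(\<omega>, \<omega>'). comb_seq m \<omega> \<omega>') -` ?B \<inter> space (S \<Otimes>\<^sub>M S))"
    by (rule emeasure_distr[OF measurable_comb_seq B])
  also have "\<dots> = (\<integral>\<^sup>+\<omega>. emeasure S (Pair \<omega> -` ((\<lambda>(\<omega>, \<omega>'). comb_seq m \<omega> \<omega>') -` ?B \<inter> space (S \<Otimes>\<^sub>M S))) \<partial>S)"
    by (intro P.emeasure_pair_measure_alt measurable_sets[OF measurable_comb_seq B])
  also have "\<dots> \<ge> (\<integral>\<^sup>+\<omega>. ennreal (1/2) * indicator ?A \<omega> \<partial>S)"
  proof (rule nn_integral_mono)
    fix \<omega> assume w: "\<omega> \<in> space S"
    let ?P = "Pair \<omega> -` ((\<lambda>(\<omega>, \<omega>'). comb_seq m \<omega> \<omega>') -` ?B \<inter> space (S \<Otimes>\<^sub>M S))"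
    have Pm: "?P \<in> sets S"
      by (rule sets_Pair1[OF measurable_sets[OF measurable_comb_seq B]])
    show "ennreal (1/2) * indicator ?A \<omega> \<le> emeasure S ?P"
    proof (cases "\<omega> \<in> ?A")
      case True
      \<comment> \<open>The witness depends on the sample alone, so for the independent ghost sample
        the bound for a single function is enough.\<close>
      then obtain v where v: "v \<in> V" and vA: "m * t < m * (\<integral>z. h v z \<partial>M) - (\<Sum>i<m. h v (\<omega> i))" by auto
      let ?C = "{\<omega>' \<in> space S. (\<Sum>i<m. h v (\<omega>' i)) \<le> m * (\<integral>z. h v z \<partial>M) - m * t / 2}"
      have Cm[measurable]: "?C \<in> sets S" using v by measurable
      have "measure S ?C \<le> 1/2"
        using prob_average_ge[OF h[OF v] b[OF v] t] by simp
      then have "1/2 \<le> measure S (space S - ?C)"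
        by (subst P.prob_compl) auto
      also have "\<dots> \<le> measure S ?P"
      proof (rule P.finite_measure_mono[OF _ Pm], rule subsetI)
        fix \<omega>' assume *: "\<omega>' \<in> space S - ?C"
        have sp: "comb_seq m \<omega> \<omega>' \<in> space S"
          using measurable_space[OF measurable_comb_seq, of "(\<omega>, \<omega>')" M m] w * by (auto simp: space_pair_measure)
        have "(\<Sum>i<m. h v (comb_seq m \<omega> \<omega>' (i + m)) - h v (comb_seq m \<omega> \<omega>' i)) = (\<Sum>i<m. h v (\<omega>' i)) - (\<Sum>i<m. h v (\<omega> i))"
          by (simp add: sum_subtractf comb_seq_add comb_seq_less)
        then have "comb_seq m \<omega> \<omega>' \<in> ?B" using * vA v sp by (auto intro!: bexI[of _ v])
        then show "\<omega>' \<in> ?P" using w * by (auto simp: space_pair_measure)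
      qed
      finally have "ennreal (1/2) \<le> ennreal (measure S ?P)" by (rule ennreal_leI)
      then show ?thesis using True by (simp add: P.emeasure_eq_measure)
    qed simp
  qed
  finally have "ennreal (1/2) * emeasure S ?A \<le> emeasure S ?B"
    by (subst (asm) nn_integral_cmult_indicator) auto
  then have "ennreal (1/2 * measure S ?A) \<le> ennreal (measure S ?B)"
    unfolding P.emeasure_eq_measure by (subst ennreal_mult) auto
  then show ?thesis by (subst (asm) ennreal_le_iff) auto
qed

text \<open>The measure of the symmetrized event is averaged over all \<open>2 ^ m\<close> swaps,
  and for each fixed sequence the bad swaps are counted. The representatives \<open>R\<close> may
  depend on the sequence. Replacing \<open>v\<close> by its representative changes each difference
  by at most 2 * t / 8, so of the deviation t / 2 there remains t / 4, and the bound for signed sums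
  gives the exponent (t / 4)^2 / 8 = t^2 / 128. A union over \<open>R\<close> contributes the factor
  \<open>N\<close>.\<close>

lemma uniform_law:
  fixes h :: "'v \<Rightarrow> 'a \<Rightarrow> real" and t :: real and m N :: nat
  assumes V: "countable V"
    and h: "\<And>v. v \<in> V \<Longrightarrow> h v \<in> borel_measurable M"
    and b: "\<And>v z. v \<in> V \<Longrightarrow> z \<in> space M \<Longrightarrow> \<bar>h v z\<bar> \<le> 1"
    and t: "t > 0" "8 \<le> m * t\<^sup>2"
    and cover: "\<And>\<omega>. (\<And>i. \<omega> i \<in> space M) \<Longrightarrow> \<exists>R\<subseteq>V. finite R \<and> card R \<le> N \<and>
      (\<forall>v\<in>V. \<exists>u\<in>R. \<forall>i<2*m. \<bar>h v (\<omega> i) - h u (\<omega> i)\<bar> \<le> t / 8)"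
  shows "measure S {\<omega> \<in> space S. \<exists>v\<in>V. m * t < m * (\<integral>z. h v z \<partial>M) - (\<Sum>i<m. h v (\<omega> i))}
    \<le> 2 * N * exp (- (m * t\<^sup>2 / 128))"
proof -
  let ?b = "\<lambda>\<omega>. \<exists>v\<in>V. m * t / 2 < (\<Sum>i<m. h v (\<omega> (i + m)) - h v (\<omega> i))"
  let ?B = "{\<omega> \<in> space S. ?b \<omega>}"
  let ?sw = "\<lambda>J \<omega> n. \<omega> (swap_block m J n)"
  let ?BJ = "\<lambda>J. ?sw J -` ?B \<inter> space S"
  have hc[measurable]: "(\<lambda>\<omega>. h v (\<omega> i)) \<in> borel_measurable S" if "v \<in> V" for v i
    using that h by measurable
  have B[measurable]: "?B \<in> sets S"
    by (intro sets.sets_Collect_countable_Ex'[OF _ V]) measurable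
  have BJ: "?BJ J \<in> sets S" for J
    by (rule measurable_sets[OF measurable_swap_block B])
  have "2 ^ m * measure S ?B = (\<Sum>J\<in>Pow {..<m}. measure S ?B)" by (simp add: card_Pow)
  also have "\<dots> = (\<Sum>J\<in>Pow {..<m}. measure S (?BJ J))"
  proof (intro sum.cong refl)
    fix J assume "J \<in> Pow {..<m}"
    then have "measure S ?B = measure (distr S S (?sw J)) ?B" by (subst distr_swap_block) auto
    also have "\<dots> = measure S (?BJ J)" by (rule measure_distr[OF measurable_swap_block B])
    finally show "measure S ?B = measure S (?BJ J)" .
  qed
  also have "\<dots> = (\<Sum>J\<in>Pow {..<m}. (\<integral>\<omega>. indicat_real (?BJ J) \<omega> \<partial>S))"
    using BJ by simp
  also have "\<dots> = (\<integral>\<omega>. (\<Sum>J\<in>Pow {..<m}. indicat_real (?BJ J) \<omega>) \<partial>S)"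
    by (rule Bochner_Integration.integral_sum[symmetric]) (use BJ in \<open>auto simp: less_top[symmetric]\<close>)
  also have "\<dots> \<le> (\<integral>\<omega>. N * (2 ^ m * exp (- (m * t\<^sup>2 / 128))) \<partial>S)"
  proof (rule integral_mono)
    show "integrable S (\<lambda>\<omega>. \<Sum>J\<in>Pow {..<m}. indicat_real (?BJ J) \<omega>)"
      by (intro Bochner_Integration.integrable_sum) (use BJ in \<open>auto simp: less_top[symmetric]\<close>)
    fix \<omega> assume w: "\<omega> \<in> space S"
    then have wi: "\<omega> i \<in> space M" for i by (auto simp: space_PiM)
    obtain R where R: "R \<subseteq> V" "finite R" "card R \<le> N"
      and Rc: "\<And>v. v \<in> V \<Longrightarrow> \<exists>u\<in>R. \<forall>i<2*m. \<bar>h v (\<omega> i) - h u (\<omega> i)\<bar> \<le> t / 8"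
      using cover[of \<omega>, OF wi] by blast
    let ?d = "\<lambda>u i. h u (\<omega> i) - h u (\<omega> (i + m))"
    let ?G = "\<lambda>u. {J \<in> Pow {..<m}. m * (t / 4) < (\<Sum>i\<in>J. ?d u i) - (\<Sum>i\<in>{..<m}-J. ?d u i)}"
    have sub: "{J \<in> Pow {..<m}. \<omega> \<in> ?BJ J} \<subseteq> (\<Union>u\<in>R. ?G u)"
    proof safe
      fix J v assume J: "J \<subseteq> {..<m}" and v: "v \<in> V"
        and vB: "m * t / 2 < (\<Sum>i<m. h v (?sw J \<omega> (i + m)) - h v (?sw J \<omega> i))"
      obtain u where u: "u \<in> R" and uc: "\<And>i. i < 2*m \<Longrightarrow> \<bar>h v (\<omega> i) - h u (\<omega> i)\<bar> \<le> t / 8"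
        using Rc[OF v] by blast
      let ?s = "\<lambda>i. if i \<in> J then 1 else -1 :: real"
      have "(\<Sum>i<m. h v (?sw J \<omega> (i + m)) - h v (?sw J \<omega> i)) = (\<Sum>i<m. ?s i * ?d v i)"
        using J by (intro sum.cong) (auto simp: swap_block_def)
      also have "\<dots> \<le> (\<Sum>i<m. ?s i * ?d u i + t / 4)"
      proof (rule sum_mono)
        fix i assume "i \<in> {..<m}"
        then have "\<bar>h v (\<omega> i) - h u (\<omega> i)\<bar> \<le> t / 8" "\<bar>h v (\<omega> (i+m)) - h u (\<omega> (i+m))\<bar> \<le> t / 8"
          using uc by auto
        then have *: "h v (\<omega> i) - h u (\<omega> i) \<le> t / 8" "h u (\<omega> i) - h v (\<omega> i) \<le> t / 8"
            "h v (\<omega> (i+m)) - h u (\<omega> (i+m)) \<le> t / 8" "h u (\<omega> (i+m)) - h v (\<omega> (i+m)) \<le> t / 8"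
          by (auto simp only: abs_le_iff minus_diff_eq)
        show "?s i * ?d v i \<le> ?s i * ?d u i + t / 4"
        proof (cases "i \<in> J")
          case True
          then show ?thesis using * by simp
        next
          case False
          then show ?thesis using * by simp
        qed
      qed
      also have "\<dots> = (\<Sum>i<m. ?s i * ?d u i) + m * t / 4" by (simp add: sum.distrib)
      also have "(\<Sum>i<m. ?s i * ?d u i) = (\<Sum>i\<in>J. ?s i * ?d u i) + (\<Sum>i\<in>{..<m}-J. ?s i * ?d u i)"
        using J by (subst sum.subset_diff[of J]) auto
      also have "\<dots> = (\<Sum>i\<in>J. ?d u i) - (\<Sum>i\<in>{..<m}-J. ?d u i)"
        unfolding diff_conv_add_uminus sum_negf[symmetric]
        by (intro arg_cong2[where f="(+)"] sum.cong) auto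
      finally have "m * (t / 4) < (\<Sum>i\<in>J. ?d u i) - (\<Sum>i\<in>{..<m}-J. ?d u i)"
        using vB by (simp add: field_simps)
      then have "J \<in> ?G u" using J by simp
      then show "J \<in> (\<Union>u\<in>R. ?G u)" using u by blast
    qed
    have Gu: "card (?G u) \<le> 2 ^ m * exp (- (m * t\<^sup>2 / 128))" if "u \<in> R" for u
    proof -
      have "\<bar>?d u i\<bar> \<le> 2" for i
        using b[of u "\<omega> i"] b[of u "\<omega> (i+m)"] that R wi by fastforce
      then have "card (?G u) \<le> 2 ^ m * exp (- (m * (t / 4)\<^sup>2 / 8))"
        using t by (intro card_large_signed_sums) auto
      then show ?thesis by (simp add: power_divide)
    qed
    have "(\<Sum>J\<in>Pow {..<m}. indicat_real (?BJ J) \<omega>) = card {J \<in> Pow {..<m}. \<omega> \<in> ?BJ J}"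
      by (simp add: indicator_def sum.If_cases Int_def)
    also have "\<dots> \<le> real (card (\<Union>u\<in>R. ?G u))"
      using sub R(2) by (intro of_nat_mono card_mono) auto
    also have "\<dots> \<le> real (\<Sum>u\<in>R. card (?G u))"
      using card_UN_le[OF R(2)] by (rule of_nat_mono)
    also have "\<dots> \<le> card R * (2 ^ m * exp (- (m * t\<^sup>2 / 128)))"
      unfolding of_nat_sum using Gu by (intro sum_bounded_above) auto
    also have "\<dots> \<le> N * (2 ^ m * exp (- (m * t\<^sup>2 / 128)))"
      using R(3) by (intro mult_right_mono) auto
    finally show "(\<Sum>J\<in>Pow {..<m}. indicat_real (?BJ J) \<omega>) \<le> N * (2 ^ m * exp (- (m * t\<^sup>2 / 128)))" .
  qed simp
  also have "\<dots> = 2 ^ m * (N * exp (- (m * t\<^sup>2 / 128)))" by (simp add: P.prob_space)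
  finally have "measure S ?B \<le> N * exp (- (m * t\<^sup>2 / 128))" by simp
  moreover have "measure S {\<omega> \<in> space S. \<exists>v\<in>V. m * t < m * (\<integral>z. h v z \<partial>M) - (\<Sum>i<m. h v (\<omega> i))}
      \<le> 2 * measure S ?B"
    by (rule symmetrization[OF V h b t])
  ultimately show ?thesis by simp
qed

end

section \<open>Counting halfspace patterns\<close>

definition shattered :: "'a set set \<Rightarrow> 'a set \<Rightarrow> bool" where
  "shattered F S \<longleftrightarrow> (\<forall>T\<subseteq>S. \<exists>A\<in>F. A \<inter> S = T)"

text \<open>Pajor's form of the Sauer--Shelah lemma.\<close>
lemma card_le_card_shattered:
  assumes "finite X" "F \<subseteq> Pow X"
  shows "card F \<le> card {S. S \<subseteq> X \<and> shattered F S}"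
  using assms
proof (induction X arbitrary: F rule: finite_induct)
  case empty
  then consider "F = {}" | "F = {{}}" by auto
  then show ?case
  proof cases
    case 1
    show ?thesis unfolding 1 by (simp only: card.empty le0)
  next
    case 2
    then have "{S. S \<subseteq> {} \<and> shattered F S} = {{}}" by (auto simp: shattered_def)
    then show ?thesis unfolding 2 by simp
  qed
next
  case (insert x X)
  let ?d = "\<lambda>A. A - {x}"
  \<comment> \<open>The union of \<open>F0\<close> and \<open>F1\<close> consists of the traces on
    \<open>X\<close>, and the intersection of those traces that occur both with and without
    \<open>x\<close>. A set shattered by the intersection stays shattered by \<open>F\<close> after
    \<open>x\<close> is added, so the two families of shattered sets that arise are
    disjoint.\<close>
  define F0 where "F0 = {A \<in> F. x \<notin> A}"
  define F1 where "F1 = ?d ` {A \<in> F. x \<in> A}"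
  have fin: "finite F" using insert.hyps insert.prems by (meson finite.insertI finite_Pow_iff finite_subset)
  have f01: "finite F0" "finite F1" using fin by (auto simp: F0_def F1_def)
  have "card F = card F0 + card {A \<in> F. x \<in> A}"
    unfolding F0_def using fin by (subst card_Un_disjoint[symmetric]) (auto intro: arg_cong[where f=card])
  also have "card {A \<in> F. x \<in> A} = card F1"
    unfolding F1_def by (intro card_image[symmetric] inj_onI) (metis (no_types, lifting) insert_Diff mem_Collect_eq)
  finally have cF: "card F = card (F0 \<union> F1) + card (F0 \<inter> F1)"
    using card_Un_Int[OF f01] by simp
  have subs: "F0 \<union> F1 \<subseteq> Pow X" "F0 \<inter> F1 \<subseteq> Pow X"
    using insert.prems by (auto simp: F0_def F1_def)
  let ?s = "\<lambda>F. {S. S \<subseteq> X \<and> shattered F S}"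
  have fs: "finite (?s G)" for G using insert.hyps by simp
  have sub1: "?s (F0 \<union> F1) \<subseteq> {S. S \<subseteq> insert x X \<and> x \<notin> S \<and> shattered F S}"
  proof (rule subsetI, unfold mem_Collect_eq, elim conjE)
    fix S assume S: "S \<subseteq> X" "shattered (F0 \<union> F1) S"
    have xS: "x \<notin> S" using S(1) insert.hyps by auto
    have "shattered F S"
      unfolding shattered_def
    proof (intro allI impI)
      fix T assume T: "T \<subseteq> S"
      obtain A where A: "A \<in> F0 \<union> F1" "A \<inter> S = T"
        using S(2)[unfolded shattered_def, rule_format, OF T] by blast
      consider "A \<in> F" | B where "B \<in> F" "A = B - {x}" using A(1) by (auto simp: F0_def F1_def)
      then show "\<exists>A\<in>F. A \<inter> S = T"
      proof cases
        case 1
        show ?thesis by (rule bexI[of _ A]) (rule A(2), rule 1)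
      next
        case (2 B)
        then have "B \<inter> S = T" using A(2) xS by blast
        then show ?thesis using 2(1) by (rule bexI)
      qed
    qed
    then show "S \<subseteq> insert x X \<and> x \<notin> S \<and> shattered F S" using S(1) xS by blast
  qed
  have sub2: "insert x ` ?s (F0 \<inter> F1) \<subseteq> {S. S \<subseteq> insert x X \<and> x \<in> S \<and> shattered F S}"
  proof (rule image_subsetI, unfold mem_Collect_eq, elim conjE)
    fix S assume S: "S \<subseteq> X" "shattered (F0 \<inter> F1) S"
    then have xS: "x \<notin> S" using insert.hyps by auto
    have "shattered F (insert x S)"
      unfolding shattered_def
    proof (intro allI impI)
      fix T assume T: "T \<subseteq> insert x S"
      then have "T - {x} \<subseteq> S" by blast
      from S(2)[unfolded shattered_def, rule_format, OF this]
      obtain A where A: "A \<in> F0" "A \<in> F1" "A \<inter> S = T - {x}" by blast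
      from A(2) obtain B where B: "B \<in> F" "x \<in> B" "A = B - {x}" by (auto simp: F1_def)
      show "\<exists>A\<in>F. A \<inter> insert x S = T"
      proof (cases "x \<in> T")
        case True
        then show ?thesis using A B xS T by (intro bexI[of _ B]) auto
      next
        case False
        then show ?thesis using A T by (intro bexI[of _ A]) (auto simp: F0_def)
      qed
    qed
    then show "insert x S \<subseteq> insert x X \<and> x \<in> insert x S \<and> shattered F (insert x S)" using S(1) by blast
  qed
  have "card (insert x ` ?s (F0 \<inter> F1)) = card (?s (F0 \<inter> F1))"
  proof (intro card_image inj_onI)
    fix A B assume AB: "A \<in> ?s (F0 \<inter> F1)" "B \<in> ?s (F0 \<inter> F1)" "insert x A = insert x B"
    then have "x \<notin> A" "x \<notin> B" using insert.hyps by auto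
    then show "A = B" using AB(3) by (simp add: insert_ident)
  qed
  then have "card F \<le> card (?s (F0 \<union> F1)) + card (insert x ` ?s (F0 \<inter> F1))"
    unfolding cF using insert.IH[OF subs(1)] insert.IH[OF subs(2)] by linarith
  also have "\<dots> \<le> card {S. S \<subseteq> insert x X \<and> x \<notin> S \<and> shattered F S} + card {S. S \<subseteq> insert x X \<and> x \<in> S \<and> shattered F S}"
    using insert.hyps by (intro add_mono card_mono sub1 sub2) auto
  also have "\<dots> = card {S. S \<subseteq> insert x X \<and> shattered F S}"
    using insert.hyps by (subst card_Un_disjoint[symmetric]) (auto intro: arg_cong[where f=card])
  finally show ?case .
qed

text \<open>A set of at most d + 1 elements arises from one of at most d elements by adding one
  element or none, so each increase of d costs a factor of \<open>card X + 1\<close>.\<close>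

lemma card_small_subsets:
  assumes X: "finite X"
  shows "card {S. S \<subseteq> X \<and> card S \<le> d} \<le> (card X + 1) ^ d"
proof (induction d)
  case 0
  have "{S. S \<subseteq> X \<and> card S \<le> 0} = {{}}" using finite_subset[OF _ X] by (auto simp: card_eq_0_iff)
  then show ?case by simp
next
  case (Suc d)
  let ?A = "\<lambda>d. {S. S \<subseteq> X \<and> card S \<le> d}"
  let ?f = "\<lambda>(S, z). case z of None \<Rightarrow> S | Some x \<Rightarrow> insert x S"
  let ?O = "insert None (Some ` X)"
  have "?A (Suc d) \<subseteq> ?f ` (?A d \<times> ?O)"
  proof
    fix S assume S: "S \<in> ?A (Suc d)"
    show "S \<in> ?f ` (?A d \<times> ?O)"
    proof (cases "card S \<le> d")
      case True
      then show ?thesis using S by (intro image_eqI[of _ _ "(S, None)"]) auto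
    next
      case False
      then obtain x where x: "x \<in> S" by fastforce
      have "finite S" using S X finite_subset by auto
      then have "card (S - {x}) < Suc d" using S x card_Diff1_less[of S x] by simp
      then have "S - {x} \<subseteq> X" "card (S - {x}) \<le> d" using S by auto
      moreover have "S = insert x (S - {x})" "x \<in> X" using S x by auto
      ultimately show ?thesis by (intro image_eqI[of _ _ "(S - {x}, Some x)"]) (simp_all del: card_Diff_insert)
    qed
  qed
  then have "card (?A (Suc d)) \<le> card (?A d \<times> ?O)"
    using X by (intro surj_card_le) auto
  also have "\<dots> = card (?A d) * (card X + 1)"
    using X by (subst card_cartesian_product, subst card_insert_disjoint) (auto simp: card_image)
  also have "\<dots> \<le> (card X + 1) ^ d * (card X + 1)" using Suc.IH by (rule mult_right_mono) simp
  finally show ?case unfolding power_Suc2 .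
qed

text \<open>Elimination of the last coordinate: a vector \<open>q\<close> where it is nonzero is the
  pivot, the remaining vectors are reduced by multiples of it, and the coefficient of
  \<open>q\<close> is fixed at the end so that the last coordinate cancels.\<close>

lemma linear_dependence:
  fixes y :: "'a \<Rightarrow> nat \<Rightarrow> real"
  assumes "finite S" "d < card S"
  shows "\<exists>c. (\<exists>p\<in>S. c p \<noteq> 0) \<and> (\<forall>k<d. (\<Sum>p\<in>S. c p * y p k) = 0)"
  using assms
proof (induction d arbitrary: S y)
  case 0
  then show ?case by (intro exI[of _ "\<lambda>_. 1"]) (auto simp: card_gt_0_iff)
next
  case (Suc d)
  show ?case
  proof (cases "\<forall>p\<in>S. y p d = 0")
    case True
    obtain c where c: "\<exists>p\<in>S. c p \<noteq> 0" "\<forall>k<d. (\<Sum>p\<in>S. c p * y p k) = 0"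
      using Suc.IH[of S y] Suc.prems by auto
    have "(\<Sum>p\<in>S. c p * y p k) = 0" if "k < Suc d" for k
      using c(2) True that by (cases "k = d") (auto simp: less_Suc_eq)
    then show ?thesis using c(1) by blast
  next
    case False
    then obtain q where q: "q \<in> S" "y q d \<noteq> 0" by blast
    let ?S = "S - {q}"
    let ?y = "\<lambda>p k. y p k - y p d / y q d * y q k"
    have "d < card ?S" "finite ?S" using Suc.prems q by auto
    from Suc.IH[OF this(2,1), of ?y] obtain c
      where c: "\<exists>p\<in>?S. c p \<noteq> 0" "\<And>k. k < d \<Longrightarrow> (\<Sum>p\<in>?S. c p * ?y p k) = 0" by auto
    define c' where "c' = c(q := - (\<Sum>p\<in>?S. c p * y p d) / y q d)"
    have "(\<Sum>p\<in>S. c' p * y p k) = (\<Sum>p\<in>?S. c p * ?y p k)" for k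
    proof -
      have "(\<Sum>p\<in>S. c' p * y p k) = c' q * y q k + (\<Sum>p\<in>?S. c' p * y p k)"
        using Suc.prems q by (subst sum.remove[of _ q]) auto
      also have "(\<Sum>p\<in>?S. c' p * y p k) = (\<Sum>p\<in>?S. c p * y p k)"
        by (intro sum.cong) (auto simp: c'_def)
      also have "c' q * y q k = - (\<Sum>p\<in>?S. c p * (y p d / y q d * y q k))"
        by (simp add: c'_def sum_divide_distrib sum_distrib_right mult.assoc)
      finally show ?thesis by (simp add: sum_subtractf right_diff_distrib)
    qed
    moreover have "(\<Sum>p\<in>?S. c p * ?y p k) = 0" if "k < Suc d" for k
      using c(2) that q(2) by (cases "k = d") (auto simp: less_Suc_eq)
    moreover have "\<exists>p\<in>S. c' p \<noteq> 0" using c(1) by (auto simp: c'_def)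
    ultimately show ?thesis by auto
  qed
qed

text \<open>With more than \<open>d\<close> points there is a linear relation with a positive
  coefficient. A halfspace that selects exactly the points with positive coefficients would make the
  combination of the values \<open>v \<cdot> y p\<close> strictly positive, although the relation
  makes it zero.\<close>

lemma card_shattered_halfspaces:
  fixes y :: "'a \<Rightarrow> nat \<Rightarrow> real"
  assumes S: "finite S" "S \<subseteq> X" and sh: "shattered ((\<lambda>v. {p \<in> X. (\<Sum>k<d. v k * y p k) > 0}) ` W) S"
  shows "card S \<le> d"
proof (rule ccontr)
  assume "\<not> card S \<le> d"
  then obtain c0 where c0: "\<exists>p\<in>S. c0 p \<noteq> 0" "\<forall>k<d. (\<Sum>p\<in>S. c0 p * y p k) = 0"
    using linear_dependence[OF S(1), of d y] by auto
  obtain c where c: "\<exists>p\<in>S. c p > 0" "\<And>k. k < d \<Longrightarrow> (\<Sum>p\<in>S. c p * y p k) = 0"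
  proof (cases "\<exists>p\<in>S. c0 p > 0")
    case True
    then show ?thesis using that[of c0] c0 by blast
  next
    case False
    then have "\<exists>p\<in>S. - c0 p > 0" using c0(1) by (metis linorder_neqE_linordered_idom neg_0_less_iff_less)
    then show ?thesis using that[of "\<lambda>p. - c0 p"] c0(2) by (simp add: sum_negf)
  qed
  obtain v where v: "{p \<in> X. (\<Sum>k<d. v k * y p k) > 0} \<inter> S = {p \<in> S. c p > 0}"
    using sh[unfolded shattered_def, rule_format, of "{p \<in> S. c p > 0}"] by blast
  obtain p where p: "p \<in> S" "c p > 0" using c(1) by blast
  have iff: "(\<Sum>k<d. v k * y p k) > 0 \<longleftrightarrow> c p > 0" if "p \<in> S" for p
    using v S(2) that by blast
  have "0 < (\<Sum>p\<in>S. c p * (\<Sum>k<d. v k * y p k))"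
  proof (rule sum_pos2[OF S(1) p(1)])
    show "0 < c p * (\<Sum>k<d. v k * y p k)" using iff[OF p(1)] p(2) by simp
    fix q assume "q \<in> S"
    from iff[OF this] show "0 \<le> c q * (\<Sum>k<d. v k * y q k)"
      by (cases "c q > 0") (simp_all add: not_less mult_nonpos_nonpos)
  qed
  also have "\<dots> = (\<Sum>k<d. v k * (\<Sum>p\<in>S. c p * y p k))"
    by (simp add: sum_distrib_left) (subst sum.swap, simp add: mult_ac)
  also have "\<dots> = 0" using c(2) by simp
  finally show False by simp
qed

definition clip :: "real \<Rightarrow> real \<Rightarrow> real" where
  "clip a z = max (- a) (min a z)"

text \<open>If the clipped values differed by more than the grid step, the first threshold at or
  above \<open>clip a y\<close> would lie strictly below \<open>clip a z\<close> and separate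
  \<open>y\<close> from \<open>z\<close>. The condition \<open>2 * a \<le> N * s\<close> ensures
  that this threshold is among the first \<open>N\<close>.\<close>

lemma clip_close_if_same_thresholds:
  fixes N :: nat and a s y z :: real
  assumes s: "s > 0" "2 * a \<le> N * s" and ab: "\<And>j. j < N \<Longrightarrow> - a + j * s < y \<longleftrightarrow> - a + j * s < z"
  shows "clip a z - clip a y \<le> s"
proof (rule ccontr)
  assume c: "\<not> clip a z - clip a y \<le> s"
  show False
  proof (cases "a < 0")
    \<comment> \<open>For negative \<open>a\<close> the function \<open>clip a\<close> is
      constant.\<close>
    case True
    then show False using c s by (auto simp: clip_def split: if_splits)
  next
    case False
    let ?q = "(clip a y + a) / s"
    have qs: "?q * s = clip a y + a" using s(1) by simp
    have q0: "?q \<ge> 0" using s(1) False by (auto simp: clip_def)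
    define j where "j = nat \<lceil>?q\<rceil>"
    have j: "real j = of_int \<lceil>?q\<rceil>" using q0 by (simp add: j_def)
    have "?q \<le> j" unfolding j by linarith
    then have j1: "clip a y \<le> - a + j * s" using s(1) by (simp add: field_simps)
    have "j < ?q + 1" unfolding j by linarith
    then have "j * s < (?q + 1) * s" using s(1) by (rule mult_strict_right_mono)
    then have j2: "- a + j * s < clip a y + s" unfolding distrib_right qs by simp
    have j3: "- a + j * s < clip a z" using c j2 by linarith
    have "clip a z \<le> a" using False by (auto simp: clip_def)
    then have "j * s < N * s" using j3 s by linarith
    then have jN: "j < N" using s(1) by simp
    have "- a < clip a z" using j1 c s(1) False by (auto simp: clip_def)
    then have "clip a z \<le> z" by (auto simp: clip_def)
    then have "- a + j * s < z" using j3 by linarith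
    moreover have "clip a y < a" using c s(1) False by (auto simp: clip_def)
    then have "y \<le> clip a y" by (auto simp: clip_def)
    then have "\<not> - a + j * s < y" using j1 by linarith
    ultimately show False using ab[OF jN] by blast
  qed
qed

text \<open>A halfspace with normal \<open>v\<close> and threshold \<open>t\<close> is a linear halfspace for the lifted point \<open>(x, -t)\<close>;
  grid thresholds then determine the clipped value \<open>clip a (v \<cdot> x)\<close> up to the grid step.\<close>
lemma halfspace_cover:
  fixes M N n :: nat and a s :: real and x :: "nat \<Rightarrow> nat \<Rightarrow> real"
  assumes s: "s > 0" "2 * a \<le> N * s"
  shows "\<exists>R\<subseteq>W. finite R \<and> card R \<le> (M * N + 1) ^ (n + 1) \<and>
    (\<forall>v\<in>W. \<exists>u\<in>R. \<forall>i<M. \<bar>clip a (dot n v (x i)) - clip a (dot n u (x i))\<bar> \<le> s)"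
proof -
  define X where "X = {..<M} \<times> {..<N}"
  define y :: "nat \<times> nat \<Rightarrow> nat \<Rightarrow> real" where
    "y = (\<lambda>(i, j) k. if k < n then x i k else - (- a + j * s))"
  let ?l = "\<lambda>v :: nat \<Rightarrow> real. v(n := 1)"
  define P where "P v = {p \<in> X. (\<Sum>k<n + 1. v k * y p k) > 0}" for v
  define Q where "Q v = P (?l v)" for v
  have finX: "finite X" by (simp add: X_def)
  have Qi: "(i, j) \<in> Q v \<longleftrightarrow> i < M \<and> j < N \<and> - a + j * s < dot n v (x i)" for i j v
    by (auto simp: Q_def P_def X_def y_def dot_def)
  have QX: "Q ` W \<subseteq> Pow X" by (auto simp: Q_def P_def)
  have "card (Q ` W) \<le> card {S. S \<subseteq> X \<and> shattered (Q ` W) S}"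
    by (rule card_le_card_shattered[OF finX QX])
  also have "\<dots> \<le> card {S. S \<subseteq> X \<and> card S \<le> n + 1}"
  proof (rule card_mono)
    show "finite {S. S \<subseteq> X \<and> card S \<le> n + 1}" using finX by simp
    show "{S. S \<subseteq> X \<and> shattered (Q ` W) S} \<subseteq> {S. S \<subseteq> X \<and> card S \<le> n + 1}"
    proof safe
      fix S assume S: "S \<subseteq> X" "shattered (Q ` W) S"
      have "Q ` W = (\<lambda>v. {p \<in> X. (\<Sum>k<n + 1. v k * y p k) > 0}) ` (?l ` W)"
        unfolding image_image by (intro image_cong refl) (simp only: Q_def P_def)
      then show "card S \<le> n + 1"
        using card_shattered_halfspaces[where S=S and X=X and d="n + 1" and y=y and W="?l ` W"] S finite_subset[OF S(1) finX] by simp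
    qed
  qed
  also have "\<dots> \<le> (card X + 1) ^ (n + 1)" by (rule card_small_subsets[OF finX])
  also have "card X = M * N" by (simp add: X_def)
  finally have cQ: "card (Q ` W) \<le> (M * N + 1) ^ (n + 1)" .
  have fQ: "finite (Q ` W)" using QX finX by (meson finite_Pow_iff finite_subset)
  \<comment> \<open>One representative of each realised pattern, taken from \<open>W\<close> itself,
    so that a cover of the rational vectors consists of rational vectors.\<close>
  define R where "R = inv_into W Q ` (Q ` W)"
  show ?thesis
  proof (intro exI conjI ballI)
    show "R \<subseteq> W" by (auto simp: R_def intro: inv_into_into)
    show "finite R" using fQ by (simp add: R_def)
    show "card R \<le> (M * N + 1) ^ (n + 1)" using cQ card_image_le[OF fQ] unfolding R_def by (rule le_trans[rotated])
    fix v assume v: "v \<in> W"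
    let ?u = "inv_into W Q (Q v)"
    have "Q ?u = Q v" using v by (simp add: f_inv_into_f)
    then have *: "i < M \<Longrightarrow> j < N \<Longrightarrow> - a + j * s < dot n ?u (x i) \<longleftrightarrow> - a + j * s < dot n v (x i)" for i j
      using Qi by (metis (no_types, lifting))
    have "\<bar>clip a (dot n v (x i)) - clip a (dot n ?u (x i))\<bar> \<le> s" if i: "i < M" for i
      using clip_close_if_same_thresholds[OF s, of "dot n ?u (x i)" "dot n v (x i)"]
        clip_close_if_same_thresholds[OF s, of "dot n v (x i)" "dot n ?u (x i)"] *[OF i]
      by (simp add: abs_le_iff)
    then show "\<exists>u\<in>R. \<forall>i<M. \<bar>clip a (dot n v (x i)) - clip a (dot n u (x i))\<bar> \<le> s"
      using v by (intro bexI[of _ ?u]) (auto simp: R_def)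
  qed
qed

section \<open>A uniform law for clipped linear scores\<close>

lemma abs_clip_le: "0 \<le> a \<Longrightarrow> \<bar>clip a z\<bar> \<le> a"
  by (auto simp: clip_def)

lemma clip_lipschitz: "\<bar>clip a y - clip a z\<bar> \<le> \<bar>y - z\<bar>"
  by (auto simp: clip_def max_def min_def abs_if)

lemma clip_measurable [measurable]: "clip a \<in> borel_measurable borel"
  unfolding clip_def by measurable

lemma dot_commute: "dot n u v = dot n v u"
  by (simp add: dot_def mult.commute)

lemma dot_measurable: "(\<lambda>x. dot n v x) \<in> borel_measurable (instance_space n)"
  unfolding dot_def instance_space_def
  by (intro borel_measurable_sum borel_measurable_times measurable_const measurable_restrict_space1) auto

locale example_measure =
  fixes n :: nat and D :: "((nat \<Rightarrow> real) \<times> real) measure"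
  assumes example_distribution: "example_distribution n D"
begin

sublocale sequence_space D
proof -
  interpret prob_space D using example_distribution by (simp add: example_distribution_def)
  show "sequence_space D" ..
qed

lemma sets_D: "sets D = sets (instance_space n \<Otimes>\<^sub>M count_space {-1, 1})"
  using example_distribution by (simp add: example_distribution_def example_space_def)

lemma space_D: "space D = space (instance_space n) \<times> {-1, 1}"
  using sets_eq_imp_space_eq[OF sets_D] by (simp add: space_pair_measure)

lemma label: "z \<in> space D \<Longrightarrow> snd z = -1 \<or> snd z = 1"
  by (auto simp: space_D)

lemma label_abs: "z \<in> space D \<Longrightarrow> \<bar>snd z\<bar> \<le> 1"
  using label[of z] by auto

lemma fst_measurable [measurable]: "fst \<in> measurable D (instance_space n)"
  unfolding measurable_cong_sets[OF sets_D refl] by simp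

lemma snd_measurable [measurable]: "snd \<in> borel_measurable D"
proof -
  have "(snd :: _ \<Rightarrow> real) \<in> measurable (instance_space n \<Otimes>\<^sub>M count_space {-1, 1}) (count_space {-1, 1})"
    by simp
  then have "(\<lambda>z. (\<lambda>x. x) (snd z)) \<in> measurable (instance_space n \<Otimes>\<^sub>M count_space {-1, 1 :: real}) borel"
    by (rule measurable_compose) simp
  then show ?thesis unfolding measurable_cong_sets[OF sets_D refl] by simp
qed

lemma dot_fst_measurable [measurable]: "(\<lambda>z. dot n v (fst z)) \<in> borel_measurable D"
  by (rule measurable_compose[OF fst_measurable dot_measurable])

text \<open>The uniform law speaks of a countable index set, which makes the exceptional event
  measurable. Approximation by rational vectors later extends it to all vectors.\<close>

lemma rational_vectors_dense:
  fixes v :: "nat \<Rightarrow> real"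
  obtains u where "\<And>k. u k \<in> {..<n} \<rightarrow>\<^sub>E \<rat>" "\<And>x. (\<lambda>k. dot n (u k) x) \<longlonglongrightarrow> dot n v x"
proof -
  have "\<exists>q\<in>\<rat>. v i < q \<and> q < v i + 1 / Suc k" for i k
    using Rats_dense_in_real[of "v i" "v i + 1 / Suc k"] by auto
  then obtain q where q: "\<And>i k. q i k \<in> \<rat>" "\<And>i k. v i < q i k" "\<And>i k. q i k < v i + 1 / Suc k"
    by metis
  have lim: "(\<lambda>k. q i k) \<longlonglongrightarrow> v i" for i
  proof (rule tendsto_sandwich[where f = "\<lambda>_. v i" and h = "\<lambda>k. v i + 1 / Suc k"])
    show "(\<lambda>k. v i + 1 / Suc k) \<longlonglongrightarrow> v i"
      using tendsto_add[OF tendsto_const LIMSEQ_inverse_real_of_nat, of "v i"] by (simp add: field_simps)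
    show "\<forall>\<^sub>F k in sequentially. v i \<le> q i k" "\<forall>\<^sub>F k in sequentially. q i k \<le> v i + 1 / Suc k"
      using q by (intro always_eventually allI less_imp_le; blast)+
  qed simp
  show ?thesis
  proof (rule that[of "\<lambda>k. restrict (\<lambda>i. q i k) {..<n}"])
    show "restrict (\<lambda>i. q i k) {..<n} \<in> {..<n} \<rightarrow>\<^sub>E \<rat>" for k using q by auto
    have "(\<lambda>k. \<Sum>i<n. q i k * x i) \<longlonglongrightarrow> (\<Sum>i<n. v i * x i)" for x
      by (intro tendsto_intros lim)
    then show "(\<lambda>k. dot n (restrict (\<lambda>i. q i k) {..<n}) x) \<longlonglongrightarrow> dot n v x" for x
      by (simp add: dot_def)
  qed
qed

text \<open>Since \<open>H\<close> is Lipschitz in the clipped score, a cover of the clipped scores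
  at precision t / 8 is a cover of the functions; \<open>16 * a \<le> N * t\<close> says that
  \<open>N\<close> thresholds at this spacing reach across [-a, a]. The exceptional set
  \<open>B\<close> is built from rational vectors only. Outside of it the inequality passes to an
  arbitrary \<open>v\<close> in the limit, by dominated convergence on the left and pointwise
  convergence on the right.\<close>

lemma uniform_law_halfspaces:
  fixes H :: "real \<Rightarrow> (nat \<Rightarrow> real) \<times> real \<Rightarrow> real" and a t :: real and m N :: nat
  assumes meas: "\<And>v. (\<lambda>z. H (dot n v (fst z)) z) \<in> borel_measurable D"
    and b: "\<And>b z. z \<in> space D \<Longrightarrow> \<bar>H b z\<bar> \<le> 1"
    and lip: "\<And>b c z. z \<in> space D \<Longrightarrow> \<bar>H b z - H c z\<bar> \<le> \<bar>clip a b - clip a c\<bar>"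
    and t: "t > 0" "8 \<le> m * t\<^sup>2" and N: "16 * a \<le> N * t"
  shows "\<exists>B\<in>sets S. measure S B \<le> 2 * (2 * m * N + 1) ^ (n + 1) * exp (- (m * t\<^sup>2 / 128)) \<and>
    (\<forall>\<omega>\<in>space S - B. \<forall>v. m * (\<integral>z. H (dot n v (fst z)) z \<partial>D) \<le> (\<Sum>i<m. H (dot n v (fst (\<omega> i))) (\<omega> i)) + m * t)"
proof -
  let ?h = "\<lambda>v z. H (dot n v (fst z)) z"
  let ?V = "{..<n} \<rightarrow>\<^sub>E (\<rat> :: real set)"
  let ?B = "{\<omega> \<in> space S. \<exists>v\<in>?V. m * t < m * (\<integral>z. ?h v z \<partial>D) - (\<Sum>i<m. ?h v (\<omega> i))}"
  have V: "countable ?V" by (intro countable_PiE) (auto simp: countable_rat)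
  have hm: "?h v \<in> borel_measurable D" for v by (rule meas)
  note [measurable] = hm
  have "(\<lambda>\<omega>. ?h v (\<omega> i)) \<in> borel_measurable S" for v i
    by (rule measurable_compose[OF _ hm]) measurable
  note [measurable] = this
  have BS: "?B \<in> sets S"
    by (intro sets.sets_Collect_countable_Ex'[OF _ V]) measurable
  have s: "t / 8 > 0" "2 * a \<le> N * (t / 8)" using t N by auto
  have "measure S ?B \<le> 2 * ((2 * m) * N + 1) ^ (n + 1) * exp (- (m * t\<^sup>2 / 128))"
  proof (rule uniform_law[OF V hm _ t])
    show "\<bar>?h v z\<bar> \<le> 1" if "z \<in> space D" for v z by (rule b[OF that])
    fix \<omega> :: "nat \<Rightarrow> (nat \<Rightarrow> real) \<times> real" assume w: "\<And>i. \<omega> i \<in> space D"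
    have "\<exists>R\<subseteq>?V. finite R \<and> card R \<le> (2 * m * N + 1) ^ (n + 1) \<and>
        (\<forall>v\<in>?V. \<exists>u\<in>R. \<forall>i<2*m. \<bar>clip a (dot n v (fst (\<omega> i))) - clip a (dot n u (fst (\<omega> i)))\<bar> \<le> t / 8)"
      by (rule halfspace_cover[OF s])
    then show "\<exists>R\<subseteq>?V. finite R \<and> card R \<le> (2 * m * N + 1) ^ (n + 1) \<and>
        (\<forall>v\<in>?V. \<exists>u\<in>R. \<forall>i<2*m. \<bar>?h v (\<omega> i) - ?h u (\<omega> i)\<bar> \<le> t / 8)"
    proof (elim exE conjE, intro exI conjI ballI)
      fix R v assume c: "\<forall>v\<in>?V. \<exists>u\<in>R. \<forall>i<2*m. \<bar>clip a (dot n v (fst (\<omega> i))) - clip a (dot n u (fst (\<omega> i)))\<bar> \<le> t / 8"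
        and v: "v \<in> ?V"
      from c[rule_format, OF v] obtain u where u: "u \<in> R"
        and "\<And>i. i < 2*m \<Longrightarrow> \<bar>clip a (dot n v (fst (\<omega> i))) - clip a (dot n u (fst (\<omega> i)))\<bar> \<le> t / 8" by blast
      then have "\<bar>?h v (\<omega> i) - ?h u (\<omega> i)\<bar> \<le> t / 8" if "i < 2*m" for i
        using lip[OF w] that order_trans by blast
      then show "\<exists>u\<in>R. \<forall>i<2*m. \<bar>?h v (\<omega> i) - ?h u (\<omega> i)\<bar> \<le> t / 8" using u by blast
    qed
  qed
  moreover have "m * (\<integral>z. ?h v z \<partial>D) \<le> (\<Sum>i<m. ?h v (\<omega> i)) + m * t" if w: "\<omega> \<in> space S - ?B" for \<omega> v
  proof -
    obtain u where u: "\<And>k. u k \<in> ?V" and lim: "\<And>x. (\<lambda>k. dot n (u k) x) \<longlonglongrightarrow> dot n v x"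
      using rational_vectors_dense[of v] by blast
    have wi: "\<omega> i \<in> space D" for i using w by (auto simp: space_PiM)
    have hl: "(\<lambda>k. ?h (u k) z) \<longlonglongrightarrow> ?h v z" if "z \<in> space D" for z
    proof -
      have d: "(\<lambda>k. dot n (u k) (fst z) - dot n v (fst z)) \<longlonglongrightarrow> 0" using lim by (rule LIM_zero)
      have e: "\<forall>\<^sub>F k in sequentially. norm (?h (u k) z - ?h v z) \<le> \<bar>dot n (u k) (fst z) - dot n v (fst z)\<bar>"
        unfolding real_norm_def by (intro always_eventually allI order_trans[OF lip[OF that] clip_lipschitz])
      have "(\<lambda>k. ?h (u k) z - ?h v z) \<longlonglongrightarrow> 0"
        by (rule Lim_null_comparison[OF e tendsto_rabs_zero[OF d]])
      then show ?thesis by (rule LIM_zero_cancel)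
    qed
    have "(\<lambda>k. \<integral>z. ?h (u k) z \<partial>D) \<longlonglongrightarrow> (\<integral>z. ?h v z \<partial>D)"
      by (rule integral_dominated_convergence[where w = "\<lambda>_. 1"]) (use hl b hm in \<open>auto simp: M.prob_space_axioms\<close>)
    then have L: "(\<lambda>k. m * (\<integral>z. ?h (u k) z \<partial>D)) \<longlonglongrightarrow> m * (\<integral>z. ?h v z \<partial>D)" by (intro tendsto_intros)
    have R: "(\<lambda>k. (\<Sum>i<m. ?h (u k) (\<omega> i)) + m * t) \<longlonglongrightarrow> (\<Sum>i<m. ?h v (\<omega> i)) + m * t"
      by (intro tendsto_intros hl wi)
    show ?thesis
    proof (rule LIMSEQ_le[OF L R], intro exI[of _ 0] allI impI)
      fix k
      show "m * (\<integral>z. ?h (u k) z \<partial>D) \<le> (\<Sum>i<m. ?h (u k) (\<omega> i)) + m * t"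
      proof (rule ccontr)
        assume "\<not> ?thesis"
        then have "m * t < m * (\<integral>z. ?h (u k) z \<partial>D) - (\<Sum>i<m. ?h (u k) (\<omega> i))" by linarith
        then have "\<omega> \<in> ?B" using w bexI[OF _ u[of k], where P = "\<lambda>v. m * t < m * (\<integral>z. ?h v z \<partial>D) - (\<Sum>i<m. ?h v (\<omega> i))"] by simp
        with w show False unfolding Diff_iff by (elim conjE notE)
      qed
    qed
  qed
  ultimately show ?thesis by (intro bexI[OF _ BS] conjI ballI allI)
qed

end

section \<open>Misspecified generalized linear models\<close>

lemma mono_saturated_bounded:
  assumes "mono g" "saturates_at a g" "a \<ge> 1"
  shows "\<bar>g z\<bar> \<le> (1 :: real)"
proof -
  have "g (min z (- a)) \<le> g z" "g z \<le> g (max z a)" using assms(1) by (auto simp: mono_def)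
  moreover have "g (min z (- a)) = -1" "g (max z a) = 1"
    using assms by (auto simp: saturates_at_def min_def max_def sgn_if)
  ultimately show ?thesis by (simp add: abs_le_iff)
qed

lemma saturated_clip: "saturates_at a g \<Longrightarrow> a \<ge> 1 \<Longrightarrow> g (clip a z) = g z"
  by (auto simp: saturates_at_def clip_def min_def max_def sgn_if)

locale misspecified_glm =
  fixes n :: nat and D :: "((nat \<Rightarrow> real) \<times> real) measure"
    and \<alpha> \<epsilon> :: real and \<sigma> \<sigma>' :: "real \<Rightarrow> real" and v :: "nat \<Rightarrow> real"
  assumes alpha: "\<alpha> \<ge> 1" and eps: "\<epsilon> > 0"
    and sigma: "mono \<sigma>" "lipschitz_on 1 UNIV \<sigma>" "saturates_at \<alpha> \<sigma>"
    and sigma': "mono \<sigma>'" "saturates_at \<alpha> \<sigma>'"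
    and close: "\<And>z. \<bar>\<sigma>' z - \<sigma> z\<bar> \<le> \<epsilon>"
    and glm: "glm n D \<sigma>' v"
begin

sublocale example_measure n D
  using glm by unfold_locales (simp add: glm_def)

lemma lip: "\<bar>\<sigma> y - \<sigma> z\<bar> \<le> \<bar>y - z\<bar>"
  using lipschitz_onD[OF sigma(2), of y z] by (simp add: dist_real_def)

lemma sigma_bounds: "\<bar>\<sigma> z\<bar> \<le> 1" "\<bar>\<sigma>' z\<bar> \<le> 1"
  using mono_saturated_bounded sigma sigma' alpha by blast+

lemma sigma_clip: "\<sigma> (clip \<alpha> z) = \<sigma> z"
  using saturated_clip sigma(3) alpha by blast

lemma lip_clip: "\<bar>\<sigma> y - \<sigma> z\<bar> \<le> \<bar>clip \<alpha> y - clip \<alpha> z\<bar>"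
  using lip[of "clip \<alpha> y" "clip \<alpha> z"] by (simp add: sigma_clip)

lemma sigma_measurable [measurable]: "\<sigma> \<in> borel_measurable borel" "\<sigma>' \<in> borel_measurable borel"
  using sigma(1) sigma'(1) by (auto intro: borel_measurable_mono)

abbreviation "score u z \<equiv> dot n u (fst z)"

text \<open>The integrand of the clipped gap. Unlike the gap itself it is bounded on the space of
  examples, by 4 \<alpha>, whatever the length of \<open>u\<close>.\<close>

abbreviation "ramp u z \<equiv> (\<sigma> (score u z) - snd z) * (clip \<alpha> (score u z) - clip \<alpha> (score v z))"

abbreviation "sqloss u z \<equiv> (\<sigma> (score u z) - snd z)\<^sup>2"

section \<open>Expectations that involve the labels\<close>

lemma bounded_integrable:
  fixes f :: "_ \<Rightarrow> real"
  assumes "f \<in> borel_measurable D" "\<And>z. z \<in> space D \<Longrightarrow> \<bar>f z\<bar> \<le> c"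
  shows "integrable D f"
  by (rule M.integrable_const_bound[where B = c]) (use assms in auto)

text \<open>A function of the instance may be pulled out of the conditional expectation, so the
  label can be replaced by its conditional mean. Every use of that conditional mean goes through
  this identity.\<close>

lemma expectation_label:
  fixes f :: "(nat \<Rightarrow> real) \<Rightarrow> real"
  assumes f: "f \<in> borel_measurable (instance_space n)" and b: "\<And>x. \<bar>f x\<bar> \<le> c"
  shows "(\<integral>z. f (fst z) * snd z \<partial>D) = (\<integral>z. f (fst z) * \<sigma>' (score v z) \<partial>D)"
proof -
  let ?F = "vimage_algebra (space D) fst (instance_space n)"
  interpret F: finite_measure_subalgebra D ?F
    by unfold_locales (rule subalgebra_instance[OF example_distribution])
  have fF: "(\<lambda>z. f (fst z)) \<in> borel_measurable ?F"
    by (rule measurable_compose[OF measurable_vimage_algebra1 f])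
       (use measurable_space[OF fst_measurable] in auto)
  have fD: "(\<lambda>z. f (fst z)) \<in> borel_measurable D"
    by (rule measurable_compose[OF fst_measurable f])
  have c: "0 \<le> c" using b[of "\<lambda>_. 0"] by linarith
  have i: "integrable D (\<lambda>z. f (fst z) * snd z)"
  proof (rule bounded_integrable[where c = c])
    show "\<bar>f (fst z) * snd z\<bar> \<le> c" if "z \<in> space D" for z
      using b label[OF that] by (auto simp: abs_mult)
  qed (use fD in measurable)
  have "(\<integral>z. f (fst z) * snd z \<partial>D) = (\<integral>z. f (fst z) * real_cond_exp D ?F snd z \<partial>D)"
    by (rule F.real_cond_exp_intg(2)[OF i fF snd_measurable, symmetric])
  also have "\<dots> = (\<integral>z. f (fst z) * \<sigma>' (score v z) \<partial>D)"
  proof (rule integral_cong_AE)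
    show "AE z in D. f (fst z) * real_cond_exp D ?F snd z = f (fst z) * \<sigma>' (score v z)"
      using glm unfolding glm_def by auto
  qed (use fD in measurable)
  finally show ?thesis .
qed

text \<open>Where the score of \<open>v\<close> is saturated, the conditional mean of the label is 1
  or -1, an extreme value of the label. Hence the nonnegative function that is positive exactly at
  saturated instances with the wrong label has integral zero.\<close>

lemma labels_consistent: "AE z in D. \<bar>score v z\<bar> \<ge> \<alpha> \<longrightarrow> snd z = sgn (score v z)"
proof -
  let ?I = "\<lambda>x. if \<bar>dot n v x\<bar> \<ge> \<alpha> then 1 else 0 :: real"
  let ?f = "\<lambda>x. ?I x * sgn (dot n v x)"
  have d[measurable]: "(\<lambda>x. dot n v x) \<in> borel_measurable (instance_space n)" by (rule dot_measurable)
  have I: "?I \<in> borel_measurable (instance_space n)" by measurable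
  have f: "?f \<in> borel_measurable (instance_space n)" by measurable
  have ID: "(\<lambda>z. ?I (fst z)) \<in> borel_measurable D"
    by (rule measurable_compose[OF fst_measurable I])
  have fD: "(\<lambda>z. ?f (fst z)) \<in> borel_measurable D"
    by (rule measurable_compose[OF fst_measurable f])
  have i1: "integrable D (\<lambda>z. ?I (fst z))"
    by (rule bounded_integrable[where c = 1, OF ID]) auto
  have i2: "integrable D (\<lambda>z. ?f (fst z) * snd z)"
  proof (rule bounded_integrable[where c = 1])
    show "\<bar>?f (fst z) * snd z\<bar> \<le> 1" if "z \<in> space D" for z
      using label[OF that] by (auto simp: abs_mult sgn_if)
  qed (use fD in measurable)
  have "(\<integral>z. ?f (fst z) * snd z \<partial>D) = (\<integral>z. ?f (fst z) * \<sigma>' (score v z) \<partial>D)"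
    by (rule expectation_label[OF f, of 1]) (auto simp: sgn_if)
  also have "\<dots> = (\<integral>z. ?I (fst z) \<partial>D)"
    using sigma'(2) alpha by (intro Bochner_Integration.integral_cong) (auto simp: saturates_at_def sgn_if)
  finally have "(\<integral>z. ?I (fst z) - ?f (fst z) * snd z \<partial>D) = 0"
    by (subst Bochner_Integration.integral_diff[OF i1 i2]) simp
  then have "AE z in D. ?I (fst z) - ?f (fst z) * snd z = 0"
  proof (subst (asm) integral_nonneg_eq_0_iff_AE)
    show "integrable D (\<lambda>z. ?I (fst z) - ?f (fst z) * snd z)" using i1 i2 by simp
    show "AE z in D. 0 \<le> ?I (fst z) - ?f (fst z) * snd z"
    proof (rule AE_I2)
      fix z assume "z \<in> space D"
      then show "0 \<le> ?I (fst z) - ?f (fst z) * snd z" using label[of z] by (auto simp: sgn_if)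
    qed
  qed
  then show ?thesis
  proof (rule AE_mp, intro AE_I2 impI)
    fix z assume "z \<in> space D" "?I (fst z) - ?f (fst z) * snd z = 0" "\<alpha> \<le> \<bar>score v z\<bar>"
    then show "snd z = sgn (score v z)" using label[of z] by (auto simp: sgn_if split: if_splits)
  qed
qed

text \<open>Saturation makes the residual vanish wherever clipping \<open>b\<close> could increase the gap, and the labels are
  deterministic wherever clipping \<open>a\<close> acts.\<close>
lemma ramp_le_gap:
  assumes "y = -1 \<or> y = 1" "\<bar>a\<bar> \<ge> \<alpha> \<longrightarrow> y = sgn a"
  shows "(\<sigma> b - y) * (clip \<alpha> b - clip \<alpha> a) \<le> (\<sigma> b - y) * (b - a)"
proof -
  have s: "b \<ge> \<alpha> \<Longrightarrow> \<sigma> b = 1" "b \<le> - \<alpha> \<Longrightarrow> \<sigma> b = -1"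
    using sigma(3) alpha by (auto simp: saturates_at_def sgn_if)
  from assms(1) show ?thesis
  proof
    assume y: "y = -1"
    have "a < \<alpha>"
    proof (rule ccontr)
      assume "\<not> a < \<alpha>"
      then have "sgn a = 1" "\<alpha> \<le> \<bar>a\<bar>" using alpha by (auto simp: sgn_if)
      then show False using assms(2) y by simp
    qed
    then have a: "a \<le> clip \<alpha> a" by (simp add: clip_def)
    show ?thesis
    proof (cases "b \<le> - \<alpha>")
      case False
      then have "clip \<alpha> b \<le> b" by (auto simp: clip_def)
      then show ?thesis using a sigma_bounds(1)[of b] y by (intro mult_left_mono) auto
    qed (use y s in auto)
  next
    assume y: "y = 1"
    have "- \<alpha> < a"
    proof (rule ccontr)
      assume "\<not> - \<alpha> < a"
      then have "sgn a = -1" "\<alpha> \<le> \<bar>a\<bar>" using alpha by (auto simp: sgn_if)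
      then show False using assms(2) y by simp
    qed
    then have a: "clip \<alpha> a \<le> a" by (simp add: clip_def)
    show ?thesis
    proof (cases "b \<ge> \<alpha>")
      case False
      then have "b \<le> clip \<alpha> b" by (auto simp: clip_def)
      then show ?thesis using a sigma_bounds(1)[of b] y by (intro mult_left_mono_neg) auto
    qed (use y s in auto)
  qed
qed

text \<open>With \<open>\<sigma> a\<close> in place of \<open>\<sigma>' a\<close> both factors have
  the same sign and the first is dominated by the second, so the product is at least the square of
  the first. Exchanging \<open>\<sigma> a\<close> for \<open>\<sigma>' a\<close> changes the product
  by at most \<epsilon> times the range 2 \<alpha> of the clipped difference.\<close>

lemma ramp_lower_bound:
  "(\<sigma> b - \<sigma>' a) * (clip \<alpha> b - clip \<alpha> a) \<ge> (\<sigma> b - \<sigma> a)\<^sup>2 - 2 * \<alpha> * \<epsilon>"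
proof -
  let ?c = "clip \<alpha> b - clip \<alpha> a"
  have "(\<sigma> b - \<sigma> a)\<^sup>2 \<le> (\<sigma> b - \<sigma> a) * ?c"
  proof (cases "b \<ge> a")
    case True
    then have "0 \<le> \<sigma> b - \<sigma> a" "0 \<le> ?c" using sigma(1) by (auto simp: mono_def clip_def)
    then show ?thesis using lip_clip[of b a] unfolding power2_eq_square by (intro mult_left_mono) auto
  next
    case False
    then have "\<sigma> b - \<sigma> a \<le> 0" "?c \<le> 0" using sigma(1) by (auto simp: mono_def clip_def)
    then show ?thesis using lip_clip[of b a] unfolding power2_eq_square by (intro mult_left_mono_neg) auto
  qed
  moreover have "\<bar>(\<sigma> a - \<sigma>' a) * ?c\<bar> \<le> \<epsilon> * (2 * \<alpha>)"
    unfolding abs_mult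
  proof (rule mult_mono)
    show "\<bar>\<sigma> a - \<sigma>' a\<bar> \<le> \<epsilon>" using close[of a] by linarith
    show "\<bar>?c\<bar> \<le> 2 * \<alpha>" using abs_clip_le[of \<alpha> a] abs_clip_le[of \<alpha> b] alpha by linarith
  qed (use eps in auto)
  moreover have "(\<sigma> b - \<sigma>' a) * ?c = (\<sigma> b - \<sigma> a) * ?c + (\<sigma> a - \<sigma>' a) * ?c"
    by (simp add: algebra_simps)
  ultimately show ?thesis by (simp add: abs_le_iff algebra_simps)
qed

lemma square_perturb:
  fixes p q :: real
  assumes "\<bar>p\<bar> \<le> 2" "\<bar>q\<bar> \<le> \<epsilon>"
  shows "(p + q)\<^sup>2 \<le> p\<^sup>2 + (4 * \<epsilon> + \<epsilon>\<^sup>2)"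
proof -
  have "\<bar>p * q\<bar> \<le> 2 * \<epsilon>" unfolding abs_mult using assms by (intro mult_mono) auto
  moreover have "\<bar>q\<bar>\<^sup>2 \<le> \<epsilon>\<^sup>2" using assms by (intro power_mono) auto
  ultimately show ?thesis by (simp add: power2_sum abs_le_iff)
qed

lemma expectation_square_perturb:
  fixes f g :: "_ \<Rightarrow> real"
  assumes [measurable]: "f \<in> borel_measurable D" "g \<in> borel_measurable D"
    and f: "\<And>z. \<bar>f z\<bar> \<le> 2" and g: "\<And>z. \<bar>g z\<bar> \<le> \<epsilon>"
  shows "(\<integral>z. (f z + g z)\<^sup>2 \<partial>D) \<le> (\<integral>z. (f z)\<^sup>2 \<partial>D) + (4 * \<epsilon> + \<epsilon>\<^sup>2)"
proof -
  have i: "integrable D (\<lambda>z. (f z)\<^sup>2)"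
    by (rule bounded_integrable[where c = 4], measurable) (use power_mono[OF f, where n = 2] in simp)
  have "(\<integral>z. (f z + g z)\<^sup>2 \<partial>D) \<le> (\<integral>z. (f z)\<^sup>2 + (4 * \<epsilon> + \<epsilon>\<^sup>2) \<partial>D)"
  proof (rule integral_mono)
    show "integrable D (\<lambda>z. (f z + g z)\<^sup>2)"
    proof (rule bounded_integrable[where c = "4 + (4 * \<epsilon> + \<epsilon>\<^sup>2)"])
      show "\<bar>(f z + g z)\<^sup>2\<bar> \<le> 4 + (4 * \<epsilon> + \<epsilon>\<^sup>2)" for z
        using square_perturb[OF f[of z] g[of z]] power_mono[OF f[of z], of 2] by simp
    qed measurable
  qed (use i square_perturb[OF f g] in auto)
  also have "\<dots> = (\<integral>z. (f z)\<^sup>2 \<partial>D) + (4 * \<epsilon> + \<epsilon>\<^sup>2)" using i by (simp add: M.prob_space)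
  finally show ?thesis .
qed

lemma sigma_diff_le_2: "\<bar>\<sigma> y - \<sigma> z\<bar> \<le> 2" "\<bar>\<sigma> y - \<sigma>' z\<bar> \<le> 2"
  using sigma_bounds(1)[of y] sigma_bounds(1)[of z] sigma_bounds(2)[of z] by linarith+

text \<open>The clipped difference depends on the instance only, so the label may be replaced by
  \<open>\<sigma>' (score v z)\<close>; then the pointwise bound \<open>ramp_lower_bound\<close> is
  integrated.\<close>

lemma expectation_ramp:
  "(\<integral>z. (\<sigma> (score u z) - \<sigma> (score v z))\<^sup>2 \<partial>D) \<le> (\<integral>z. ramp u z \<partial>D) + 2 * \<alpha> * \<epsilon>"
proof -
  let ?c = "\<lambda>z. clip \<alpha> (score u z) - clip \<alpha> (score v z)"
  let ?f = "\<lambda>x. clip \<alpha> (dot n u x) - clip \<alpha> (dot n v x)"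
  have d[measurable]: "(\<lambda>x. dot n w x) \<in> borel_measurable (instance_space n)" for w by (rule dot_measurable)
  have f: "?f \<in> borel_measurable (instance_space n)" by measurable
  have fb: "\<bar>?f x\<bar> \<le> 2 * \<alpha>" for x
    using abs_clip_le[of \<alpha> "dot n u x"] abs_clip_le[of \<alpha> "dot n v x"] alpha by linarith
  have prod: "\<bar>g * ?f x\<bar> \<le> 2 * \<alpha>" "\<bar>?f x * g\<bar> \<le> 2 * \<alpha>" if "\<bar>g\<bar> \<le> 1" for g x
    using mult_mono[OF that fb] alpha by (simp_all add: abs_mult mult.commute)
  have i1: "integrable D (\<lambda>z. \<sigma> (score u z) * ?c z)"
    by (rule bounded_integrable[where c = "2 * \<alpha>"]) (use prod sigma_bounds in auto)
  have i2: "integrable D (\<lambda>z. ?c z * snd z)"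
    by (rule bounded_integrable[where c = "2 * \<alpha>"], measurable, rule prod(2)[OF label_abs])
  have i3: "integrable D (\<lambda>z. ?c z * \<sigma>' (score v z))"
    by (rule bounded_integrable[where c = "2 * \<alpha>"]) (use prod(2) sigma_bounds in auto)
  have i4: "integrable D (\<lambda>z. (\<sigma> (score u z) - \<sigma> (score v z))\<^sup>2)"
  proof (rule bounded_integrable[where c = 4])
    fix z
    have "\<bar>\<sigma> (score u z) - \<sigma> (score v z)\<bar> \<le> 2"
      using sigma_bounds(1)[of "score u z"] sigma_bounds(1)[of "score v z"] by linarith
    from power_mono[OF this, of 2] show "\<bar>(\<sigma> (score u z) - \<sigma> (score v z))\<^sup>2\<bar> \<le> 4" by simp
  qed measurable
  have "(\<integral>z. ramp u z \<partial>D) = (\<integral>z. \<sigma> (score u z) * ?c z - ?c z * snd z \<partial>D)"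
    by (intro Bochner_Integration.integral_cong) (auto simp: algebra_simps)
  also have "\<dots> = (\<integral>z. \<sigma> (score u z) * ?c z \<partial>D) - (\<integral>z. ?c z * snd z \<partial>D)"
    by (rule Bochner_Integration.integral_diff[OF i1 i2])
  also have "(\<integral>z. ?c z * snd z \<partial>D) = (\<integral>z. ?c z * \<sigma>' (score v z) \<partial>D)"
    by (rule expectation_label[OF f fb])
  also have "(\<integral>z. \<sigma> (score u z) * ?c z \<partial>D) - \<dots> = (\<integral>z. \<sigma> (score u z) * ?c z - ?c z * \<sigma>' (score v z) \<partial>D)"
    by (rule Bochner_Integration.integral_diff[OF i1 i3, symmetric])
  also have "\<dots> \<ge> (\<integral>z. (\<sigma> (score u z) - \<sigma> (score v z))\<^sup>2 - 2 * \<alpha> * \<epsilon> \<partial>D)"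
  proof (rule integral_mono)
    show "integrable D (\<lambda>z. (\<sigma> (score u z) - \<sigma> (score v z))\<^sup>2 - 2 * \<alpha> * \<epsilon>)" using i4 by simp
    show "integrable D (\<lambda>z. \<sigma> (score u z) * ?c z - ?c z * \<sigma>' (score v z))" using i1 i3 by simp
    show "(\<sigma> (score u z) - \<sigma> (score v z))\<^sup>2 - 2 * \<alpha> * \<epsilon> \<le> \<sigma> (score u z) * ?c z - ?c z * \<sigma>' (score v z)" for z
      using ramp_lower_bound[of "score u z" "score v z"] by (simp add: algebra_simps)
  qed
  also have "(\<integral>z. (\<sigma> (score u z) - \<sigma> (score v z))\<^sup>2 - 2 * \<alpha> * \<epsilon> \<partial>D) = (\<integral>z. (\<sigma> (score u z) - \<sigma> (score v z))\<^sup>2 \<partial>D) - 2 * \<alpha> * \<epsilon>"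
    using i4 by (simp add: M.prob_space)
  finally show ?thesis by simp
qed

lemma square_diff_le_4: "\<bar>x\<bar> \<le> 1 \<Longrightarrow> \<bar>y\<bar> \<le> 1 \<Longrightarrow> \<bar>(x - y)\<^sup>2\<bar> \<le> (4 :: real)"
proof -
  assume "\<bar>x\<bar> \<le> 1" "\<bar>y\<bar> \<le> 1"
  then have "\<bar>x - y\<bar> \<le> 2" by linarith
  from power_mono[OF this, of 2] show ?thesis by simp
qed

text \<open>The last integral is the noise level and does not depend on \<open>u\<close>, so the empirical square loss selects
  among the iterates.\<close>
lemma expectation_sqloss:
  "(\<integral>z. sqloss u z \<partial>D) = (\<integral>z. (\<sigma> (score u z) - \<sigma>' (score v z))\<^sup>2 \<partial>D) + (\<integral>z. 1 - (\<sigma>' (score v z))\<^sup>2 \<partial>D)"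
proof -
  let ?f = "\<lambda>x. \<sigma> (dot n u x)"
  have d[measurable]: "(\<lambda>x. dot n w x) \<in> borel_measurable (instance_space n)" for w by (rule dot_measurable)
  have f: "?f \<in> borel_measurable (instance_space n)" by measurable
  have prod: "\<bar>g * h\<bar> \<le> 1" if "\<bar>g\<bar> \<le> 1" "\<bar>h\<bar> \<le> 1" for g h :: real
    using mult_mono[OF that] by (simp add: abs_mult)
  have sq: "(g :: real)\<^sup>2 \<le> 1" if "\<bar>g\<bar> \<le> 1" for g using that by (simp add: abs_square_le_1)
  have i0: "integrable D (\<lambda>z. (\<sigma> (score u z))\<^sup>2 + 1)"
    by (rule bounded_integrable[where c = 2]) (use sq sigma_bounds in auto)
  have i1: "integrable D (\<lambda>z. \<sigma> (score u z) * snd z)"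
    by (rule bounded_integrable[where c = 1], measurable, rule prod[OF sigma_bounds(1) label_abs])
  have i2: "integrable D (\<lambda>z. \<sigma> (score u z) * \<sigma>' (score v z))"
    by (rule bounded_integrable[where c = 1]) (use prod sigma_bounds in auto)
  have i3: "integrable D (\<lambda>z. 1 - (\<sigma>' (score v z))\<^sup>2)"
  proof (rule bounded_integrable[where c = 1])
    show "\<bar>1 - (\<sigma>' (score v z))\<^sup>2\<bar> \<le> 1" for z
      using sq[OF sigma_bounds(2), of "score v z"] by (simp add: abs_le_iff)
  qed measurable
  have i4: "integrable D (\<lambda>z. (\<sigma> (score u z) - \<sigma>' (score v z))\<^sup>2)"
    by (rule bounded_integrable[where c = 4]) (use sigma_bounds square_diff_le_4 in auto)
  have "(\<integral>z. sqloss u z \<partial>D) = (\<integral>z. ((\<sigma> (score u z))\<^sup>2 + 1) - 2 * (\<sigma> (score u z) * snd z) \<partial>D)"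
  proof (intro Bochner_Integration.integral_cong refl)
    fix z assume "z \<in> space D"
    from label[OF this] show "sqloss u z = ((\<sigma> (score u z))\<^sup>2 + 1) - 2 * (\<sigma> (score u z) * snd z)"
      by (auto simp: power2_eq_square algebra_simps)
  qed
  also have "\<dots> = (\<integral>z. (\<sigma> (score u z))\<^sup>2 + 1 \<partial>D) - 2 * (\<integral>z. \<sigma> (score u z) * snd z \<partial>D)"
    using i0 i1 by simp
  also have "(\<integral>z. \<sigma> (score u z) * snd z \<partial>D) = (\<integral>z. \<sigma> (score u z) * \<sigma>' (score v z) \<partial>D)"
    by (rule expectation_label[OF f, of 1]) (rule sigma_bounds)
  also have "(\<integral>z. (\<sigma> (score u z))\<^sup>2 + 1 \<partial>D) - 2 * \<dots> = (\<integral>z. ((\<sigma> (score u z))\<^sup>2 + 1) - 2 * (\<sigma> (score u z) * \<sigma>' (score v z)) \<partial>D)"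
    using i0 i2 by simp
  also have "\<dots> = (\<integral>z. (\<sigma> (score u z) - \<sigma>' (score v z))\<^sup>2 + (1 - (\<sigma>' (score v z))\<^sup>2) \<partial>D)"
    by (intro Bochner_Integration.integral_cong) (auto simp: power2_eq_square algebra_simps)
  also have "\<dots> = (\<integral>z. (\<sigma> (score u z) - \<sigma>' (score v z))\<^sup>2 \<partial>D) + (\<integral>z. 1 - (\<sigma>' (score v z))\<^sup>2 \<partial>D)"
    by (rule Bochner_Integration.integral_add[OF i4 i3])
  finally show ?thesis .
qed

text \<open>All that correctness asks of the randomness. The ramp is controlled on one side, since
  its expectation is only bounded from above; the square loss is controlled on both sides, since two
  vectors are compared. The first clause may range over all draws because countably many null sets
  are discarded.\<close>

definition good_sample :: "nat \<Rightarrow> (nat \<Rightarrow> (nat \<Rightarrow> real) \<times> real) \<Rightarrow> bool" where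
  "good_sample m \<omega> \<longleftrightarrow> (\<forall>i. \<bar>score v (\<omega> i)\<bar> \<ge> \<alpha> \<longrightarrow> snd (\<omega> i) = sgn (score v (\<omega> i))) \<and>
    (\<forall>u. m * (\<integral>z. ramp u z \<partial>D) \<le> (\<Sum>i<m. ramp u (\<omega> i)) + m * (2 * \<alpha> * \<epsilon>)) \<and>
    (\<forall>u. \<bar>m * (\<integral>z. sqloss u z \<partial>D) - (\<Sum>i<m. sqloss u (\<omega> i))\<bar> \<le> m * (2 * \<epsilon>))"

text \<open>Clipping and the sample deviation give an expected ramp of at most \<epsilon> + 2
  \<alpha> \<epsilon>, hence a squared error of \<open>u\<close> with respect to \<sigma> of at most
  \<epsilon> + 4 \<alpha> \<epsilon>. Replacing \<sigma> by \<sigma>' at \<open>v\<close> costs 4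
  \<epsilon> + \<epsilon>^2, passing from \<open>u\<close> to \<open>u'\<close> through the square
  losses costs 4 \<epsilon>, and replacing \<sigma> by \<sigma>' at \<open>u'\<close> costs 4
  \<epsilon> + \<epsilon>^2 again. Since \<epsilon>^2 \<le> \<epsilon> \<le> \<alpha> \<epsilon>,
  the sum is at most 19 \<alpha> \<epsilon>.\<close>

lemma good_sample_imp_small_error:
  assumes small: "6 * \<alpha> * \<epsilon> < 1" and m: "m > 0" and w: "\<And>i. \<omega> i \<in> space D" and good: "good_sample m \<omega>"
    and gap: "(\<Sum>i<m. (\<sigma> (score u (\<omega> i)) - snd (\<omega> i)) * (score u (\<omega> i) - score v (\<omega> i))) \<le> m * \<epsilon>"
    and best: "(\<Sum>i<m. sqloss u' (\<omega> i)) \<le> (\<Sum>i<m. sqloss u (\<omega> i))"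
  shows "(LINT x | marginal n D. (\<sigma>' (dot n x v) - \<sigma>' (dot n x u'))\<^sup>2) \<le> 24 * \<alpha> * \<epsilon>"
proof -
  let ?e = "4 * \<epsilon> + \<epsilon>\<^sup>2"
  let ?d = "\<lambda>w. \<integral>z. (\<sigma> (score w z) - \<sigma>' (score v z))\<^sup>2 \<partial>D"
  note [measurable] = dot_fst_measurable
  have "(\<Sum>i<m. ramp u (\<omega> i)) \<le> (\<Sum>i<m. (\<sigma> (score u (\<omega> i)) - snd (\<omega> i)) * (score u (\<omega> i) - score v (\<omega> i)))"
    by (intro sum_mono ramp_le_gap label w) (use good in \<open>simp add: good_sample_def\<close>)
  then have "m * (\<integral>z. ramp u z \<partial>D) \<le> m * \<epsilon> + m * (2 * \<alpha> * \<epsilon>)"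
    using gap good unfolding good_sample_def by (meson add_right_mono order_trans)
  then have "m * (\<integral>z. ramp u z \<partial>D) \<le> m * (\<epsilon> + 2 * \<alpha> * \<epsilon>)" by (simp add: algebra_simps)
  then have r: "(\<integral>z. ramp u z \<partial>D) \<le> \<epsilon> + 2 * \<alpha> * \<epsilon>" using m by simp
  have "?d u = (\<integral>z. ((\<sigma> (score u z) - \<sigma> (score v z)) + (\<sigma> (score v z) - \<sigma>' (score v z)))\<^sup>2 \<partial>D)" by simp
  also have "\<dots> \<le> (\<integral>z. (\<sigma> (score u z) - \<sigma> (score v z))\<^sup>2 \<partial>D) + ?e"
    by (rule expectation_square_perturb) (measurable, rule sigma_diff_le_2, use close in \<open>simp add: abs_minus_commute\<close>)
  finally have du: "?d u \<le> \<epsilon> + 4 * \<alpha> * \<epsilon> + ?e" using expectation_ramp[of u] r by simp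
  have "m * (\<integral>z. sqloss u' z \<partial>D) \<le> m * (\<integral>z. sqloss u z \<partial>D) + m * (2 * \<epsilon>) + m * (2 * \<epsilon>)"
  proof -
    have "\<bar>m * (\<integral>z. sqloss u z \<partial>D) - (\<Sum>i<m. sqloss u (\<omega> i))\<bar> \<le> m * (2 * \<epsilon>)"
      "\<bar>m * (\<integral>z. sqloss u' z \<partial>D) - (\<Sum>i<m. sqloss u' (\<omega> i))\<bar> \<le> m * (2 * \<epsilon>)"
      using good by (simp_all add: good_sample_def)
    then show ?thesis using best unfolding abs_le_iff by linarith
  qed
  then have "m * (\<integral>z. sqloss u' z \<partial>D) \<le> m * ((\<integral>z. sqloss u z \<partial>D) + 4 * \<epsilon>)" by (simp add: algebra_simps)
  then have "(\<integral>z. sqloss u' z \<partial>D) \<le> (\<integral>z. sqloss u z \<partial>D) + 4 * \<epsilon>" using m by simp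
  then have du': "?d u' \<le> ?d u + 4 * \<epsilon>" by (simp add: expectation_sqloss)
  have "(LINT x | marginal n D. (\<sigma>' (dot n x v) - \<sigma>' (dot n x u'))\<^sup>2) = (\<integral>z. (\<sigma>' (dot n (fst z) v) - \<sigma>' (dot n (fst z) u'))\<^sup>2 \<partial>D)"
    unfolding marginal_def
  proof (rule integral_distr[OF fst_measurable])
    have [measurable]: "(\<lambda>x. dot n x w) \<in> borel_measurable (instance_space n)" for w
      using dot_measurable[of n w] by (simp add: dot_commute[of n _ w])
    show "(\<lambda>x. (\<sigma>' (dot n x v) - \<sigma>' (dot n x u'))\<^sup>2) \<in> borel_measurable (instance_space n)" by measurable
  qed
  also have "\<dots> = (\<integral>z. ((\<sigma> (score u' z) - \<sigma>' (score v z)) + (\<sigma>' (score u' z) - \<sigma> (score u' z)))\<^sup>2 \<partial>D)"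
    by (simp add: dot_commute[of n "fst _"] power2_commute)
  also have "\<dots> \<le> ?d u' + ?e"
    by (rule expectation_square_perturb) (measurable, rule sigma_diff_le_2, rule close)
  also have "\<dots> \<le> 4 * \<alpha> * \<epsilon> + 13 * \<epsilon> + 2 * \<epsilon>\<^sup>2" using du du' by simp
  also have "\<dots> \<le> 24 * \<alpha> * \<epsilon>"
  proof -
    have ae: "\<epsilon> \<le> \<alpha> * \<epsilon>" using alpha eps by simp
    then have "\<epsilon> \<le> 1" using eps small by linarith
    then have "\<epsilon>\<^sup>2 \<le> \<epsilon>" using eps by (simp add: power2_eq_square mult_left_le)
    then show ?thesis using ae eps by linarith
  qed
  finally show ?thesis .
qed


lemma error_le_4:
  "(LINT x | marginal n D. (\<sigma>' (dot n x v) - \<sigma>' (dot n x u))\<^sup>2) \<le> 4"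
proof -
  have d[measurable]: "(\<lambda>x. dot n x w) \<in> borel_measurable (instance_space n)" for w
    using dot_measurable[of n w] by (simp add: dot_commute[of n _ w])
  have m: "(\<lambda>x. (\<sigma>' (dot n x v) - \<sigma>' (dot n x u))\<^sup>2) \<in> borel_measurable (instance_space n)" by measurable
  have "(LINT x | marginal n D. (\<sigma>' (dot n x v) - \<sigma>' (dot n x u))\<^sup>2) = (\<integral>z. (\<sigma>' (dot n (fst z) v) - \<sigma>' (dot n (fst z) u))\<^sup>2 \<partial>D)"
    unfolding marginal_def by (rule integral_distr[OF fst_measurable m])
  also have "\<dots> \<le> (\<integral>z. 4 \<partial>D)"
  proof (rule integral_mono)
    show "integrable D (\<lambda>z. (\<sigma>' (dot n (fst z) v) - \<sigma>' (dot n (fst z) u))\<^sup>2)"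
      by (rule bounded_integrable[where c = 4], rule measurable_compose[OF fst_measurable m])
         (rule square_diff_le_4[OF sigma_bounds(2) sigma_bounds(2)])
    show "(\<sigma>' (dot n (fst z) v) - \<sigma>' (dot n (fst z) u))\<^sup>2 \<le> 4" for z
      using square_diff_le_4[OF sigma_bounds(2) sigma_bounds(2)] by simp
  qed simp
  finally show ?thesis by (simp add: M.prob_space)
qed

text \<open>The uniform law is applied at deviation \<epsilon> / 2 to three functions scaled into
  [-1, 1]: the ramp divided by 4 \<alpha>, the square loss divided by 4, and the negative of the
  latter. Undoing the scaling gives the deviations 2 \<alpha> \<epsilon> and 2 \<epsilon>. Each
  application fails with probability at most 1 / 300, and the labels are inconsistent with
  probability 0.\<close>

lemma good_sample_probable:
  fixes m N :: nat
  assumes m: "32 \<le> m * \<epsilon>\<^sup>2" and N: "32 * \<alpha> \<le> N * \<epsilon>"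
    and small: "(2 * m * N + 1) ^ (n + 1) * exp (- (m * \<epsilon>\<^sup>2 / 512)) \<le> 1 / 600"
  shows "\<exists>E\<in>sets S. measure S E \<ge> 0.99 \<and> (\<forall>\<omega>\<in>E. good_sample m \<omega>)"
proof -
  let ?\<delta> = "2 * (2 * m * N + 1) ^ (n + 1) * exp (- (m * (\<epsilon> / 2)\<^sup>2 / 128))"
  have "?\<delta> = 2 * ((2 * m * N + 1) ^ (n + 1) * exp (- (m * \<epsilon>\<^sup>2 / 512)))"
    by (simp add: power_divide)
  then have \<delta>: "?\<delta> \<le> 1 / 300" using small by linarith
  have t: "\<epsilon> / 2 > 0" "8 \<le> m * (\<epsilon> / 2)\<^sup>2" "16 * \<alpha> \<le> N * (\<epsilon> / 2)"
    using eps m N by (auto simp: power_divide)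
  have [measurable]: "(\<lambda>z. dot n u (fst z)) \<in> borel_measurable D" for u by (rule dot_fst_measurable)
  let ?U = "\<lambda>c H B. measure S B \<le> 1 / 300 \<and> (\<forall>\<omega>\<in>space S - B. \<forall>u.
      m * (\<integral>z. c * H (score u z) z \<partial>D) \<le> (\<Sum>i<m. c * H (score u (\<omega> i)) (\<omega> i)) + m * (c * \<epsilon> / 2))"
  have uniform: "\<exists>B\<in>sets S. ?U c H B"
    if meas: "\<And>u. (\<lambda>z. H (score u z) z) \<in> borel_measurable D"
      and b: "\<And>b z. z \<in> space D \<Longrightarrow> \<bar>H b z\<bar> \<le> 1"
      and l: "\<And>b c z. z \<in> space D \<Longrightarrow> \<bar>H b z - H c z\<bar> \<le> \<bar>clip \<alpha> b - clip \<alpha> c\<bar>"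
      and c: "0 \<le> c"
    for H :: "real \<Rightarrow> (nat \<Rightarrow> real) \<times> real \<Rightarrow> real" and c :: real
  proof -
    have "\<exists>B\<in>sets S. measure S B \<le> ?\<delta> \<and> (\<forall>\<omega>\<in>space S - B. \<forall>u.
        m * (\<integral>z. H (score u z) z \<partial>D) \<le> (\<Sum>i<m. H (score u (\<omega> i)) (\<omega> i)) + m * (\<epsilon> / 2))"
      by (rule uniform_law_halfspaces[of H, OF meas _ _ t], erule b, erule l)
    then obtain B where B: "B \<in> sets S" and BU: "measure S B \<le> ?\<delta> \<and> (\<forall>\<omega>\<in>space S - B. \<forall>u.
        m * (\<integral>z. H (score u z) z \<partial>D) \<le> (\<Sum>i<m. H (score u (\<omega> i)) (\<omega> i)) + m * (\<epsilon> / 2))"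
      by (rule bexE)
    have B': "measure S B \<le> ?\<delta>" by (rule conjunct1[OF BU])
    have *: "m * (\<integral>z. H (score u z) z \<partial>D) \<le> (\<Sum>i<m. H (score u (\<omega> i)) (\<omega> i)) + m * (\<epsilon> / 2)"
      if "\<omega> \<in> space S - B" for \<omega> u
      by (rule bspec[OF conjunct2[OF BU] that, THEN spec])
    have "m * (\<integral>z. c * H (score u z) z \<partial>D) \<le> (\<Sum>i<m. c * H (score u (\<omega> i)) (\<omega> i)) + m * (c * \<epsilon> / 2)"
      if "\<omega> \<in> space S - B" for \<omega> u
      using mult_left_mono[OF *[OF that, of u] c] by (simp add: sum_distrib_left algebra_simps)
    then show ?thesis using order_trans[OF B' \<delta>] by (intro bexI[OF _ B] conjI ballI allI)
  qed
  define F1 where "F1 b z = (\<sigma> b - snd z) * (clip \<alpha> b - clip \<alpha> (score v z)) / (4 * \<alpha>)" for b and z :: "(nat \<Rightarrow> real) \<times> real"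
  define F2 where "F2 b z = (\<sigma> b - snd z)\<^sup>2 / 4" for b and z :: "(nat \<Rightarrow> real) \<times> real"
  have res: "\<bar>\<sigma> b - snd z\<bar> \<le> 2" if "z \<in> space D" for b z
    using sigma_bounds(1)[of b] label_abs[OF that] by linarith
  have F1b: "\<bar>F1 b z\<bar> \<le> 1" if "z \<in> space D" for b z
  proof -
    have "\<bar>clip \<alpha> b - clip \<alpha> (score v z)\<bar> \<le> 2 * \<alpha>"
      using abs_clip_le[of \<alpha> b] abs_clip_le[of \<alpha> "score v z"] alpha by linarith
    from mult_mono[OF res[OF that, of b] this] have "\<bar>(\<sigma> b - snd z) * (clip \<alpha> b - clip \<alpha> (score v z))\<bar> \<le> 4 * \<alpha>"
      by (simp add: abs_mult)
    then show ?thesis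
      unfolding F1_def abs_divide using alpha by (simp add: pos_divide_le_eq)
  qed
  have F1l: "\<bar>F1 b z - F1 c z\<bar> \<le> \<bar>clip \<alpha> b - clip \<alpha> c\<bar>" if z: "z \<in> space D" for b c z
  proof -
    let ?d = "\<bar>clip \<alpha> b - clip \<alpha> c\<bar>"
    have c2: "\<bar>clip \<alpha> b - clip \<alpha> (score v z)\<bar> \<le> 2 * \<alpha>"
      using abs_clip_le[of \<alpha> b] abs_clip_le[of \<alpha> "score v z"] alpha by linarith
    \<comment> \<open>One factor is varied at a time. The Lipschitz constants are 2 \<alpha> from
      the first term and 2 \<le> 2 \<alpha> from the second, which the divisor 4 \<alpha>
      absorbs.\<close>
    let ?P = "(\<sigma> b - \<sigma> c) * (clip \<alpha> b - clip \<alpha> (score v z))"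
    let ?Q = "(\<sigma> c - snd z) * (clip \<alpha> b - clip \<alpha> c)"
    have "(\<sigma> b - snd z) * (clip \<alpha> b - clip \<alpha> (score v z)) - (\<sigma> c - snd z) * (clip \<alpha> c - clip \<alpha> (score v z)) = ?P + ?Q"
      by (simp add: algebra_simps)
    also have "\<bar>\<dots>\<bar> \<le> \<bar>?P\<bar> + \<bar>?Q\<bar>" by (rule abs_triangle_ineq)
    also have "\<bar>?P\<bar> \<le> ?d * (2 * \<alpha>)"
      unfolding abs_mult using lip_clip c2 by (intro mult_mono) auto
    also have "\<bar>?Q\<bar> \<le> 2 * ?d"
      unfolding abs_mult using res[OF z] by (intro mult_mono) auto
    also have "2 * ?d \<le> (2 * \<alpha>) * ?d" using alpha by (intro mult_right_mono) auto
    also have "?d * (2 * \<alpha>) + (2 * \<alpha>) * ?d = ?d * (4 * \<alpha>)" by simp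
    finally have "\<bar>(\<sigma> b - snd z) * (clip \<alpha> b - clip \<alpha> (score v z)) - (\<sigma> c - snd z) * (clip \<alpha> c - clip \<alpha> (score v z))\<bar> \<le> ?d * (4 * \<alpha>)"
      by simp
    then show ?thesis
      unfolding F1_def diff_divide_distrib[symmetric] abs_divide
      using alpha by (simp add: pos_divide_le_eq)
  qed
  have F2b: "\<bar>F2 b z\<bar> \<le> 1" if "z \<in> space D" for b z
    using power_mono[OF res[OF that, of b], of 2] by (simp add: F2_def)
  have F2l: "\<bar>F2 b z - F2 c z\<bar> \<le> \<bar>clip \<alpha> b - clip \<alpha> c\<bar>" if z: "z \<in> space D" for b c z
  proof -
    have "(\<sigma> b - snd z)\<^sup>2 - (\<sigma> c - snd z)\<^sup>2 = (\<sigma> b - \<sigma> c) * ((\<sigma> b - snd z) + (\<sigma> c - snd z))"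
      by (simp add: power2_eq_square algebra_simps)
    moreover have "\<bar>(\<sigma> b - snd z) + (\<sigma> c - snd z)\<bar> \<le> 4"
      using res[OF z, of b] res[OF z, of c] by linarith
    then have "\<bar>(\<sigma> b - \<sigma> c) * ((\<sigma> b - snd z) + (\<sigma> c - snd z))\<bar> \<le> \<bar>clip \<alpha> b - clip \<alpha> c\<bar> * 4"
      unfolding abs_mult using lip_clip by (intro mult_mono) auto
    ultimately show ?thesis by (simp add: F2_def diff_divide_distrib[symmetric])
  qed
  have m1: "(\<lambda>z. F1 (score u z) z) \<in> borel_measurable D" for u unfolding F1_def by measurable
  have m2: "(\<lambda>z. F2 (score u z) z) \<in> borel_measurable D" for u unfolding F2_def by measurable
  have "\<exists>B\<in>sets S. ?U (4 * \<alpha>) F1 B"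
    by (rule uniform[of F1, OF m1], erule F1b, erule F1l, use alpha in simp)
  then obtain B1 where B1: "B1 \<in> sets S" and U1: "?U (4 * \<alpha>) F1 B1" by (rule bexE)
  have "\<exists>B\<in>sets S. ?U 4 F2 B"
    by (rule uniform[of F2, OF m2], erule F2b, erule F2l, simp)
  then obtain B2 where B2: "B2 \<in> sets S" and U2: "?U 4 F2 B2" by (rule bexE)
  have "\<exists>B\<in>sets S. ?U 4 (\<lambda>b z. - F2 b z) B"
    by (rule uniform[of "\<lambda>b z. - F2 b z"], use m2 in simp, unfold abs_minus_cancel minus_diff_minus, erule F2b, erule F2l, simp)
  then obtain B3 where B3: "B3 \<in> sets S" and U3: "?U 4 (\<lambda>b z. - F2 b z) B3" by (rule bexE)
  have r1: "4 * \<alpha> * F1 (score u z) z = ramp u z" for u z using alpha by (simp add: F1_def)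
  have r2: "4 * F2 (score u z) z = sqloss u z" "4 * (- F2 (score u z) z) = - sqloss u z" for u z by (simp_all add: F2_def)
  have "AE \<omega> in S. \<forall>i. \<bar>score v (\<omega> i)\<bar> \<ge> \<alpha> \<longrightarrow> snd (\<omega> i) = sgn (score v (\<omega> i))"
    unfolding AE_all_countable
    by (intro allI AE_component labels_consistent) simp
  then obtain Z where Z: "Z \<in> null_sets S"
    "{\<omega> \<in> space S. \<not> (\<forall>i. \<bar>score v (\<omega> i)\<bar> \<ge> \<alpha> \<longrightarrow> snd (\<omega> i) = sgn (score v (\<omega> i)))} \<subseteq> Z"
    unfolding eventually_ae_filter by (elim bexE)
  define E where "E = space S - (B1 \<union> B2 \<union> B3 \<union> Z)"
  have sets: "Z \<in> sets S" using Z(1) by (rule null_setsD2)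
  have "measure S (B1 \<union> B2 \<union> B3 \<union> Z) \<le> measure S (B1 \<union> B2 \<union> B3) + measure S Z"
    using B1 B2 B3 sets by (intro measure_Un_le) auto
  also have "measure S (B1 \<union> B2 \<union> B3) \<le> measure S (B1 \<union> B2) + measure S B3"
    using B1 B2 B3 by (intro measure_Un_le) auto
  also have "measure S (B1 \<union> B2) \<le> measure S B1 + measure S B2"
    using B1 B2 by (intro measure_Un_le) auto
  finally have "measure S (B1 \<union> B2 \<union> B3 \<union> Z) \<le> measure S B1 + measure S B2 + measure S B3 + measure S Z" by simp
  moreover have "measure S Z = 0" using Z(1) by (simp add: measure_eq_0_null_sets)
  ultimately have "measure S (B1 \<union> B2 \<union> B3 \<union> Z) \<le> 1 / 100"
    using conjunct1[OF U1] conjunct1[OF U2] conjunct1[OF U3] by linarith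
  then have "0.99 \<le> measure S E"
    unfolding E_def using B1 B2 B3 sets by (subst P.prob_compl) auto
  moreover have "good_sample m \<omega>" if w: "\<omega> \<in> E" for \<omega>
    unfolding good_sample_def
  proof (intro conjI allI)
    have wS: "\<omega> \<in> space S - B1" "\<omega> \<in> space S - B2" "\<omega> \<in> space S - B3" "\<omega> \<in> space S" "\<omega> \<notin> Z"
      using w by (auto simp: E_def)
    show "\<bar>score v (\<omega> i)\<bar> \<ge> \<alpha> \<longrightarrow> snd (\<omega> i) = sgn (score v (\<omega> i))" for i
      using Z(2) wS(4,5) by blast
    show "m * (\<integral>z. ramp u z \<partial>D) \<le> (\<Sum>i<m. ramp u (\<omega> i)) + m * (2 * \<alpha> * \<epsilon>)" for u
      using bspec[OF conjunct2[OF U1] wS(1), THEN spec, of u] unfolding r1 by simp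
    show "\<bar>m * (\<integral>z. sqloss u z \<partial>D) - (\<Sum>i<m. sqloss u (\<omega> i))\<bar> \<le> m * (2 * \<epsilon>)" for u
      using bspec[OF conjunct2[OF U2] wS(2), THEN spec, of u] bspec[OF conjunct2[OF U3] wS(3), THEN spec, of u]
      unfolding r2 by (simp add: sum_negf abs_le_iff)
  qed
  moreover have "E \<in> sets S" unfolding E_def using B1 B2 B3 sets by auto
  ultimately show ?thesis by blast
qed

end

section \<open>Determinants and volumes\<close>

text \<open>Matrices are functions of two indices, as in the arrays of the program, and are
  converted to the matrix type only to speak of determinants.\<close>

definition fdet :: "nat \<Rightarrow> (nat \<Rightarrow> nat \<Rightarrow> real) \<Rightarrow> real" where
  "fdet n B = det (mat n n (\<lambda>(i, j). B i j))"

definition fmult :: "nat \<Rightarrow> (nat \<Rightarrow> nat \<Rightarrow> real) \<Rightarrow> (nat \<Rightarrow> nat \<Rightarrow> real) \<Rightarrow> nat \<Rightarrow> nat \<Rightarrow> real" where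
  "fmult n A B i j = (\<Sum>k<n. A i k * B k j)"

lemma fdet_cong: "(\<And>i j. i < n \<Longrightarrow> j < n \<Longrightarrow> A i j = B i j) \<Longrightarrow> fdet n A = fdet n B"
  unfolding fdet_def by (intro arg_cong[where f = det] eq_matI) auto

lemma fmult_mat: "mat n n (\<lambda>(i, j). fmult n A B i j) = mat n n (\<lambda>(i, j). A i j) * mat n n (\<lambda>(i, j). B i j)"
  by (intro eq_matI) (auto simp: fmult_def scalar_prod_def atLeast0LessThan)

lemma fdet_fmult: "fdet n (fmult n A B) = fdet n A * fdet n B"
  unfolding fdet_def fmult_mat by (rule det_mult) auto

lemma fdet_scale: "fdet n (\<lambda>i j. l * B i j) = l ^ n * fdet n B"
proof -
  have "mat n n (\<lambda>(i, j). l * B i j) = l \<cdot>\<^sub>m mat n n (\<lambda>(i, j). B i j)"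
    by (intro eq_matI) auto
  then show ?thesis by (simp add: fdet_def det_smult)
qed

lemma fdet_identity: "fdet n (\<lambda>i j. if i = j then 1 else 0) = 1"
proof -
  have "mat n n (\<lambda>(i, j). if i = j then 1 else 0 :: real) = 1\<^sub>m n" by (intro eq_matI) auto
  then show ?thesis by (simp add: fdet_def)
qed

lemma abs_fdet_le_fact:
  assumes "\<And>i j. i < n \<Longrightarrow> j < n \<Longrightarrow> \<bar>B i j\<bar> \<le> 1"
  shows "\<bar>fdet n B\<bar> \<le> fact n"
proof -
  have "\<bar>fdet n B\<bar> = \<bar>\<Sum>p \<in> {p. p permutes {0..<n}}. signof p * (\<Prod>i = 0..<n. mat n n (\<lambda>(i, j). B i j) $$ (i, p i))\<bar>"
    unfolding fdet_def by (subst det_def'[of _ n]) auto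
  also have "\<dots> \<le> (\<Sum>p \<in> {p. p permutes {0..<n}}. 1)"
  proof (rule order_trans[OF sum_abs sum_mono])
    fix p assume "p \<in> {p. p permutes {0..<n}}"
    then have p: "p permutes {0..<n}" by simp
    have "\<bar>\<Prod>i = 0..<n. mat n n (\<lambda>(i, j). B i j) $$ (i, p i)\<bar> \<le> 1"
      unfolding abs_prod
    proof (rule prod_le_1)
      fix i assume i: "i \<in> {0..<n}"
      then have "p i < n" using permutes_in_image[OF p] by auto
      then show "0 \<le> \<bar>mat n n (\<lambda>(i, j). B i j) $$ (i, p i)\<bar> \<and> \<bar>mat n n (\<lambda>(i, j). B i j) $$ (i, p i)\<bar> \<le> 1"
        using i assms[of i "p i"] by simp
    qed
    moreover have "\<bar>signof p :: real\<bar> = 1" by (simp add: sign_def)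
    ultimately show "\<bar>signof p * (\<Prod>i = 0..<n. mat n n (\<lambda>(i, j). B i j) $$ (i, p i))\<bar> \<le> 1"
      by (simp only: abs_mult mult_1_left)
  qed
  also have "\<dots> = fact n" by (simp add: card_permutations)
  finally show ?thesis .
qed

lemma arg_cong4: "a = a' \<Longrightarrow> b = b' \<Longrightarrow> c = c' \<Longrightarrow> d = d' \<Longrightarrow> f a b c d = f a' b' c' d'"
  by simp

text \<open>Both sides come from the two block triangular factorisations of the bordered matrix.\<close>
lemma det_rank_one_update:
  fixes u w :: "nat \<Rightarrow> real"
  shows "fdet n (\<lambda>i j. (if i = j then 1 else 0) + u i * w j) = 1 + (\<Sum>i<n. u i * w i)"
proof -
  define U where "U = mat n 1 (\<lambda>(i, _). u i)"
  define W where "W = mat 1 n (\<lambda>(_, j). w j)"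
  define I where "I = (1\<^sub>m n :: real mat)"
  define J where "J = (1\<^sub>m 1 :: real mat)"
  have c: "U \<in> carrier_mat n 1" "W \<in> carrier_mat 1 n" "I \<in> carrier_mat n n" "J \<in> carrier_mat 1 1"
    by (auto simp: U_def W_def I_def J_def)
  have UW: "U * W \<in> carrier_mat n n" "W * U \<in> carrier_mat 1 1" using c by auto
  define Z where "Z = (0\<^sub>m n 1 :: real mat)"
  define Y where "Y = (0\<^sub>m 1 n :: real mat)"
  have z: "Z \<in> carrier_mat n 1" "Y \<in> carrier_mat 1 n" by (auto simp: Z_def Y_def)
  have IUW: "I + U * W \<in> carrier_mat n n" and WUJ: "W * U + J \<in> carrier_mat 1 1" using c by auto
  let ?L = "four_block_mat I Z W J"
  let ?M = "four_block_mat (I + U * W) U Y J"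
  let ?M' = "four_block_mat I U Y (W * U + J)"
  have "?L * ?M = four_block_mat (I * (I + U * W) + Z * Y) (I * U + Z * J) (W * (I + U * W) + J * Y) (W * U + J * J)"
    by (rule mult_four_block_mat[OF c(3) z(1) c(2,4) IUW c(1) z(2) c(4)])
  also have "\<dots> = four_block_mat (I * I + U * W) (I * Z + U * J) (Y * I + (W * U + J) * W) (Y * Z + (W * U + J) * J)"
  proof (rule arg_cong4[where f = four_block_mat])
    show "I * (I + U * W) + Z * Y = I * I + U * W" using c z by (simp add: I_def Z_def)
    show "I * U + Z * J = I * Z + U * J" using c z by (simp add: I_def J_def Z_def)
    have "W * (I + U * W) = W * I + W * (U * W)" using c by (intro mult_add_distrib_mat) auto
    moreover have "(W * U + J) * W = W * U * W + J * W" using c by (intro add_mult_distrib_mat) auto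
    moreover have "W * U * W = W * (U * W)" using c by (intro assoc_mult_mat) auto
    moreover have "W + W * (U * W) = W * (U * W) + W" using c by (intro comm_add_mat) auto
    ultimately show "W * (I + U * W) + J * Y = Y * I + (W * U + J) * W"
      using c z by (simp add: I_def J_def Y_def)
    show "W * U + J * J = Y * Z + (W * U + J) * J" using c z WUJ by (simp add: J_def Y_def)
  qed
  also have "\<dots> = ?M' * ?L"
    by (rule mult_four_block_mat[OF c(3,1) z(2) WUJ c(3) z(1) c(2,4), symmetric])
  finally have "det (?L * ?M) = det (?M' * ?L)" by (rule arg_cong)
  moreover have "?L \<in> carrier_mat (n + 1) (n + 1)" "?M \<in> carrier_mat (n + 1) (n + 1)" "?M' \<in> carrier_mat (n + 1) (n + 1)"
    by (rule four_block_carrier_mat[OF c(3,4)] four_block_carrier_mat[OF IUW c(4)] four_block_carrier_mat[OF c(3) WUJ])+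
  ultimately have "det ?L * det ?M = det ?M' * det ?L" by (metis det_mult)
  moreover have "det ?L = 1"
    by (subst det_four_block_mat_upper_right_zero[OF c(3) Z_def c(2,4)]) (simp add: I_def J_def)
  moreover have "det ?M = det (I + U * W)"
    by (subst det_four_block_mat_lower_left_zero[OF IUW c(1) Y_def c(4)]) (simp add: J_def)
  moreover have "det ?M' = det (W * U + J)"
    by (subst det_four_block_mat_lower_left_zero[OF c(3) c(1) Y_def WUJ]) (simp add: I_def)
  moreover have "det (W * U + J) = 1 + (\<Sum>i<n. u i * w i)"
    by (subst det_single[OF WUJ]) (simp add: W_def U_def J_def scalar_prod_def atLeast0LessThan mult.commute)
  moreover have "mat n n (\<lambda>(i, j). (if i = j then 1 else 0) + u i * w j) = I + U * W"
    by (intro eq_matI) (auto simp: I_def U_def W_def scalar_prod_def)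
  ultimately show ?thesis by (simp add: fdet_def)
qed

section \<open>Linear images of the unit ball\<close>

definition fapp :: "nat \<Rightarrow> (nat \<Rightarrow> nat \<Rightarrow> real) \<Rightarrow> (nat \<Rightarrow> real) \<Rightarrow> nat \<Rightarrow> real" where
  "fapp n B z i = (\<Sum>j<n. B i j * z j)"

lemma fapp_fmult: "fapp n (fmult n A B) z i = fapp n A (fapp n B z) i"
  unfolding fapp_def fmult_def
  by (simp add: sum_distrib_left sum_distrib_right, subst sum.swap) (simp add: mult_ac)

lemma fapp_cong: "(\<And>j. j < n \<Longrightarrow> y j = z j) \<Longrightarrow> fapp n B y i = fapp n B z i"
  by (simp add: fapp_def)

lemma fapp_scale: "fapp n B (\<lambda>j. l * z j) i = l * fapp n B z i"
  by (simp add: fapp_def sum_distrib_left mult_ac)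

lemma abs_le_of_dot_le_1:
  assumes "dot n z z \<le> 1" "i < n"
  shows "\<bar>z i\<bar> \<le> 1"
proof -
  have "z i * z i \<le> dot n z z"
    unfolding dot_def using assms(2) by (intro member_le_sum) auto
  then have "(z i)\<^sup>2 \<le> 1" using assms(1) by (simp add: power2_eq_square)
  then show ?thesis by (simp add: abs_square_le_1)
qed

text \<open>Instead of Hadamard's inequality: if \<open>B\<close> maps the unit ball onto a superset of the ball of radius
  \<open>r\<close>, then \<open>B^k N = r^k I\<close> for some \<open>N\<close> with entries in \<open>[-1, 1]\<close>, so \<open>r^(n k) \<le> \<bar>det B\<bar>^k n!\<close> for all \<open>k\<close>.\<close>
lemma fdet_ge_of_ball_subset_image:
  assumes r: "r > 0"
    and onto: "\<And>p. dot n p p \<le> 1 \<Longrightarrow> \<exists>z. dot n z z \<le> 1 \<and> (\<forall>i<n. fapp n B z i = r * p i)"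
  shows "r ^ n \<le> \<bar>fdet n B\<bar>"
proof -
  let ?id = "\<lambda>i j. if i = j then 1 else 0 :: real"
  define P where "P k = ((fmult n B) ^^ k) ?id" for k
  have P0: "P 0 = ?id" and PS: "P (Suc k) = fmult n B (P k)" for k by (simp_all add: P_def)
  have detP: "fdet n (P k) = fdet n B ^ k" for k
    by (induction k) (simp_all add: P0 PS fdet_identity fdet_fmult)
  have Ponto: "\<exists>z. dot n z z \<le> 1 \<and> (\<forall>i<n. fapp n (P k) z i = r ^ k * p i)" if "dot n p p \<le> 1" for k p
    using that
  proof (induction k arbitrary: p)
    case 0
    have "fapp n ?id p i = p i" if "i < n" for i
      using that unfolding fapp_def by (subst sum.mono_neutral_right[of _ "{i}"]) auto
    then show ?case using 0 unfolding P0 by (intro exI[of _ p]) simp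
  next
    case (Suc k)
    obtain y where y: "dot n y y \<le> 1" "\<forall>i<n. fapp n B y i = r * p i" using onto[OF Suc.prems] by blast
    obtain z where z: "dot n z z \<le> 1" "\<forall>i<n. fapp n (P k) z i = r ^ k * y i" using Suc.IH[OF y(1)] by blast
    have "fapp n (P (Suc k)) z i = r ^ Suc k * p i" if "i < n" for i
    proof -
      have "fapp n (P (Suc k)) z i = fapp n B (\<lambda>i. r ^ k * y i) i"
        unfolding PS fapp_fmult using z(2) by (intro fapp_cong) simp
      then show ?thesis using y(2) that by (simp add: fapp_scale)
    qed
    then show ?case using z(1) by blast
  qed
  have key: "(r ^ n) ^ k \<le> \<bar>fdet n B\<bar> ^ k * fact n" for k
  proof -
    have "\<exists>z. dot n z z \<le> 1 \<and> (\<forall>i<n. fapp n (P k) z i = r ^ k * ?id i j)" if "j < n" for j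
    proof (rule Ponto)
      have "dot n (\<lambda>i. ?id i j) (\<lambda>i. ?id i j) = 1"
        using that unfolding dot_def by (subst sum.mono_neutral_right[of _ "{j}"]) auto
      then show "dot n (\<lambda>i. ?id i j) (\<lambda>i. ?id i j) \<le> 1" by simp
    qed
    then obtain z where z: "\<And>j. j < n \<Longrightarrow> dot n (z j) (z j) \<le> 1"
      "\<And>i j. j < n \<Longrightarrow> i < n \<Longrightarrow> fapp n (P k) (z j) i = r ^ k * ?id i j"
      by metis
    \<comment> \<open>The columns of \<open>N\<close> are preimages of the unit vectors, so
      multiplying \<open>P k\<close> by \<open>N\<close> gives \<open>r ^ k\<close> times the
      identity.\<close>
    define N where "N i j = z j i" for i j
    have "fdet n (P k) * fdet n N = fdet n (\<lambda>i j. r ^ k * ?id i j)"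
      unfolding fdet_fmult[symmetric]
      by (intro fdet_cong) (use z(2) in \<open>simp add: fmult_def fapp_def N_def\<close>)
    also have "\<dots> = (r ^ k) ^ n" by (simp add: fdet_scale fdet_identity)
    finally have "(r ^ n) ^ k = \<bar>fdet n B ^ k * fdet n N\<bar>"
      using r by (simp add: detP power_mult[symmetric] mult.commute)
    also have "\<dots> = \<bar>fdet n B\<bar> ^ k * \<bar>fdet n N\<bar>" by (simp add: abs_mult power_abs)
    also have "\<dots> \<le> \<bar>fdet n B\<bar> ^ k * fact n"
      using abs_le_of_dot_le_1 z(1) by (intro mult_left_mono abs_fdet_le_fact) (auto simp: N_def)
    finally show ?thesis .
  qed
  show ?thesis
  proof (rule ccontr)
    let ?d = "\<bar>fdet n B\<bar>"
    assume "\<not> r ^ n \<le> ?d"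
    then have lt: "?d < r ^ n" by simp
    have "?d \<noteq> 0" using key[of 1] zero_less_power[OF r, of n] by auto
    then have d: "?d > 0" by simp
    then have "1 < r ^ n / ?d" using lt by simp
    \<comment> \<open>The factor \<open>fact n\<close> does not depend on \<open>k\<close>, so a
      sufficiently high power outgrows it.\<close>
    then obtain k where "fact n < (r ^ n / ?d) ^ k" using real_arch_pow by blast
    then have "?d ^ k * fact n < (r ^ n) ^ k" using d by (simp add: power_divide field_simps)
    then show False using key[of k] by simp
  qed
qed

section \<open>Central cuts without square roots\<close>

lemma dot_add_left: "dot n (\<lambda>i. u i + w i) x = dot n u x + dot n w x"
  by (simp add: dot_def distrib_right sum.distrib)

lemma dot_diff_left: "dot n (\<lambda>i. u i - w i) x = dot n u x - dot n w x"
  by (simp add: dot_def left_diff_distrib sum_subtractf)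

lemma dot_add_right: "dot n x (\<lambda>i. u i + w i) = dot n x u + dot n x w"
  by (simp add: dot_def distrib_left sum.distrib)

lemma dot_diff_right: "dot n x (\<lambda>i. u i - w i) = dot n x u - dot n x w"
  by (simp add: dot_def right_diff_distrib sum_subtractf)

lemma dot_scale_left: "dot n (\<lambda>i. c * u i) x = c * dot n u x"
  by (simp add: dot_def sum_distrib_left mult.assoc)

lemma dot_scale_right: "dot n x (\<lambda>i. c * u i) = c * dot n x u"
  by (simp add: dot_def sum_distrib_left mult_ac)

lemma dot_cong: "(\<And>i. i < n \<Longrightarrow> u i = u' i) \<Longrightarrow> (\<And>i. i < n \<Longrightarrow> x i = x' i) \<Longrightarrow> dot n u x = dot n u' x'"
  by (simp add: dot_def)

lemma dot_self_nonneg: "0 \<le> dot n x x"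
  by (simp add: dot_def sum_nonneg)

lemma L2_set_dot: "L2_set x {..<n} = sqrt (dot n x x)"
  by (simp add: L2_set_def dot_def power2_eq_square)

lemma dot_le_L2_set: "\<bar>dot n u x\<bar> \<le> L2_set u {..<n} * L2_set x {..<n}"
proof -
  have "\<bar>dot n u x\<bar> \<le> (\<Sum>i<n. \<bar>u i\<bar> * \<bar>x i\<bar>)"
    unfolding dot_def by (rule order_trans[OF sum_abs]) (simp add: abs_mult)
  also have "\<dots> \<le> L2_set u {..<n} * L2_set x {..<n}"
    by (rule L2_set_mult_ineq)
  finally show ?thesis .
qed

lemma dot_square_le: "(dot n u x)\<^sup>2 \<le> dot n u u * dot n x x"
proof -
  have "\<bar>dot n u x\<bar>\<^sup>2 \<le> (L2_set u {..<n} * L2_set x {..<n})\<^sup>2"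
    by (intro power_mono dot_le_L2_set) simp
  then show ?thesis by (simp add: L2_set_dot power_mult_distrib dot_self_nonneg)
qed

text \<open>Keeping a factor \<open>B\<close> instead of a positive definite matrix makes the
  determinant directly comparable with powers of a radius. Only the first \<open>n\<close>
  coordinates are constrained.\<close>

definition ellipsoid :: "nat \<Rightarrow> (nat \<Rightarrow> real) \<Rightarrow> (nat \<Rightarrow> nat \<Rightarrow> real) \<Rightarrow> (nat \<Rightarrow> real) set" where
  "ellipsoid n c B = {x. \<exists>z. dot n z z \<le> 1 \<and> (\<forall>i<n. x i = c i + fapp n B z i)}"

text \<open>One central cut with square roots avoided: \<open>s = \<Sum> \<bar>h j\<bar>\<close> overestimates the norm of the transformed
  gradient \<open>h = B\<^sup>T g\<close> by at most the factor \<open>sqrt n\<close>, and \<open>1 + q / (8 n)\<close> and \<open>1 - q / 4\<close> are rational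
  upper bounds for the optimal semi-axes.\<close>
definition cut_step :: "nat \<Rightarrow> (nat \<Rightarrow> real) \<Rightarrow> (nat \<Rightarrow> real) \<Rightarrow> (nat \<Rightarrow> nat \<Rightarrow> real) \<Rightarrow>
    (nat \<Rightarrow> real) \<Rightarrow> (nat \<Rightarrow> nat \<Rightarrow> real) \<Rightarrow> bool" where
  "cut_step n g c B c' B' \<longleftrightarrow>
    (let h = (\<lambda>j. \<Sum>i<n. B i j * g i); s = (\<Sum>j<n. \<bar>h j\<bar>); H = dot n h h; q = H / (s * s) / n; r = fapp n B h in
      (\<forall>i<n. c' i = c i - r i / (2 * real n * s * (1 + q))) \<and>
      (\<forall>i<n. \<forall>j<n. B' i j = (1 + q / (8 * real n)) * (B i j - q / 4 * r i * h j / H)))"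

lemma dot_transpose: "dot n (\<lambda>j. \<Sum>i<n. B i j * g i) z = dot n g (fapp n B z)"
  unfolding dot_def fapp_def by (simp add: sum_distrib_left sum_distrib_right, subst sum.swap) (simp add: mult_ac)

locale cut =
  fixes n :: nat and g c :: "nat \<Rightarrow> real" and B :: "nat \<Rightarrow> nat \<Rightarrow> real" and c' B'
  assumes n: "n \<ge> 1" and step: "cut_step n g c B c' B'"
    and nonzero: "dot n (\<lambda>j. \<Sum>i<n. B i j * g i) (\<lambda>j. \<Sum>i<n. B i j * g i) \<noteq> 0"
begin

definition "h = (\<lambda>j. \<Sum>i<n. B i j * g i)"
definition "s = (\<Sum>j<n. \<bar>h j\<bar>)"
definition "H = dot n h h"
text \<open>With the exact squared norm in place of \<open>s * s\<close> this would be 1 / n. The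
  overestimate \<open>s\<close> leaves it between 1 / n^2 and 1 / n, and it sets the strength of the
  cut.\<close>

definition "q = H / (s * s) / n"
definition "r = fapp n B h"

lemma step_unfolded:
  "(\<forall>i<n. c' i = c i - r i / (2 * real n * s * (1 + q))) \<and>
    (\<forall>i<n. \<forall>j<n. B' i j = (1 + q / (8 * real n)) * (B i j - q / 4 * r i * h j / H))"
  using step by (simp only: cut_step_def Let_def q_def H_def s_def r_def h_def)

lemma c'_eq: "i < n \<Longrightarrow> c' i = c i - r i / (2 * real n * s * (1 + q))"
  by (rule conjunct1[OF step_unfolded, rule_format])

lemma B'_eq: "i < n \<Longrightarrow> j < n \<Longrightarrow> B' i j = (1 + q / (8 * real n)) * (B i j - q / 4 * r i * h j / H)"
  by (rule conjunct2[OF step_unfolded, rule_format])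

lemma H_pos: "H > 0"
  using nonzero dot_self_nonneg[of n h] unfolding H_def h_def by linarith

lemma H_le: "H \<le> s\<^sup>2"
proof -
  have "L2_set h {..<n} \<le> s" unfolding s_def by (rule L2_set_le_sum_abs)
  then have "(L2_set h {..<n})\<^sup>2 \<le> s\<^sup>2" by (intro power_mono) auto
  then show ?thesis by (simp add: L2_set_dot dot_self_nonneg H_def)
qed

lemma s_le: "s\<^sup>2 \<le> n * H"
proof -
  have "s = dot n (\<lambda>_. 1) (\<lambda>j. \<bar>h j\<bar>)" by (simp add: s_def dot_def)
  then have "s\<^sup>2 \<le> dot n (\<lambda>_. 1) (\<lambda>_. 1) * dot n (\<lambda>j. \<bar>h j\<bar>) (\<lambda>j. \<bar>h j\<bar>)" using dot_square_le by metis
  then show ?thesis by (simp add: H_def dot_def)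
qed

lemma s_pos: "s > 0"
proof -
  have "s \<ge> 0" by (simp add: s_def sum_nonneg)
  moreover have "s \<noteq> 0" using H_le H_pos by auto
  ultimately show ?thesis by simp
qed

lemma q_pos: "q > 0" and q_le: "q \<le> 1" and q_ge: "1 / (real n)\<^sup>2 \<le> q"
proof -
  show "q > 0" using H_pos s_pos n by (simp add: q_def)
  have "H / (s * s) \<le> 1" using H_le s_pos by (simp add: power2_eq_square)
  then have "H / (s * s) / n \<le> 1 / 1" using n H_pos s_pos by (intro frac_le) auto
  then show "q \<le> 1" by (simp add: q_def)
  have "1 / real n \<le> H / (s * s)" using s_le s_pos n by (simp add: field_simps power2_eq_square)
  then have "1 / real n / n \<le> H / (s * s) / n" using n by (intro divide_right_mono) auto
  then show "1 / (real n)\<^sup>2 \<le> q" by (simp add: q_def power2_eq_square)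
qed

text \<open>The new matrix is 1 + q / (8 n) times the product of \<open>B\<close> with the identity
  minus q / 4 times the projection onto \<open>h\<close>. The scalar contributes at most exp (q / 8)
  to the determinant, the rank one update contributes 1 - q / 4 \<le> exp (- q / 4), and q \<ge> 1 /
  n^2.\<close>

lemma fdet_step: "\<bar>fdet n B'\<bar> \<le> exp (- (1 / (8 * (real n)\<^sup>2))) * \<bar>fdet n B\<bar>"
proof -
  let ?l = "1 + q / (8 * real n)"
  have l: "?l \<ge> 0" using q_pos n by simp
  let ?R = "\<lambda>i j. (if i = j then 1 else 0) + h i * (- (q / 4) * h j / H)"
  have "B' i j = ?l * fmult n B ?R i j" if "i < n" "j < n" for i j
  proof -
    have "fmult n B (\<lambda>i j. (if i = j then 1 else 0) + h i * C j) i j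
        = (\<Sum>k<n. B i k * (if k = j then 1 else 0)) + (\<Sum>k<n. B i k * h k) * C j" for C
      by (simp only: fmult_def distrib_left sum.distrib sum_distrib_right mult.assoc)
    then have "fmult n B ?R i j = (\<Sum>k<n. B i k * (if k = j then 1 else 0)) + (\<Sum>k<n. B i k * h k) * (- (q / 4) * h j / H)" .
    also have "(\<Sum>k<n. B i k * (if k = j then 1 else 0)) = B i j"
      using that by (subst sum.mono_neutral_right[of _ "{j}"]) auto
    finally show ?thesis using B'_eq[OF that] by (simp add: r_def fapp_def)
  qed
  then have "fdet n B' = fdet n (\<lambda>i j. ?l * fmult n B ?R i j)" by (intro fdet_cong)
  also have "\<dots> = ?l ^ n * (fdet n B * fdet n ?R)" by (simp add: fdet_scale fdet_fmult)
  also have "fdet n ?R = 1 - q / 4"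
  proof -
    have "(\<Sum>i<n. h i * (- (q / 4) * h i / H)) = - (q / 4) / H * dot n h h"
      by (simp add: dot_def sum_distrib_left field_simps)
    then show ?thesis using H_pos unfolding det_rank_one_update by (simp add: H_def)
  qed
  finally have "\<bar>fdet n B'\<bar> = ?l ^ n * (1 - q / 4) * \<bar>fdet n B\<bar>"
    using l q_le by (simp add: abs_mult power_abs)
  also have "\<dots> \<le> exp (- (1 / (8 * (real n)\<^sup>2))) * \<bar>fdet n B\<bar>"
  proof (rule mult_right_mono)
    have "?l ^ n \<le> exp (q / (8 * real n)) ^ n" using l by (intro power_mono exp_ge_add_one_self)
    also have "\<dots> = exp (q / 8)" using n by (simp add: exp_of_nat_mult[symmetric])
    finally have "?l ^ n * (1 - q / 4) \<le> exp (q / 8) * exp (- (q / 4))"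
      using q_le exp_ge_add_one_self[of "- (q / 4)"] by (intro mult_mono) auto
    also have "\<dots> = exp (- (q / 8))" by (simp add: exp_add[symmetric])
    also have "\<dots> \<le> exp (- (1 / (8 * (real n)\<^sup>2)))" using q_ge by simp
    finally show "?l ^ n * (1 - q / 4) \<le> exp (- (1 / (8 * (real n)\<^sup>2)))" .
  qed simp
  finally show ?thesis .
qed

text \<open>In the coordinates \<open>z\<close> of the unit ball the kept half is
  \<open>p = h \<cdot> z \<le> 0\<close>, and \<open>p \<ge> - s\<close> because \<open>s\<close>
  overestimates the norm of \<open>h\<close>. The preimage \<open>z'\<close> of \<open>x\<close>
  under the new map is written down by inverting the rank one factor, and its norm is estimated as a
  quadratic function of \<open>p / s\<close>.\<close>

lemma half_ellipsoid_subset: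
  assumes x: "x \<in> ellipsoid n c B" and le: "dot n g (\<lambda>i. x i - c i) \<le> 0"
  shows "x \<in> ellipsoid n c' B'"
proof -
  obtain z where z: "dot n z z \<le> 1" and xz: "\<And>i. i < n \<Longrightarrow> x i = c i + fapp n B z i"
    using x by (auto simp: ellipsoid_def)
  define p where "p = dot n h z"
  have p0: "p \<le> 0"
  proof -
    have "p = dot n g (fapp n B z)" by (simp add: p_def h_def dot_transpose)
    also have "\<dots> = dot n g (\<lambda>i. x i - c i)" by (intro dot_cong) (auto simp: xz)
    finally show ?thesis using le by simp
  qed
  have "p\<^sup>2 \<le> H * 1"
    using dot_square_le[of n h z] z H_pos mult_left_mono[of "dot n z z" 1 H] unfolding p_def H_def by linarith
  then have "p\<^sup>2 \<le> s\<^sup>2" using H_le by linarith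
  then have ps: "- s \<le> p" using s_pos abs_le_square_iff[of p s] by linarith
  let ?N = "real n"
  define \<zeta> where "\<zeta> = 1 / (2 * real n * s * (1 + q))"
  define \<beta> where "\<beta> = q / 4"
  define \<mu> where "\<mu> = 1 + q / (8 * real n)"
  define w where "w = (\<lambda>i. z i + \<zeta> * h i)"
  define a where "a = dot n h w"
  \<comment> \<open>Chosen such that 1 + \<theta> is the inverse of 1 - \<beta>: it undoes the
    contraction along \<open>h\<close>.\<close>
  define \<theta> where "\<theta> = \<beta> / (1 - \<beta>)"
  define z' where "z' = (\<lambda>i. (1 / \<mu>) * (w i + \<theta> * a / H * h i))"
  have l0: "\<mu> \<ge> 1" using q_pos n by (simp add: \<mu>_def)
  have b1: "1 - \<beta> > 0" using q_le by (simp add: \<beta>_def)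
  have fz': "fapp n B' z' i = fapp n B z i + \<zeta> * r i" if i: "i < n" for i
  proof -
    have lin: "fapp n B (\<lambda>j. u j + k * h j) i = fapp n B u i + k * r i" for u k
      by (simp add: fapp_def r_def distrib_left sum.distrib sum_distrib_left mult_ac)
    have "fapp n B' z' i = (\<Sum>j<n. \<mu> * (B i j - \<beta> * r i * h j / H) * z' j)"
      using B'_eq[OF i] by (simp add: fapp_def \<mu>_def \<beta>_def)
    also have "\<dots> = (\<Sum>j<n. \<mu> * (B i j * z' j) - \<mu> * (\<beta> * r i / H) * (h j * z' j))"
      by (intro sum.cong) (simp_all add: algebra_simps)
    also have "\<dots> = \<mu> * (fapp n B z' i) - \<mu> * (\<beta> * r i / H) * dot n h z'"
      by (simp only: fapp_def dot_def sum_subtractf sum_distrib_left)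
    also have "\<dots> = \<mu> * (fapp n B z' i - \<beta> * r i / H * dot n h z')"
      by (simp only: right_diff_distrib mult.assoc)
    also have "fapp n B z' i = (1 / \<mu>) * (fapp n B w i + \<theta> * a / H * r i)"
      unfolding z'_def fapp_scale lin ..
    also have "dot n h z' = (1 / \<mu>) * (a + \<theta> * a)"
      unfolding z'_def dot_scale_right dot_add_right using H_pos by (simp add: a_def H_def)
    also have "\<mu> * (1 / \<mu> * (fapp n B w i + \<theta> * a / H * r i) - \<beta> * r i / H * (1 / \<mu> * (a + \<theta> * a)))
        = fapp n B w i + (\<theta> - \<beta> * (1 + \<theta>)) * (a / H * r i)"
      using l0 H_pos by (simp add: field_simps)
    also have "\<theta> - \<beta> * (1 + \<theta>) = 0" using b1 by (simp add: \<theta>_def field_simps)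
    also have "fapp n B w i = fapp n B z i + \<zeta> * r i" unfolding w_def lin ..
    finally show ?thesis by simp
  qed
  have "dot n z' z' \<le> 1"
  proof -
    have ww: "dot n w w = dot n z z + 2 * \<zeta> * p + \<zeta>\<^sup>2 * H"
      by (simp add: w_def dot_add_left dot_add_right dot_scale_left dot_scale_right dot_commute[of n z h]
          p_def H_def power2_eq_square algebra_simps)
    have aa: "a = p + \<zeta> * H"
      by (simp add: a_def w_def dot_add_right dot_scale_right p_def H_def)
    have "dot n z' z' = (1 / \<mu>)\<^sup>2 * (dot n w w + 2 * (\<theta> * a / H) * a + (\<theta> * a / H)\<^sup>2 * H)"
      unfolding z'_def dot_scale_left dot_scale_right dot_add_left dot_add_right
      by (simp add: dot_commute[of n w h] a_def[symmetric] H_def[symmetric] power2_eq_square algebra_simps)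
    also have "\<dots> = (1 / \<mu>)\<^sup>2 * (dot n w w + ((1 + \<theta>)\<^sup>2 - 1) * (a\<^sup>2 / H))"
      using H_pos by (simp add: power2_eq_square field_simps)
    also have "\<dots> \<le> (1 / \<mu>)\<^sup>2 * (dot n w w + q * (a\<^sup>2 / H))"
    proof (intro mult_left_mono add_left_mono mult_right_mono)
      \<comment> \<open>The contraction by q / 4 is weak enough for undoing it to stretch squared
        lengths along \<open>h\<close> by at most 1 + q.\<close>
      have "1 \<le> (1 + q) * (1 - \<beta>)\<^sup>2"
      proof -
        have "q * q \<le> q" using q_pos q_le by (simp add: mult_left_le)
        moreover have "0 \<le> q * (q * q)" using q_pos by simp
        moreover have "(1 + q) * (1 - \<beta>)\<^sup>2 = 1 + q / 2 - 7 / 16 * (q * q) + 1 / 16 * (q * (q * q))"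
          by (simp add: \<beta>_def power2_eq_square field_simps)
        ultimately show ?thesis using q_pos by linarith
      qed
      then have "1 / (1 - \<beta>)\<^sup>2 \<le> 1 + q" using b1 by (subst pos_divide_le_eq) auto
      moreover have "1 + \<theta> = 1 / (1 - \<beta>)" using b1 by (simp add: \<theta>_def field_simps)
      then have "(1 + \<theta>)\<^sup>2 = 1 / (1 - \<beta>)\<^sup>2" by (simp add: power_divide)
      ultimately show "(1 + \<theta>)\<^sup>2 - 1 \<le> q" by linarith
    qed (use H_pos in auto)
    \<comment> \<open>The step length satisfies \<open>\<zeta> * (1 + q) = 1 / (2 * n * s)\<close>.
      This lets the linear and the quadratic term in \<open>p\<close> combine to a multiple of (p /
      s) (1 + p / s), which is nonpositive on - s \<le> p \<le> 0. The remaining constant is covered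
      by the expansion \<mu>.\<close>
    also have "dot n w w + q * (a\<^sup>2 / H) = dot n z z + (p / s) * (1 + p / s) / n + q / (4 * real n * (1 + q))"
    proof -
      have qH: "q / H = 1 / (s * s * n)" using H_pos by (simp add: q_def)
      have zq: "\<zeta> * (1 + q) = 1 / (2 * real n * s)" using q_pos n s_pos by (simp add: \<zeta>_def)
      have "q * (a\<^sup>2 / H) = (q / H) * p\<^sup>2 + 2 * q * \<zeta> * p + q * \<zeta>\<^sup>2 * H"
        using H_pos by (simp add: aa power2_eq_square field_simps)
      then have "dot n w w + q * (a\<^sup>2 / H) = dot n z z + 2 * (\<zeta> * (1 + q)) * p + \<zeta> * (\<zeta> * (1 + q)) * H + (q / H) * p\<^sup>2"
        by (simp add: ww power2_eq_square algebra_simps)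
      also have "\<dots> = dot n z z + p / (n * s) + \<zeta> * H / (2 * real n * s) + p\<^sup>2 / (s * s * n)"
        unfolding zq qH by simp
      also have "\<zeta> * H / (2 * real n * s) = q / (4 * real n * (1 + q))"
        using n s_pos by (simp add: \<zeta>_def q_def)
      also have "p / (n * s) = (p / s) / n" by simp
      also have "p\<^sup>2 / (s * s * n) = (p / s) * (p / s) / n" by (simp add: power2_eq_square)
      finally show ?thesis by (simp add: distrib_left add_divide_distrib)
    qed
    also have "(1 / \<mu>)\<^sup>2 * \<dots> \<le> (1 / \<mu>)\<^sup>2 * \<mu>\<^sup>2"
    proof (rule mult_left_mono)
      have "(p / s) * (1 + p / s) \<le> 0"
        using p0 ps s_pos by (intro mult_nonpos_nonneg) (auto simp: field_simps)
      then have "(p / s) * (1 + p / s) / n \<le> 0" by (rule divide_nonpos_nonneg) simp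
      moreover have "q / (4 * real n * (1 + q)) \<le> q / (4 * real n)"
        using q_pos n by (intro divide_left_mono) auto
      moreover have "1 + q / (4 * real n) \<le> \<mu>\<^sup>2"
        by (simp add: \<mu>_def power2_eq_square algebra_simps)
      ultimately show "dot n z z + (p / s) * (1 + p / s) / n + q / (4 * real n * (1 + q)) \<le> \<mu>\<^sup>2"
        using z by linarith
    qed simp
    also have "\<dots> = 1" using l0 by (simp add: power_divide)
    finally show ?thesis .
  qed
  moreover have "x i = c' i + fapp n B' z' i" if "i < n" for i
    using xz[OF that] c'_eq[OF that] fz'[OF that] by (simp add: \<zeta>_def)
  ultimately show ?thesis unfolding ellipsoid_def by blast
qed

end

text \<open>Suppose that every cut exceeds \<open>r\<close> times the norm of its gradient at
  \<open>v\<close>. By Cauchy-Schwarz the whole ball of radius \<open>r\<close> around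
  \<open>v\<close> then lies on the kept side each time, so it is contained in every ellipsoid and
  the determinant stays at least \<open>r ^ n\<close> in absolute value. But it starts at
  \<open>R ^ n\<close> and loses a factor exp (- 1 / (8 n^2)) per step, which limits the number of
  steps to 8 n^3 ln (R / r).\<close>

theorem cutting_planes:
  fixes c g :: "nat \<Rightarrow> nat \<Rightarrow> real" and B :: "nat \<Rightarrow> nat \<Rightarrow> nat \<Rightarrow> real"
  assumes n: "n \<ge> 1" and r: "r > 0" and v: "L2_set v {..<n} \<le> R - r"
    and init: "\<And>i. i < n \<Longrightarrow> c 0 i = 0" "\<And>i j. i < n \<Longrightarrow> j < n \<Longrightarrow> B 0 i j = (if i = j then R else 0)"
    and step: "\<And>k. k < T \<Longrightarrow> cut_step n (g k) (c k) (B k) (c (Suc k)) (B (Suc k))"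
    and T: "8 * real n ^ 3 * ln (R / r) < T"
  shows "\<exists>k<T. dot n (g k) (\<lambda>i. c k i - v i) \<le> r * L2_set (g k) {..<n}"
proof (rule ccontr)
  assume contra: "\<not> ?thesis"
  have R: "R > 0" using v r L2_set_nonneg[of v "{..<n}"] by linarith
  let ?ball = "{x. L2_set (\<lambda>i. x i - v i) {..<n} \<le> r}"
  have inv: "?ball \<subseteq> ellipsoid n (c k) (B k) \<and> \<bar>fdet n (B k)\<bar> \<le> R ^ n * exp (- (k / (8 * (real n)\<^sup>2)))"
    if "k \<le> T" for k
    using that
  proof (induction k)
    case 0
    have "?ball \<subseteq> ellipsoid n (c 0) (B 0)"
    proof
      fix x assume "x \<in> ?ball"
      moreover have "L2_set (\<lambda>i. (x i - v i) + v i) {..<n} \<le> L2_set (\<lambda>i. x i - v i) {..<n} + L2_set v {..<n}"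
        by (rule L2_set_triangle_ineq)
      ultimately have "L2_set x {..<n} \<le> R" using v by simp
      then have "L2_set x {..<n} ^ 2 \<le> R ^ 2" by (intro power_mono) auto
      then have x: "dot n x x \<le> R\<^sup>2" by (simp add: L2_set_dot dot_self_nonneg)
      have "dot n (\<lambda>i. (1 / R) * x i) (\<lambda>i. (1 / R) * x i) \<le> 1"
        unfolding dot_scale_left dot_scale_right using x R by (simp add: power2_eq_square field_simps)
      moreover have "x i = c 0 i + fapp n (B 0) (\<lambda>i. (1 / R) * x i) i" if "i < n" for i
      proof -
        have "fapp n (B 0) (\<lambda>i. (1 / R) * x i) i = (\<Sum>j<n. (if i = j then R else 0) * ((1 / R) * x j))"
          unfolding fapp_def using init(2)[OF that] by (intro sum.cong) auto
        also have "\<dots> = x i"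
          using that R by (subst sum.mono_neutral_right[of _ "{i}"]) auto
        finally show ?thesis using init(1)[OF that] by simp
      qed
      ultimately show "x \<in> ellipsoid n (c 0) (B 0)" unfolding ellipsoid_def by blast
    qed
    moreover have "fdet n (B 0) = R ^ n"
    proof -
      have "fdet n (B 0) = fdet n (\<lambda>i j. R * (if i = j then 1 else 0))"
        using init(2) by (intro fdet_cong) simp
      then show ?thesis by (simp only: fdet_scale fdet_identity mult_1_right)
    qed
    ultimately show ?case using R by simp
  next
    case (Suc k)
    then have k: "k < T" and IH: "?ball \<subseteq> ellipsoid n (c k) (B k)"
      "\<bar>fdet n (B k)\<bar> \<le> R ^ n * exp (- (k / (8 * (real n)\<^sup>2)))" by auto
    have gap: "r * L2_set (g k) {..<n} < dot n (g k) (\<lambda>i. c k i - v i)"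
      using contra k by (force simp: not_le)
    have cutv: "dot n (g k) (\<lambda>i. x i - c k i) < 0" if "x \<in> ?ball" for x
    proof -
      have "dot n (g k) (\<lambda>i. x i - c k i) = dot n (g k) (\<lambda>i. x i - v i) - dot n (g k) (\<lambda>i. c k i - v i)"
        unfolding dot_diff_right[symmetric] by simp
      moreover have "dot n (g k) (\<lambda>i. x i - v i) \<le> L2_set (g k) {..<n} * L2_set (\<lambda>i. x i - v i) {..<n}"
        using dot_le_L2_set abs_le_D1 by blast
      moreover have "\<dots> \<le> L2_set (g k) {..<n} * r" using that by (intro mult_left_mono) auto
      ultimately show ?thesis using gap by (simp add: mult.commute)
    qed
    let ?h = "\<lambda>j. \<Sum>i<n. B k i j * g k i"
    \<comment> \<open>If the transformed gradient vanished, the cut would take the value zero on the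
      whole ellipsoid, in particular at \<open>v\<close>, where it is strictly negative.\<close>
    have nz: "dot n ?h ?h \<noteq> 0"
    proof
      assume h0: "dot n ?h ?h = 0"
      have "v \<in> ?ball" using r by (simp add: L2_set_def)
      then have "v \<in> ellipsoid n (c k) (B k)" using IH(1) by blast
      then obtain z where z: "\<forall>i<n. v i = c k i + fapp n (B k) z i" unfolding ellipsoid_def by blast
      have "dot n (g k) (\<lambda>i. v i - c k i) = dot n (g k) (fapp n (B k) z)"
        using z by (intro dot_cong) auto
      also have "\<dots> = dot n ?h z" by (simp add: dot_transpose)
      also have "\<dots> = 0" using dot_square_le[of n ?h z] h0 by simp
      finally show False using cutv[OF \<open>v \<in> ?ball\<close>] by simp
    qed
    interpret cut n "g k" "c k" "B k" "c (Suc k)" "B (Suc k)"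
      using n step[OF k] nz by unfold_locales
    have "?ball \<subseteq> ellipsoid n (c (Suc k)) (B (Suc k))"
      using half_ellipsoid_subset IH(1) cutv by (meson less_imp_le subset_eq)
    moreover have "\<bar>fdet n (B (Suc k))\<bar> \<le> R ^ n * exp (- (Suc k / (8 * (real n)\<^sup>2)))"
    proof -
      have "\<bar>fdet n (B (Suc k))\<bar> \<le> exp (- (1 / (8 * (real n)\<^sup>2))) * (R ^ n * exp (- (k / (8 * (real n)\<^sup>2))))"
        by (rule order_trans[OF fdet_step mult_left_mono[OF IH(2)]]) simp
      also have "\<dots> = R ^ n * (exp (- (1 / (8 * (real n)\<^sup>2))) * exp (- (k / (8 * (real n)\<^sup>2))))" by simp
      also have "exp (- (1 / (8 * (real n)\<^sup>2))) * exp (- (k / (8 * (real n)\<^sup>2))) = exp (- (Suc k / (8 * (real n)\<^sup>2)))"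
        unfolding exp_add[symmetric] by (simp add: add_divide_distrib)
      finally show ?thesis .
    qed
    ultimately show ?case by blast
  qed
  have sub: "?ball \<subseteq> ellipsoid n (c T) (B T)" and det: "\<bar>fdet n (B T)\<bar> \<le> R ^ n * exp (- (T / (8 * (real n)\<^sup>2)))"
    using inv[of T] by auto
  have "r ^ n \<le> \<bar>fdet n (B T)\<bar>"
  proof (rule fdet_ge_of_ball_subset_image[OF r])
    fix p assume p: "dot n p p \<le> 1"
    have nrm: "L2_set (\<lambda>i. l * r * p i) {..<n} \<le> r" if l: "\<bar>l\<bar> = 1" for l
    proof -
      have "l * l = 1" using l by (metis abs_mult_self_eq mult_1)
      have "dot n (\<lambda>i. l * r * p i) (\<lambda>i. l * r * p i) = (l * l) * r\<^sup>2 * dot n p p"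
        unfolding dot_scale_left dot_scale_right by (simp add: power2_eq_square)
      also have "\<dots> \<le> r\<^sup>2" using p \<open>l * l = 1\<close> by (simp add: mult_left_le)
      finally show ?thesis using r by (simp add: L2_set_dot real_le_lsqrt)
    qed
    \<comment> \<open>Two opposite points of the ball have preimages \<open>y\<close> and
      \<open>z\<close>; half their difference is a preimage of \<open>r * p\<close> under the linear
      part alone, so \<open>v\<close> and the centre cancel.\<close>
    have "(\<lambda>i. v i + 1 * r * p i) \<in> ellipsoid n (c T) (B T)" "(\<lambda>i. v i + (-1) * r * p i) \<in> ellipsoid n (c T) (B T)"
      using nrm[of 1] nrm[of "-1"] by (auto intro!: subsetD[OF sub])
    then obtain y z where y: "dot n y y \<le> 1" "\<forall>i<n. v i + 1 * r * p i = c T i + fapp n (B T) y i"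
      and z: "dot n z z \<le> 1" "\<forall>i<n. v i + (-1) * r * p i = c T i + fapp n (B T) z i"
      by (auto simp: ellipsoid_def)
    let ?w = "\<lambda>i. (1 / 2) * (y i - z i)"
    have "fapp n (B T) ?w i = r * p i" if "i < n" for i
    proof -
      have "fapp n (B T) ?w i = (1 / 2) * (fapp n (B T) y i - fapp n (B T) z i)"
        unfolding fapp_scale by (simp add: fapp_def right_diff_distrib sum_subtractf)
      moreover have "fapp n (B T) y i = v i + r * p i - c T i" "fapp n (B T) z i = v i - r * p i - c T i"
        using y(2) z(2) that by (simp_all add: algebra_simps)
      ultimately show ?thesis by simp
    qed
    moreover have "dot n ?w ?w \<le> 1"
    proof -
      have "0 \<le> dot n (\<lambda>i. y i + z i) (\<lambda>i. y i + z i)" by (rule dot_self_nonneg)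
      then have "- (2 * dot n y z) \<le> dot n y y + dot n z z"
        by (simp add: dot_add_left dot_add_right dot_commute[of n z y])
      then show ?thesis
        using y(1) z(1) unfolding dot_scale_left dot_scale_right dot_diff_left dot_diff_right
        by (simp add: dot_commute[of n z y])
    qed
    ultimately show "\<exists>z. dot n z z \<le> 1 \<and> (\<forall>i<n. fapp n (B T) z i = r * p i)" by blast
  qed
  then have "r ^ n \<le> R ^ n * exp (- (T / (8 * (real n)\<^sup>2)))" using det by linarith
  then have "ln (r ^ n) \<le> ln (R ^ n * exp (- (T / (8 * (real n)\<^sup>2))))"
    using r by (intro ln_mono) auto
  also have "\<dots> = n * ln R - T / (8 * (real n)\<^sup>2)"
    using R by (simp add: ln_mult ln_realpow)
  finally have "T / (8 * (real n)\<^sup>2) \<le> n * ln (R / r)"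
    using r R by (simp add: ln_realpow ln_div algebra_simps)
  then have "T \<le> 8 * real n ^ 3 * ln (R / r)"
    using n by (simp add: field_simps power3_eq_cube power2_eq_square)
  then show False using T by simp
qed

section \<open>Reasoning about programs\<close>

primrec nmods :: "com \<Rightarrow> string set" where
  "nmods Skip = {}"
| "nmods (NAssign x i) = {x}"
| "nmods (RAssign a i e) = {}"
| "nmods (Draw a b) = {}"
| "nmods (Seq c d) = nmods c \<union> nmods d"
| "nmods (Cond b c d) = nmods c \<union> nmods d"
| "nmods (While b c) = nmods c"

primrec rmods :: "com \<Rightarrow> string set" where
  "rmods Skip = {}"
| "rmods (NAssign x i) = {}"
| "rmods (RAssign a i e) = {a}"
| "rmods (Draw a b) = {a, b}"
| "rmods (Seq c d) = rmods c \<union> rmods d"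
| "rmods (Cond b c d) = rmods c \<union> rmods d"
| "rmods (While b c) = rmods c"

primrec draw_free :: "com \<Rightarrow> bool" where
  "draw_free Skip = True"
| "draw_free (NAssign x i) = True"
| "draw_free (RAssign a i e) = True"
| "draw_free (Draw a b) = False"
| "draw_free (Seq c d) = (draw_free c \<and> draw_free d)"
| "draw_free (Cond b c d) = (draw_free c \<and> draw_free d)"
| "draw_free (While b c) = draw_free c"

definition frame :: "com \<Rightarrow> state \<Rightarrow> state \<Rightarrow> bool" where
  "frame c s s' \<longleftrightarrow> (\<forall>x. x \<notin> nmods c \<longrightarrow> nats s' x = nats s x) \<and>
    (\<forall>a. a \<notin> rmods c \<longrightarrow> reals s' a = reals s a) \<and> (draw_free c \<longrightarrow> draws s' = draws s)"

lemma exec_frame: "exec \<sigma> n \<omega> c s t s' \<Longrightarrow> frame c s s'"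
  by (induction rule: exec.induct) (simp_all add: frame_def)

lemma frame_nats: "frame c s s' \<Longrightarrow> x \<notin> nmods c \<Longrightarrow> nats s' x = nats s x"
  and frame_reals: "frame c s s' \<Longrightarrow> a \<notin> rmods c \<Longrightarrow> reals s' a = reals s a"
  and frame_draws: "frame c s s' \<Longrightarrow> draw_free c \<Longrightarrow> draws s' = draws s"
  by (simp_all add: frame_def)

primrec loop_free :: "com \<Rightarrow> bool" where
  "loop_free Skip = True"
| "loop_free (NAssign x i) = True"
| "loop_free (RAssign a i e) = True"
| "loop_free (Draw a b) = False"
| "loop_free (Seq c d) = (loop_free c \<and> loop_free d)"
| "loop_free (Cond b c d) = (loop_free c \<and> loop_free d)"
| "loop_free (While b c) = False"

text \<open>The clauses for \<open>Draw\<close> and \<open>While\<close> are dummies: only loop-free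
  programs are evaluated this way.\<close>

primrec eval_com :: "(real \<Rightarrow> real) \<Rightarrow> com \<Rightarrow> state \<Rightarrow> state" where
  "eval_com \<sigma> Skip s = s"
| "eval_com \<sigma> (NAssign x i) s = s\<lparr>nats := (nats s)(x := nval i s)\<rparr>"
| "eval_com \<sigma> (RAssign a i e) s = s\<lparr>reals := (reals s)(a := (reals s a)(nval i s := rval \<sigma> e s))\<rparr>"
| "eval_com \<sigma> (Draw a b) s = s"
| "eval_com \<sigma> (Seq c d) s = eval_com \<sigma> d (eval_com \<sigma> c s)"
| "eval_com \<sigma> (Cond b c d) s = (if bval \<sigma> b s then eval_com \<sigma> c s else eval_com \<sigma> d s)"
| "eval_com \<sigma> (While b c) s = s"

text \<open>A conditional is charged for both branches, which makes the bound independent of the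
  state.\<close>

primrec cost_com :: "com \<Rightarrow> nat" where
  "cost_com Skip = 1"
| "cost_com (NAssign x i) = 1 + ncost i"
| "cost_com (RAssign a i e) = 1 + ncost i + rcost e"
| "cost_com (Draw a b) = 0"
| "cost_com (Seq c d) = cost_com c + cost_com d"
| "cost_com (Cond b c d) = bcost b + cost_com c + cost_com d"
| "cost_com (While b c) = 0"

definition For :: "string \<Rightarrow> string \<Rightarrow> com \<Rightarrow> com" where
  "For x y c = Seq (NAssign x (NConst 0))
    (While (NLess (NVar x) (NVar y)) (Seq c (NAssign x (NPlus (NVar x) (NConst 1)))))"

lemma For_mods [simp]:
  "nmods (For x y c) = insert x (nmods c)" "rmods (For x y c) = rmods c" "draw_free (For x y c) = draw_free c"
  by (auto simp: For_def)

locale machine =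
  fixes \<sigma> :: "real \<Rightarrow> real" and n :: nat and \<omega> :: "nat \<Rightarrow> (nat \<Rightarrow> real) \<times> real"
begin

text \<open>A total correctness triple with a time bound. The existence of one halting run suffices
  because execution is deterministic.\<close>

definition reach :: "com \<Rightarrow> state \<Rightarrow> nat \<Rightarrow> (state \<Rightarrow> bool) \<Rightarrow> bool" where
  "reach c s T Q \<longleftrightarrow> (\<exists>t s'. exec \<sigma> n \<omega> c s t s' \<and> t \<le> T \<and> Q s')"

abbreviation "runs c s T s' \<equiv> reach c s T (\<lambda>s''. s'' = s')"

lemma reachE:
  assumes "reach c s T P"
  obtains t s' where "exec \<sigma> n \<omega> c s t s'" "t \<le> T" "P s'" "frame c s s'"
  using assms exec_frame unfolding reach_def by blast

lemma reachI: "exec \<sigma> n \<omega> c s t s' \<Longrightarrow> t \<le> T \<Longrightarrow> P s' \<Longrightarrow> reach c s T P"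
  unfolding reach_def by blast

lemma reach_mono:
  "reach c s T Q \<Longrightarrow> T \<le> T' \<Longrightarrow> (\<And>s'. frame c s s' \<Longrightarrow> Q s' \<Longrightarrow> Q' s') \<Longrightarrow> reach c s T' Q'"
  unfolding reach_def using exec_frame order_trans by blast

text \<open>The frame of \<open>c\<close> is at hand when \<open>d\<close> is verified, so
  postconditions need not list what \<open>c\<close> leaves unchanged.\<close>

lemma reach_Seq:
  assumes "reach c s T P" and d: "\<And>s'. frame c s s' \<Longrightarrow> P s' \<Longrightarrow> reach d s' U Q"
  shows "reach (Seq c d) s (T + U) Q"
proof -
  obtain t s' where c: "exec \<sigma> n \<omega> c s t s'" "t \<le> T" "P s'" using assms(1) unfolding reach_def by blast
  then obtain u s'' where "exec \<sigma> n \<omega> d s' u s''" "u \<le> U" "Q s''"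
    using d exec_frame unfolding reach_def by blast
  then show ?thesis using exec.Seq[OF c(1)] c(2) unfolding reach_def by (meson add_mono)
qed

lemma runs_Seq: "runs c s T s1 \<Longrightarrow> reach d s1 U Q \<Longrightarrow> reach (Seq c d) s (T + U) Q"
  by (rule reach_Seq[where P = "\<lambda>s''. s'' = s1"]) auto

lemma runs_loop_free: "loop_free c \<Longrightarrow> runs c s (cost_com c) (eval_com \<sigma> c s)"
proof (induction c arbitrary: s)
  case (Seq c d)
  then show ?case by (auto intro!: runs_Seq)
next
  case (Cond b c d)
  show ?case
  proof (cases "bval \<sigma> b s")
    case True
    then obtain t where "exec \<sigma> n \<omega> c s t (eval_com \<sigma> c s)" "t \<le> cost_com c"
      using Cond unfolding reach_def by auto
    then show ?thesis using exec.CondTrue[where d = d, OF True] True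
      unfolding reach_def by (intro exI[of _ "bcost b + t"] exI[of _ "eval_com \<sigma> c s"]) auto
  next
    case False
    then obtain t where "exec \<sigma> n \<omega> d s t (eval_com \<sigma> d s)" "t \<le> cost_com d"
      using Cond unfolding reach_def by auto
    then show ?thesis using exec.CondFalse[where c = c, OF False] False
      unfolding reach_def by (intro exI[of _ "bcost b + t"] exI[of _ "eval_com \<sigma> d s"]) auto
  qed
qed (auto simp: reach_def intro: exec.intros)

lemma reach_loop_free: "loop_free c \<Longrightarrow> Q (eval_com \<sigma> c s) \<Longrightarrow> reach c s (cost_com c) Q"
  using runs_loop_free by (rule reach_mono) auto

lemma reach_Cond:
  assumes "bval \<sigma> b s \<Longrightarrow> reach c s T Q" "\<not> bval \<sigma> b s \<Longrightarrow> reach d s T Q"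
  shows "reach (Cond b c d) s (bcost b + T) Q"
  using assms unfolding reach_def
  by (cases "bval \<sigma> b s") (meson exec.CondTrue exec.CondFalse add_left_mono)+

text \<open>The invariant is indexed by the number of completed rounds, and \<open>N\<close> is
  their exact number. Termination thus comes with the invariant, and the time bound is a
  product.\<close>

lemma reach_While:
  assumes "I 0 s"
    and step: "\<And>k s'. k < N \<Longrightarrow> I k s' \<Longrightarrow> frame c s s' \<Longrightarrow> bval \<sigma> b s' \<and> reach c s' T (I (Suc k))"
    and stop: "\<And>s'. I N s' \<Longrightarrow> frame c s s' \<Longrightarrow> \<not> bval \<sigma> b s'"
  shows "reach (While b c) s (N * (bcost b + T) + bcost b) (I N)"
proof -
  have "reach (While b c) s' ((N - k) * (bcost b + T) + bcost b) (I N)"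
    if "k \<le> N" "I k s'" "frame c s s'" for k s'
    using that
  proof (induction "N - k" arbitrary: k s')
    case 0
    then show ?case using exec.WhileFalse[OF stop[of s'], of n \<omega> c] unfolding reach_def by auto
  next
    case (Suc d)
    then have k: "k < N" by linarith
    obtain t s1 where b: "bval \<sigma> b s'" and c: "exec \<sigma> n \<omega> c s' t s1" "t \<le> T" "I (Suc k) s1"
      using step[OF k Suc.prems(2,3)] unfolding reach_def by blast
    have f: "frame c s s1"
      using Suc.prems(3) exec_frame[OF c(1)] unfolding frame_def by simp
    have "reach (While b c) s1 ((N - Suc k) * (bcost b + T) + bcost b) (I N)"
      by (rule Suc.hyps(1)) (use Suc.hyps(2) k c(3) f in auto)
    then obtain u s2 where w: "exec \<sigma> n \<omega> (While b c) s1 u s2" "u \<le> (N - Suc k) * (bcost b + T) + bcost b" "I N s2"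
      unfolding reach_def by blast
    have "N - k = Suc (N - Suc k)" using k by simp
    then have "bcost b + t + u \<le> (N - k) * (bcost b + T) + bcost b" using c(2) w(2) by simp
    then show ?case using exec.WhileTrue[OF b c(1) w(1)] w(3) unfolding reach_def by blast
  qed
  from this[of 0 s] assms(1) show ?thesis by (simp add: frame_def)
qed

text \<open>Each round pays 3 steps for the test and 4 for the increment besides the body; the 5
  steps at the end are the initialisation and the last test. The body has to establish the invariant
  for the state in which the counter has already been advanced.\<close>

lemma reach_For:
  assumes xy: "x \<notin> nmods c" "y \<notin> nmods c" "x \<noteq> y" and N: "nats s y = N"
    and init: "I 0 (s\<lparr>nats := (nats s)(x := 0)\<rparr>)"
    and step: "\<And>k s'. k < N \<Longrightarrow> nats s' x = k \<Longrightarrow> I k s' \<Longrightarrow> frame (For x y c) s s' \<Longrightarrow>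
      reach c s' T (\<lambda>s''. I (Suc k) (s''\<lparr>nats := (nats s'')(x := Suc k)\<rparr>))"
  shows "reach (For x y c) s (N * (T + 7) + 5) (I N)"
proof -
  let ?b = "NLess (NVar x) (NVar y)" and ?c = "Seq c (NAssign x (NPlus (NVar x) (NConst 1)))"
  let ?s = "s\<lparr>nats := (nats s)(x := 0)\<rparr>"
  let ?I = "\<lambda>k s'. I k s' \<and> nats s' x = k"
  have "reach (While ?b ?c) ?s (N * (bcost ?b + (T + 4)) + bcost ?b) (?I N)"
  proof (rule reach_While)
    show "?I 0 ?s" using init by simp
  next
    fix k s' assume k: "k < N" and I: "?I k s'" and f: "frame ?c ?s s'"
    have f': "frame (For x y c) s s'" using f unfolding frame_def For_def by simp
    have b: "bval \<sigma> ?b s'" using f' k I xy N unfolding frame_def by simp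
    have "reach c s' T (\<lambda>s''. I (Suc k) (s''\<lparr>nats := (nats s'')(x := Suc k)\<rparr>))"
      using step[OF k _ _ f'] I by blast
    then have "reach ?c s' (T + cost_com (NAssign x (NPlus (NVar x) (NConst 1)))) (?I (Suc k))"
    proof (rule reach_Seq)
      fix s'' assume f'': "frame c s' s''" and I': "I (Suc k) (s''\<lparr>nats := (nats s'')(x := Suc k)\<rparr>)"
      have "nats s'' x = k" using frame_nats[OF f'' xy(1)] I by simp
      then show "reach (NAssign x (NPlus (NVar x) (NConst 1))) s'' (cost_com (NAssign x (NPlus (NVar x) (NConst 1)))) (?I (Suc k))"
        using I' by (intro reach_loop_free) simp_all
    qed
    then have "reach ?c s' (T + 4) (?I (Suc k))" by (rule reach_mono) auto
    with b show "bval \<sigma> ?b s' \<and> reach ?c s' (T + 4) (?I (Suc k))" by (rule conjI)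
  next
    fix s' assume I: "?I N s'" and f: "frame ?c ?s s'"
    then show "\<not> bval \<sigma> ?b s'" using xy N unfolding frame_def by simp
  qed
  then have "reach (For x y c) s (cost_com (NAssign x (NConst 0)) + (N * (bcost ?b + (T + 4)) + bcost ?b)) (?I N)"
    unfolding For_def by (intro runs_Seq[OF runs_loop_free]) auto
  then show ?thesis by (rule reach_mono) (auto simp: algebra_simps)
qed

lemma reach_time: "reach c s T Q \<Longrightarrow> T \<le> T' \<Longrightarrow> reach c s T' Q"
  by (rule reach_mono)

text \<open>The expression is evaluated under an arbitrary content \<open>A\<close> of the array
  that agrees with the original one at the entry about to be written. So it may read that entry of
  \<open>a\<close>, as accumulation and update in place require, while its value must not depend on
  the other entries.\<close>

lemma runs_map_loop:
  assumes xy: "x \<noteq> y" and N: "nats s y = N"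
    and ix: "\<And>A k. k < N \<Longrightarrow> nval ix (s\<lparr>nats := (nats s)(x := k), reals := (reals s)(a := A)\<rparr>) = b + k"
    and e: "\<And>A k. k < N \<Longrightarrow> A (b + k) = reals s a (b + k) \<Longrightarrow>
      rval \<sigma> e (s\<lparr>nats := (nats s)(x := k), reals := (reals s)(a := A)\<rparr>) = f k"
  shows "runs (For x y (RAssign a ix e)) s (N * (ncost ix + rcost e + 8) + 5)
    (s\<lparr>nats := (nats s)(x := N),
       reals := (reals s)(a := (\<lambda>i. if b \<le> i \<and> i < b + N then f (i - b) else reals s a i))\<rparr>)"
proof -
  let ?A = "\<lambda>k i. if b \<le> i \<and> i < b + k then f (i - b) else reals s a i"
  let ?I = "\<lambda>k s'. s' = s\<lparr>nats := (nats s)(x := k), reals := (reals s)(a := ?A k)\<rparr>"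
  have "reach (For x y (RAssign a ix e)) s (N * (cost_com (RAssign a ix e) + 7) + 5) (?I N)"
  proof (rule reach_For)
    show "?I 0 (s\<lparr>nats := (nats s)(x := 0)\<rparr>)" by (rule state.equality) (auto simp: fun_eq_iff)
  next
    fix k s' assume k: "k < N" and I: "?I k s'"
    have v: "nval ix s' = b + k" "rval \<sigma> e s' = f k" unfolding I using ix[OF k] e[OF k] by auto
    have "(?A k)(b + k := f k) = ?A (Suc k)" by (auto simp: fun_eq_iff)
    then show "reach (RAssign a ix e) s' (cost_com (RAssign a ix e))
        (\<lambda>s''. ?I (Suc k) (s''\<lparr>nats := (nats s'')(x := Suc k)\<rparr>))"
      by (intro reach_loop_free) (simp_all add: v, intro state.equality, simp_all add: I)
  qed (use xy N in auto)
  then show ?thesis by (simp add: algebra_simps)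
qed

lemma runs_sum_loop:
  assumes xy: "x \<noteq> y" and N: "nats s y = N"
    and e: "\<And>A k. k < N \<Longrightarrow> rval \<sigma> e (s\<lparr>nats := (nats s)(x := k), reals := (reals s)(a := A)\<rparr>) = f k"
  shows "runs (For x y (RAssign a (NConst 0) (RPlus (Arr a (NConst 0)) e))) s (N * (rcost e + 12) + 5)
    (s\<lparr>nats := (nats s)(x := N), reals := (reals s)(a := (reals s a)(0 := reals s a 0 + (\<Sum>k<N. f k)))\<rparr>)"
proof -
  let ?A = "\<lambda>k. (reals s a)(0 := reals s a 0 + (\<Sum>k<k. f k))"
  let ?I = "\<lambda>k s'. s' = s\<lparr>nats := (nats s)(x := k), reals := (reals s)(a := ?A k)\<rparr>"
  let ?c = "RAssign a (NConst 0) (RPlus (Arr a (NConst 0)) e)"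
  have "reach (For x y ?c) s (N * (cost_com ?c + 7) + 5) (?I N)"
  proof (rule reach_For)
    show "?I 0 (s\<lparr>nats := (nats s)(x := 0)\<rparr>)" by (rule state.equality) (auto simp: fun_eq_iff)
  next
    fix k s' assume k: "k < N" and I: "?I k s'"
    have v: "rval \<sigma> e s' = f k" unfolding I using e[OF k] by auto
    show "reach ?c s' (cost_com ?c) (\<lambda>s''. ?I (Suc k) (s''\<lparr>nats := (nats s'')(x := Suc k)\<rparr>))"
      by (intro reach_loop_free) (simp_all add: v, intro state.equality, simp_all add: I add.assoc)
  qed (use xy N in auto)
  then show ?thesis by (simp add: algebra_simps)
qed

end

section \<open>The learning program\<close>

abbreviation scal :: "string \<Rightarrow> rexp" where "scal a \<equiv> Arr a (NConst 0)"
abbreviation put :: "string \<Rightarrow> rexp \<Rightarrow> com" where "put a e \<equiv> RAssign a (NConst 0) e"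
abbreviation incr :: "string \<Rightarrow> com" where "incr x \<equiv> NAssign x (NPlus (NVar x) (NConst 1))"
text \<open>The samples \<open>X\<close> and the matrix \<open>B\<close> of the ellipsoid are stored row by row. Indices cannot be
  multiplied, so \<open>b\<close> keeps the position of the current row.\<close>
abbreviation bj :: nexp where "bj \<equiv> NPlus (NVar ''b'') (NVar ''j'')"
abbreviation next_row :: com where "next_row \<equiv> NAssign ''b'' (NPlus (NVar ''b'') (NVar ''Delta''))"

text \<open>A substitute for the logarithm: the number of doublings that bring 1 up to the bound
  stored in \<open>u\<close>.\<close>

definition doubling :: "string \<Rightarrow> com" where
  "doubling x = Seq (put ''p'' (RConst 1)) (Seq (NAssign x (NConst 0))
    (While (RLess (scal ''p'') (scal ''u'')) (Seq (put ''p'' (RPlus (scal ''p'') (scal ''p''))) (incr x))))"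

definition sample_body :: com where
  "sample_body = Seq (Draw ''x'' ''y'') (Seq (For ''j'' ''Delta'' (RAssign ''X'' bj (Arr ''x'' (NVar ''j''))))
    (Seq (RAssign ''Y'' (NVar ''m'') (scal ''y'')) (Seq next_row (incr ''m''))))"

text \<open>Comparing the counter with a real bound replaces rounding: the loop ends as soon as the
  counter reaches the ceiling of \<open>u\<close>.\<close>

definition sample :: com where
  "sample = Seq (NAssign ''m'' (NConst 0)) (Seq (NAssign ''b'' (NConst 0))
    (While (RLess (OfNat (NVar ''m'')) (scal ''u'')) sample_body))"

text \<open>Only the diagonal is written, since the memory is zero at the start. The radius
  \<open>wmax + 1\<close> leaves room for a ball of radius at most 1 around
  \<open>v\<close>.\<close>

definition init_ellipsoid :: com where
  "init_ellipsoid = Seq (NAssign ''b'' (NConst 0)) (For ''i'' ''Delta''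
    (Seq (RAssign ''B'' (NPlus (NVar ''b'') (NVar ''i'')) (RPlus (scal ''wmax'') (RConst 1))) next_row))"

text \<open>\<open>r\<close> holds the score and then the residual, \<open>q\<close> collects the
  squared residuals and \<open>g\<close> the gradient, so one pass over the sample serves both the
  cut and the comparison of losses. The index \<open>0 + j\<close> fits the form
  \<open>b + k\<close> of \<open>runs_map_loop\<close>.\<close>

definition grad_body :: com where
  "grad_body = Seq (put ''r'' (RConst 0))
    (Seq (For ''j'' ''Delta'' (put ''r'' (RPlus (scal ''r'') (RTimes (Arr ''c'' (NVar ''j'')) (Arr ''X'' bj)))))
    (Seq (put ''r'' (RMinus (Act (scal ''r'')) (Arr ''Y'' (NVar ''i''))))
    (Seq (put ''q'' (RPlus (scal ''q'') (RTimes (scal ''r'') (scal ''r''))))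
    (Seq (For ''j'' ''Delta'' (RAssign ''g'' (NPlus (NConst 0) (NVar ''j'')) (RPlus (Arr ''g'' (NVar ''j'')) (RTimes (scal ''r'') (Arr ''X'' bj)))))
    next_row))))"

definition grad :: com where
  "grad = Seq (For ''j'' ''Delta'' (RAssign ''g'' (NPlus (NConst 0) (NVar ''j'')) (RConst 0)))
    (Seq (put ''q'' (RConst 0)) (Seq (NAssign ''b'' (NConst 0)) (For ''i'' ''m'' grad_body)))"

text \<open>The test \<open>k < 1\<close> makes the first iterate the initial best one.\<close>
definition record_best :: com where
  "record_best = Cond (BNot (BAnd (BNot (RLess (scal ''q'') (scal ''best''))) (BNot (NLess (NVar ''k'') (NConst 1)))))
    (Seq (put ''best'' (scal ''q'')) (For ''j'' ''Delta'' (RAssign ''out'' (NPlus (NConst 0) (NVar ''j'')) (Arr ''c'' (NVar ''j'')))))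
    Skip"

definition transform_body :: com where
  "transform_body = Seq (For ''j'' ''Delta'' (RAssign ''h'' (NPlus (NConst 0) (NVar ''j'')) (RPlus (Arr ''h'' (NVar ''j'')) (RTimes (Arr ''B'' bj) (Arr ''g'' (NVar ''i''))))))
    next_row"

definition transform :: com where
  "transform = Seq (For ''j'' ''Delta'' (RAssign ''h'' (NPlus (NConst 0) (NVar ''j'')) (RConst 0)))
    (Seq (NAssign ''b'' (NConst 0)) (For ''i'' ''Delta'' transform_body))"

definition norms_body :: com where
  "norms_body = Seq (Cond (RLess (Arr ''h'' (NVar ''j'')) (RConst 0))
      (put ''s'' (RMinus (scal ''s'') (Arr ''h'' (NVar ''j'')))) (put ''s'' (RPlus (scal ''s'') (Arr ''h'' (NVar ''j'')))))
    (put ''H'' (RPlus (scal ''H'') (RTimes (Arr ''h'' (NVar ''j'')) (Arr ''h'' (NVar ''j'')))))"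

definition norms :: com where
  "norms = Seq (put ''s'' (RConst 0)) (Seq (put ''H'' (RConst 0)) (For ''j'' ''Delta'' norms_body))"

text \<open>Row \<open>i\<close> of \<open>B\<close> is read for \<open>r\<close> before it is
  overwritten and no other row is read, so the matrix can be updated in place. The quantities
  \<open>h\<close>, \<open>s\<close>, \<open>H\<close> and \<open>t\<close> stay those of the old
  matrix.\<close>

definition update_body :: com where
  "update_body = Seq (put ''r'' (RConst 0))
    (Seq (For ''j'' ''Delta'' (put ''r'' (RPlus (scal ''r'') (RTimes (Arr ''B'' bj) (Arr ''h'' (NVar ''j''))))))
    (Seq (RAssign ''c'' (NVar ''i'') (RMinus (Arr ''c'' (NVar ''i'')) (RDivide (scal ''r'')
      (RTimes (RTimes (RTimes (RConst 2) (OfNat (NVar ''Delta''))) (scal ''s'')) (RPlus (RConst 1) (scal ''t''))))))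
    (Seq (For ''j'' ''Delta'' (RAssign ''B'' bj (RTimes (RPlus (RConst 1) (RDivide (scal ''t'') (RTimes (RConst 8) (OfNat (NVar ''Delta'')))))
      (RMinus (Arr ''B'' bj) (RDivide (RTimes (RTimes (RDivide (scal ''t'') (RConst 4)) (scal ''r'')) (Arr ''h'' (NVar ''j''))) (scal ''H''))))))
    next_row)))"

definition update :: com where
  "update = Seq (put ''t'' (RDivide (RDivide (scal ''H'') (RTimes (scal ''s'') (scal ''s''))) (OfNat (NVar ''Delta''))))
    (Seq (NAssign ''b'' (NConst 0)) (For ''i'' ''Delta'' update_body))"

definition iteration :: com where
  "iteration = Seq grad (Seq record_best (Seq transform (Seq norms (Seq update (incr ''k'')))))"

definition search :: com where
  "search = Seq (NAssign ''k'' (NConst 0)) (While (RLess (OfNat (NVar ''k'')) (scal ''u'')) iteration)"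

definition Delta_r :: rexp where "Delta_r = OfNat (NVar ''Delta'')"

text \<open>The factor \<open>65536 = 128 * 512\<close> is chosen against the deviation bound \<open>exp (- m \<epsilon>\<^sup>2 / 512)\<close> and the at most
  \<open>(\<Delta> \<alpha> / \<epsilon>) ^ (26 \<Delta>)\<close> patterns of \<open>2 m\<close> points.\<close>
definition learn :: com where
  "learn =
    Seq (put ''u'' (RDivide (RTimes Delta_r (scal ''alpha'')) (scal ''eps'')))
    (Seq (doubling ''L'')
    (Seq (put ''u'' (RDivide (RTimes (RTimes (RConst 65536) Delta_r) (OfNat (NVar ''L''))) (RTimes (scal ''eps'') (scal ''eps''))))
    (Seq sample
    (Seq (put ''u'' (RDivide (RTimes (RTimes (RConst 2) Delta_r) (RPlus (scal ''wmax'') (RConst 1))) (scal ''eps'')))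
    (Seq (doubling ''L'')
    (Seq init_ellipsoid
    (Seq (put ''u'' (RPlus (RTimes (RTimes (RTimes (RTimes (RConst 8) Delta_r) Delta_r) Delta_r) (OfNat (NVar ''L''))) (RConst 1)))
    search)))))))"

text \<open>If 6 \<alpha> \<epsilon> \<ge> 1, then 24 \<alpha> \<epsilon> \<ge> 4 bounds every
  squared difference of values in [-1, 1], and the zero vector will do. Otherwise \<Delta> \<alpha>
  / \<epsilon> is at least 6, which keeps its logarithm at least 1.\<close>

definition algorithm :: com where
  "algorithm = Cond (RLess (RTimes (RTimes (RConst 6) (scal ''alpha'')) (scal ''eps'')) (RConst 1)) learn Skip"

lemma mods [simp]:
  "nmods (doubling x) = {x}" "rmods (doubling x) = {''p''}" "draw_free (doubling x)"
  "nmods sample = {''m'', ''b'', ''j''}" "rmods sample = {''x'', ''y'', ''X'', ''Y''}"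
  "nmods sample_body = {''m'', ''b'', ''j''}" "rmods sample_body = {''x'', ''y'', ''X'', ''Y''}"
  "nmods init_ellipsoid = {''b'', ''i''}" "rmods init_ellipsoid = {''B''}" "draw_free init_ellipsoid"
  "nmods grad_body = {''j'', ''b''}" "rmods grad_body = {''r'', ''q'', ''g''}" "draw_free grad_body"
  "nmods grad = {''i'', ''j'', ''b''}" "rmods grad = {''r'', ''q'', ''g''}" "draw_free grad"
  "nmods record_best = {''j''}" "rmods record_best = {''best'', ''out''}" "draw_free record_best"
  "nmods transform_body = {''j'', ''b''}" "rmods transform_body = {''h''}" "draw_free transform_body"
  "nmods transform = {''i'', ''j'', ''b''}" "rmods transform = {''h''}" "draw_free transform"
  "nmods norms_body = {}" "rmods norms_body = {''s'', ''H''}" "draw_free norms_body"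
  "nmods norms = {''j''}" "rmods norms = {''s'', ''H''}" "draw_free norms"
  "nmods update_body = {''j'', ''b''}" "rmods update_body = {''r'', ''c'', ''B''}" "draw_free update_body"
  "nmods update = {''i'', ''j'', ''b''}" "rmods update = {''t'', ''r'', ''c'', ''B''}" "draw_free update"
  "nmods iteration = {''i'', ''j'', ''b'', ''k''}"
  "rmods iteration = {''r'', ''q'', ''g'', ''best'', ''out'', ''h'', ''s'', ''H'', ''t'', ''c'', ''B''}" "draw_free iteration"
  by (auto simp: doubling_def sample_def sample_body_def init_ellipsoid_def grad_body_def grad_def record_best_def
      transform_body_def transform_def norms_body_def norms_def update_body_def update_def iteration_def)

lemma row_index_eq_iff:
  fixes i j k l :: nat
  assumes "j < n" "l < n"
  shows "i * n + j = k * n + l \<longleftrightarrow> i = k \<and> j = l"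
proof
  assume e: "i * n + j = k * n + l"
  have "(i * n + j) div n = i" "(k * n + l) div n = k" "(i * n + j) mod n = j" "(k * n + l) mod n = l"
    using assms by simp_all
  with e show "i = k \<and> j = l" by metis
qed simp

lemma row_index_in_row_iff:
  fixes i j k :: nat
  assumes "j < n"
  shows "k * n \<le> i * n + j \<and> i * n + j < k * n + n \<longleftrightarrow> i = k"
proof
  assume *: "k * n \<le> i * n + j \<and> i * n + j < k * n + n"
  have "(i * n + j) div n = i" using assms by simp
  moreover have "(i * n + j) div n = k" using * by (intro div_nat_eqI) (auto simp: mult.commute)
  ultimately show "i = k" by simp
qed (use assms in simp)

section \<open>Correctness and running time of the subprograms\<close>

context machine
begin

text \<open>The value is 0 for every u \<le> 1, negative numbers included.\<close>

definition doublings :: "real \<Rightarrow> nat" where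
  "doublings u = (LEAST k. u \<le> 2 ^ k)"

lemma doublings_le: "u \<le> 2 ^ doublings u"
  unfolding doublings_def by (rule LeastI_ex) (metis less_imp_le one_less_numeral_iff real_arch_pow semiring_norm(76))

lemma less_doublings: "k < doublings u \<Longrightarrow> 2 ^ k < u"
  unfolding doublings_def using not_less_Least by fastforce

lemma reach_doubling:
  "reach (doubling x) s (doublings (reals s ''u'' 0) * 17 + 20) (\<lambda>s'. nats s' x = doublings (reals s ''u'' 0))"
proof -
  let ?N = "doublings (reals s ''u'' 0)"
  let ?I = "\<lambda>(k::nat) (s'::state). nats s' x = k \<and> reals s' ''p'' 0 = 2 ^ k \<and> reals s' ''u'' 0 = reals s ''u'' 0"
  let ?b = "RLess (scal ''p'') (scal ''u'')" and ?c = "Seq (put ''p'' (RPlus (scal ''p'') (scal ''p''))) (incr x)"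
  have "reach (While ?b ?c) s' (?N * (bcost ?b + cost_com ?c) + bcost ?b) (?I ?N)" if "?I 0 s'" for s'
  proof (rule reach_While[where I = "?I"])
    fix k and s'' :: state assume "k < ?N" "?I k s''"
    then show "bval \<sigma> ?b s'' \<and> reach ?c s'' (cost_com ?c) (?I (Suc k))"
      using less_doublings[of k "reals s ''u'' 0"] by (intro conjI reach_loop_free) simp_all
  next
    fix s'' :: state assume "?I ?N s''"
    then show "\<not> bval \<sigma> ?b s''" using doublings_le[of "reals s ''u'' 0"] by simp
  qed (use that in simp)
  from this[of "eval_com \<sigma> (NAssign x (NConst 0)) (eval_com \<sigma> (put ''p'' (RConst 1)) s)"]
  have "reach (doubling x) s (cost_com (put ''p'' (RConst 1)) + (cost_com (NAssign x (NConst 0)) + (?N * (bcost ?b + cost_com ?c) + bcost ?b))) (?I ?N)"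
    unfolding doubling_def by (intro runs_Seq[OF runs_loop_free]) simp_all
  then show ?thesis by (rule reach_mono) simp_all
qed

definition stored :: "nat \<Rightarrow> state \<Rightarrow> bool" where
  "stored m s \<longleftrightarrow> (\<forall>i<m. (\<forall>j<n. reals s ''X'' (i * n + j) = fst (\<omega> i) j) \<and> reals s ''Y'' i = snd (\<omega> i))"

lemma reach_sample:
  assumes n: "nats s ''Delta'' = n" and d: "draws s = 0"
  shows "reach sample s (nat \<lceil>reals s ''u'' 0\<rceil> * (n * 20 + 40) + 20)
    (\<lambda>s'. nats s' ''m'' = nat \<lceil>reals s ''u'' 0\<rceil> \<and> draws s' = nat \<lceil>reals s ''u'' 0\<rceil> \<and> stored (nat \<lceil>reals s ''u'' 0\<rceil>) s')"
proof -
  let ?u = "reals s ''u'' 0"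
  let ?N = "nat \<lceil>?u\<rceil>"
  let ?I = "\<lambda>(k::nat) (s'::state). nats s' ''m'' = k \<and> draws s' = k \<and> nats s' ''b'' = k * n \<and> nats s' ''Delta'' = n
    \<and> reals s' ''u'' 0 = ?u \<and> stored k s'"
  let ?b = "RLess (OfNat (NVar ''m'')) (scal ''u'')"
  have body: "reach sample_body s' (n * 13 + 21 + n) (?I (Suc k))" if I: "?I k s'" for k s'
  proof -
    define s1 where "s1 = s'\<lparr>reals := (reals s')(''x'' := (\<lambda>i. if i < n then fst (\<omega> (draws s')) i else reals s' ''x'' i),
        ''y'' := (reals s' ''y'')(0 := snd (\<omega> (draws s')))), draws := Suc (draws s')\<rparr>"
    have r1: "runs (Draw ''x'' ''y'') s' (2 + n) s1"
      unfolding reach_def s1_def using exec.Draw by blast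
    let ?X = "\<lambda>i. if k * n \<le> i \<and> i < k * n + n then fst (\<omega> k) (i - k * n) else reals s1 ''X'' i"
    define s2 where "s2 = s1\<lparr>nats := (nats s1)(''j'' := n), reals := (reals s1)(''X'' := ?X)\<rparr>"
    have r2: "runs (For ''j'' ''Delta'' (RAssign ''X'' bj (Arr ''x'' (NVar ''j'')))) s1
        (n * (ncost bj + rcost (Arr ''x'' (NVar ''j'')) + 8) + 5) s2"
      unfolding s2_def by (rule runs_map_loop) (use I in \<open>simp_all add: s1_def\<close>)
    let ?c = "Seq (RAssign ''Y'' (NVar ''m'') (scal ''y'')) (Seq next_row (incr ''m''))"
    have X: "?X (i * n + j) = (if i = k then fst (\<omega> k) j else reals s1 ''X'' (i * n + j))" if "j < n" for i j
      unfolding row_index_in_row_iff[OF that] by simp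
    have "stored (Suc k) (eval_com \<sigma> ?c s2)"
      unfolding stored_def
    proof (intro allI impI conjI)
      fix i j assume ij: "i < Suc k" "j < n"
      show "reals (eval_com \<sigma> ?c s2) ''X'' (i * n + j) = fst (\<omega> i) j"
        using I ij X[OF ij(2), of i] by (auto simp: s2_def s1_def stored_def less_Suc_eq)
    next
      fix i assume "i < Suc k"
      then show "reals (eval_com \<sigma> ?c s2) ''Y'' i = snd (\<omega> i)"
        using I by (auto simp: s2_def s1_def stored_def less_Suc_eq)
    qed
    then have "reach ?c s2 (cost_com ?c) (?I (Suc k))"
      using I by (intro reach_loop_free) (simp_all add: s2_def s1_def)
    then have "reach sample_body s' ((2 + n) + ((n * (ncost bj + rcost (Arr ''x'' (NVar ''j'')) + 8) + 5) + cost_com ?c)) (?I (Suc k))"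
      unfolding sample_body_def by (intro runs_Seq[OF r1] runs_Seq[OF r2])
    then show ?thesis by (rule reach_time) simp
  qed
  have "reach (While ?b sample_body) s' (?N * (bcost ?b + (n * 13 + 21 + n)) + bcost ?b) (?I ?N)" if "?I 0 s'" for s'
  proof (rule reach_While[where I = "?I"])
    show "?I 0 s'" by (rule that)
    fix k s'' assume k: "k < ?N" and I: "?I k s''"
    have "real k < ?u" using k by linarith
    then have "bval \<sigma> ?b s''" using I by simp
    then show "bval \<sigma> ?b s'' \<and> reach sample_body s'' (n * 13 + 21 + n) (?I (Suc k))" using body[OF I] by (rule conjI)
  next
    fix s'' assume I: "?I ?N s''"
    have "?u \<le> real ?N" by linarith
    then show "\<not> bval \<sigma> ?b s''" using I by simp
  qed
  from this[of "eval_com \<sigma> (NAssign ''b'' (NConst 0)) (eval_com \<sigma> (NAssign ''m'' (NConst 0)) s)"]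
  have "reach sample s (cost_com (NAssign ''m'' (NConst 0)) + (cost_com (NAssign ''b'' (NConst 0)) +
      (?N * (bcost ?b + (n * 13 + 21 + n)) + bcost ?b))) (?I ?N)"
    unfolding sample_def using n d by (intro runs_Seq[OF runs_loop_free]) (simp_all add: stored_def)
  then show ?thesis by (rule reach_mono) (simp_all add: algebra_simps)
qed


lemma reach_init_ellipsoid:
  assumes n: "nats s ''Delta'' = n" and B: "\<And>i. reals s ''B'' i = 0"
  shows "reach init_ellipsoid s (n * 20 + 20)
    (\<lambda>s'. \<forall>i<n. \<forall>j<n. reals s' ''B'' (i * n + j) = (if i = j then reals s ''wmax'' 0 + 1 else 0))"
proof -
  let ?R = "reals s ''wmax'' 0 + 1"
  let ?I = "\<lambda>(k::nat) (s'::state). nats s' ''b'' = k * n \<and> reals s' ''wmax'' = reals s ''wmax'' \<and>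
    (\<forall>i<n. \<forall>j<n. reals s' ''B'' (i * n + j) = (if i = j \<and> i < k then ?R else 0))"
  let ?c = "Seq (RAssign ''B'' (NPlus (NVar ''b'') (NVar ''i'')) (RPlus (scal ''wmax'') (RConst 1))) next_row"
  let ?s = "eval_com \<sigma> (NAssign ''b'' (NConst 0)) s"
  have "reach (For ''i'' ''Delta'' ?c) ?s (n * (cost_com ?c + 7) + 5) (?I n)"
  proof (rule reach_For[where I = "?I"])
    fix k and s' :: state
    assume k: "k < n" and i: "nats s' ''i'' = k" and I: "?I k s'" and f: "frame (For ''i'' ''Delta'' ?c) ?s s'"
    have D: "nats s' ''Delta'' = n" using frame_nats[OF f, of "''Delta''"] n by simp
    show "reach ?c s' (cost_com ?c) (\<lambda>s''. ?I (Suc k) (s''\<lparr>nats := (nats s'')(''i'' := Suc k)\<rparr>))"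
      using i I D k by (intro reach_loop_free) (auto simp: row_index_eq_iff less_Suc_eq)
  qed (use n B in auto)
  then have "reach init_ellipsoid s (cost_com (NAssign ''b'' (NConst 0)) + (n * (cost_com ?c + 7) + 5)) (?I n)"
    unfolding init_ellipsoid_def by (intro runs_Seq[OF runs_loop_free]) simp_all
  then show ?thesis by (rule reach_mono) auto
qed

definition residual :: "(nat \<Rightarrow> real) \<Rightarrow> nat \<Rightarrow> real" where
  "residual c i = \<sigma> (dot n c (fst (\<omega> i))) - snd (\<omega> i)"

text \<open>The sum is not divided by \<open>m\<close>, because a cut is unaffected by a positive
  factor in its gradient.\<close>

definition gradient :: "nat \<Rightarrow> (nat \<Rightarrow> real) \<Rightarrow> nat \<Rightarrow> real" where
  "gradient m c j = (\<Sum>i<m. residual c i * fst (\<omega> i) j)"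

definition loss :: "nat \<Rightarrow> (nat \<Rightarrow> real) \<Rightarrow> real" where
  "loss m c = (\<Sum>i<m. (residual c i)\<^sup>2)"

lemma reach_grad:
  assumes n: "nats s ''Delta'' = n" and m: "nats s ''m'' = m" and st: "stored m s"
  shows "reach grad s (m * (n * 50 + 70) + n * 20 + 50)
    (\<lambda>s'. reals s' ''q'' 0 = loss m (reals s ''c'') \<and> (\<forall>j<n. reals s' ''g'' j = gradient m (reals s ''c'') j))"
proof -
  let ?c = "reals s ''c''"
  let ?I = "\<lambda>(k::nat) (s'::state). nats s' ''b'' = k * n \<and> reals s' ''q'' 0 = (\<Sum>i<k. (residual ?c i)\<^sup>2) \<and>
    (\<forall>j<n. reals s' ''g'' j = (\<Sum>i<k. residual ?c i * fst (\<omega> i) j))"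
  let ?e0 = "RConst 0"
  define s1 where "s1 = s\<lparr>nats := (nats s)(''j'' := n), reals := (reals s)(''g'' := (\<lambda>i. if 0 \<le> i \<and> i < 0 + n then 0 else reals s ''g'' i))\<rparr>"
  have r1: "runs (For ''j'' ''Delta'' (RAssign ''g'' (NPlus (NConst 0) (NVar ''j'')) ?e0)) s
      (n * (ncost (NPlus (NConst 0) (NVar ''j'')) + rcost ?e0 + 8) + 5) s1"
    unfolding s1_def by (rule runs_map_loop) (use n in simp_all)
  define s2 where "s2 = eval_com \<sigma> (NAssign ''b'' (NConst 0)) (eval_com \<sigma> (put ''q'' (RConst 0)) s1)"
  have "reach (For ''i'' ''m'' grad_body) s2 (m * ((n * 50 + 60) + 7) + 5) (?I m)"
  proof (rule reach_For[where I = "?I"])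
    show "nats s2 ''m'' = m" using m by (simp add: s2_def s1_def)
    show "?I 0 (s2\<lparr>nats := (nats s2)(''i'' := 0)\<rparr>)" by (simp add: s2_def s1_def)
    fix k and s' :: state
    assume k: "k < m" and i: "nats s' ''i'' = k" and I: "?I k s'" and f: "frame (For ''i'' ''m'' grad_body) s2 s'"
    have D: "nats s' ''Delta'' = n" using frame_nats[OF f, of "''Delta''"] n by (simp add: s2_def s1_def)
    have C: "reals s' ''c'' = ?c" "reals s' ''X'' = reals s ''X''" "reals s' ''Y'' = reals s ''Y''"
      using frame_reals[OF f] by (simp_all add: s2_def s1_def)
    have X: "reals s' ''X'' (k * n + j) = fst (\<omega> k) j" if "j < n" for j
      using st k that by (simp add: stored_def C)
    have Y: "reals s' ''Y'' k = snd (\<omega> k)" using st k by (simp add: stored_def C)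
    let ?z0 = "put ''r'' (RConst 0)"
    let ?t0 = "eval_com \<sigma> ?z0 s'"
    let ?e = "RTimes (Arr ''c'' (NVar ''j'')) (Arr ''X'' bj)"
    define t1 where "t1 = ?t0\<lparr>nats := (nats ?t0)(''j'' := n), reals := (reals ?t0)(''r'' := (reals ?t0 ''r'')(0 := reals ?t0 ''r'' 0 + (\<Sum>j<n. ?c j * fst (\<omega> k) j)))\<rparr>"
    have q1: "runs (For ''j'' ''Delta'' (put ''r'' (RPlus (scal ''r'') ?e))) ?t0 (n * (rcost ?e + 12) + 5) t1"
      unfolding t1_def by (rule runs_sum_loop) (use D I X C in simp_all)
    let ?p2 = "put ''r'' (RMinus (Act (scal ''r'')) (Arr ''Y'' (NVar ''i'')))"
    let ?p3 = "put ''q'' (RPlus (scal ''q'') (RTimes (scal ''r'') (scal ''r'')))"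
    let ?t2 = "eval_com \<sigma> ?p3 (eval_com \<sigma> ?p2 t1)"
    let ?e' = "RPlus (Arr ''g'' (NVar ''j'')) (RTimes (scal ''r'') (Arr ''X'' bj))"
    have R: "reals ?t2 ''r'' 0 = residual ?c k"
      using Y i by (simp add: t1_def residual_def dot_def)
    define t3 where "t3 = ?t2\<lparr>nats := (nats ?t2)(''j'' := n), reals := (reals ?t2)(''g'' := (\<lambda>j. if 0 \<le> j \<and> j < 0 + n
        then reals s' ''g'' (j - 0) + residual ?c k * fst (\<omega> k) (j - 0) else reals ?t2 ''g'' j))\<rparr>"
    have q3: "runs (For ''j'' ''Delta'' (RAssign ''g'' (NPlus (NConst 0) (NVar ''j'')) ?e')) ?t2
        (n * (ncost (NPlus (NConst 0) (NVar ''j'')) + rcost ?e' + 8) + 5) t3"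
      unfolding t3_def
    proof (rule runs_map_loop)
      fix A and j assume j: "j < n" and A: "A (0 + j) = reals ?t2 ''g'' (0 + j)"
      have "reals ?t2 ''g'' = reals s' ''g''" "nats ?t2 ''b'' = k * n" "reals ?t2 ''X'' = reals s' ''X''"
        using I by (simp_all add: t1_def)
      then show "rval \<sigma> ?e' (?t2\<lparr>nats := (nats ?t2)(''j'' := j), reals := (reals ?t2)(''g'' := A)\<rparr>)
          = reals s' ''g'' j + residual ?c k * fst (\<omega> k) j"
        using A R X[OF j] by (simp del: eval_com.simps)
    qed (use D in \<open>simp_all add: t1_def\<close>)
    have b3: "nats t3 ''b'' = k * n" "nats t3 ''Delta'' = n" "reals t3 ''q'' 0 = (\<Sum>i<k. (residual ?c i)\<^sup>2) + (residual ?c k)\<^sup>2"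
      using I D R by (simp_all add: t3_def t1_def power2_eq_square)
    have g3: "reals t3 ''g'' j = (\<Sum>i<k. residual ?c i * fst (\<omega> i) j) + residual ?c k * fst (\<omega> k) j" if "j < n" for j
      using I that by (simp add: t3_def del: eval_com.simps)
    have "reach next_row t3 (cost_com next_row) (\<lambda>s''. ?I (Suc k) (s''\<lparr>nats := (nats s'')(''i'' := Suc k)\<rparr>))"
      by (intro reach_loop_free) (simp_all add: b3 g3)
    then have "reach grad_body s' (cost_com ?z0 + ((n * (rcost ?e + 12) + 5) + (cost_com ?p2 + (cost_com ?p3 +
        ((n * (ncost (NPlus (NConst 0) (NVar ''j'')) + rcost ?e' + 8) + 5) + cost_com next_row)))))
        (\<lambda>s''. ?I (Suc k) (s''\<lparr>nats := (nats s'')(''i'' := Suc k)\<rparr>))"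
      unfolding grad_body_def
      by (intro runs_Seq[OF runs_loop_free[of ?z0]] runs_Seq[OF q1] runs_Seq[OF runs_loop_free[of ?p2]]
          runs_Seq[OF runs_loop_free[of ?p3]] runs_Seq[OF q3]) simp_all
    then show "reach grad_body s' (n * 50 + 60) (\<lambda>s''. ?I (Suc k) (s''\<lparr>nats := (nats s'')(''i'' := Suc k)\<rparr>))"
      by (rule reach_time) simp
  qed simp_all
  then have "reach grad s ((n * (ncost (NPlus (NConst 0) (NVar ''j'')) + rcost ?e0 + 8) + 5) + (cost_com (put ''q'' (RConst 0)) +
      (cost_com (NAssign ''b'' (NConst 0)) + (m * ((n * 50 + 60) + 7) + 5)))) (?I m)"
    unfolding grad_def s2_def by (intro runs_Seq[OF r1] runs_Seq[OF runs_loop_free]) simp_all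
  then show ?thesis by (rule reach_mono) (simp_all add: loss_def gradient_def algebra_simps)
qed

lemma reach_record_best:
  assumes n: "nats s ''Delta'' = n"
  shows "reach record_best s (n * 20 + 50) (\<lambda>s'. if reals s ''q'' 0 < reals s ''best'' 0 \<or> nats s ''k'' = 0
    then reals s' ''best'' 0 = reals s ''q'' 0 \<and> (\<forall>j<n. reals s' ''out'' j = reals s ''c'' j)
    else reals s' ''best'' = reals s ''best'' \<and> reals s' ''out'' = reals s ''out'')" (is "reach _ _ _ ?Q")
proof -
  let ?b = "BNot (BAnd (BNot (RLess (scal ''q'') (scal ''best''))) (BNot (NLess (NVar ''k'') (NConst 1))))"
  let ?p = "put ''best'' (scal ''q'')" and ?e = "Arr ''c'' (NVar ''j'')"
  let ?L = "For ''j'' ''Delta'' (RAssign ''out'' (NPlus (NConst 0) (NVar ''j'')) ?e)"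
  let ?T = "cost_com ?p + (n * (ncost (NPlus (NConst 0) (NVar ''j'')) + rcost ?e + 8) + 5)"
  let ?s = "eval_com \<sigma> ?p s"
  have L: "runs ?L ?s (n * (ncost (NPlus (NConst 0) (NVar ''j'')) + rcost ?e + 8) + 5)
    (?s\<lparr>nats := (nats ?s)(''j'' := n), reals := (reals ?s)(''out'' :=
      (\<lambda>i. if 0 \<le> i \<and> i < 0 + n then reals s ''c'' (i - 0) else reals ?s ''out'' i))\<rparr>)"
    by (rule runs_map_loop) (use n in simp_all)
  have "reach record_best s (bcost ?b + ?T) ?Q"
    unfolding record_best_def
  proof (rule reach_Cond)
    assume "bval \<sigma> ?b s"
    then have *: "reals s ''q'' 0 < reals s ''best'' 0 \<or> nats s ''k'' = 0" by auto
    have "reach ?L ?s (n * (ncost (NPlus (NConst 0) (NVar ''j'')) + rcost ?e + 8) + 5) ?Q"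
      using L by (rule reach_mono) (use * in auto)
    then show "reach (Seq ?p ?L) s ?T ?Q" by (intro runs_Seq[OF runs_loop_free]) simp_all
  next
    assume "\<not> bval \<sigma> ?b s"
    then have *: "\<not> (reals s ''q'' 0 < reals s ''best'' 0 \<or> nats s ''k'' = 0)" by auto
    have "reach Skip s (cost_com Skip) ?Q" by (rule reach_loop_free) (use * in auto)
    then show "reach Skip s ?T ?Q" by (rule reach_time) simp
  qed
  then show ?thesis by (rule reach_time) simp
qed

lemma reach_transform:
  assumes n: "nats s ''Delta'' = n"
  shows "reach transform s (n * (n * 30 + 50) + n * 20 + 50)
    (\<lambda>s'. \<forall>j<n. reals s' ''h'' j = (\<Sum>i<n. reals s ''B'' (i * n + j) * reals s ''g'' i))"
proof -
  let ?I = "\<lambda>(k :: nat) (s' :: state). nats s' ''b'' = k * n \<and>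
    (\<forall>j<n. reals s' ''h'' j = (\<Sum>i<k. reals s ''B'' (i * n + j) * reals s ''g'' i))"
  let ?ix = "NPlus (NConst 0) (NVar ''j'')"
  define s1 where "s1 = s\<lparr>nats := (nats s)(''j'' := n), reals := (reals s)(''h'' := (\<lambda>i. if 0 \<le> i \<and> i < 0 + n then 0 else reals s ''h'' i))\<rparr>"
  have r1: "runs (For ''j'' ''Delta'' (RAssign ''h'' ?ix (RConst 0))) s (n * (ncost ?ix + rcost (RConst 0) + 8) + 5) s1"
    unfolding s1_def by (rule runs_map_loop) (use n in simp_all)
  define s2 where "s2 = eval_com \<sigma> (NAssign ''b'' (NConst 0)) s1"
  have "reach (For ''i'' ''Delta'' transform_body) s2 (n * ((n * 30 + 40) + 7) + 5) (?I n)"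
  proof (rule reach_For[where I = "?I"])
    show "nats s2 ''Delta'' = n" using n by (simp add: s2_def s1_def)
    show "?I 0 (s2\<lparr>nats := (nats s2)(''i'' := 0)\<rparr>)" by (simp add: s2_def s1_def)
    fix k and s' :: state
    assume k: "k < n" and i: "nats s' ''i'' = k" and I: "?I k s'" and f: "frame (For ''i'' ''Delta'' transform_body) s2 s'"
    have D: "nats s' ''Delta'' = n" using frame_nats[OF f, of "''Delta''"] n by (simp add: s2_def s1_def)
    have C: "reals s' ''B'' = reals s ''B''" "reals s' ''g'' = reals s ''g''"
      using frame_reals[OF f] by (simp_all add: s2_def s1_def)
    let ?e = "RPlus (Arr ''h'' (NVar ''j'')) (RTimes (Arr ''B'' bj) (Arr ''g'' (NVar ''i'')))"
    define t where "t = s'\<lparr>nats := (nats s')(''j'' := n), reals := (reals s')(''h'' := (\<lambda>j. if 0 \<le> j \<and> j < 0 + n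
        then reals s' ''h'' (j - 0) + reals s ''B'' (k * n + (j - 0)) * reals s ''g'' k else reals s' ''h'' j))\<rparr>"
    have r: "runs (For ''j'' ''Delta'' (RAssign ''h'' ?ix ?e)) s' (n * (ncost ?ix + rcost ?e + 8) + 5) t"
      unfolding t_def by (rule runs_map_loop) (use D I C i in simp_all)
    have "reach next_row t (cost_com next_row) (\<lambda>s''. ?I (Suc k) (s''\<lparr>nats := (nats s'')(''i'' := Suc k)\<rparr>))"
      using I D by (intro reach_loop_free) (simp_all add: t_def)
    then have "reach transform_body s' ((n * (ncost ?ix + rcost ?e + 8) + 5) + cost_com next_row)
        (\<lambda>s''. ?I (Suc k) (s''\<lparr>nats := (nats s'')(''i'' := Suc k)\<rparr>))"
      unfolding transform_body_def by (rule runs_Seq[OF r])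
    then show "reach transform_body s' (n * 30 + 40) (\<lambda>s''. ?I (Suc k) (s''\<lparr>nats := (nats s'')(''i'' := Suc k)\<rparr>))"
      by (rule reach_time) simp
  qed simp_all
  then have "reach transform s ((n * (ncost ?ix + rcost (RConst 0) + 8) + 5) + (cost_com (NAssign ''b'' (NConst 0)) +
      (n * ((n * 30 + 40) + 7) + 5))) (?I n)"
    unfolding transform_def s2_def by (intro runs_Seq[OF r1] runs_Seq[OF runs_loop_free]) simp_all
  then show ?thesis by (rule reach_mono) (simp_all add: algebra_simps)
qed

lemma reach_norms:
  assumes n: "nats s ''Delta'' = n"
  shows "reach norms s (n * 60 + 20)
    (\<lambda>s'. reals s' ''s'' 0 = (\<Sum>j<n. \<bar>reals s ''h'' j\<bar>) \<and> reals s' ''H'' 0 = dot n (reals s ''h'') (reals s ''h''))"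
proof -
  let ?h = "reals s ''h''"
  let ?I = "\<lambda>(k :: nat) (s' :: state). reals s' ''s'' 0 = (\<Sum>j<k. \<bar>?h j\<bar>) \<and> reals s' ''H'' 0 = (\<Sum>j<k. ?h j * ?h j)"
  let ?s = "eval_com \<sigma> (put ''H'' (RConst 0)) (eval_com \<sigma> (put ''s'' (RConst 0)) s)"
  have "reach (For ''j'' ''Delta'' norms_body) ?s (n * (cost_com norms_body + 7) + 5) (?I n)"
  proof (rule reach_For[where I = "?I"])
    fix k and s' :: state
    assume k: "k < n" and j: "nats s' ''j'' = k" and I: "?I k s'" and f: "frame (For ''j'' ''Delta'' norms_body) ?s s'"
    have h: "reals s' ''h'' = ?h" using frame_reals[OF f] by simp
    show "reach norms_body s' (cost_com norms_body) (\<lambda>s''. ?I (Suc k) (s''\<lparr>nats := (nats s'')(''j'' := Suc k)\<rparr>))"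
      by (intro reach_loop_free) (use I j h in \<open>auto simp: norms_body_def\<close>)
  qed (use n in simp_all)
  then have "reach norms s (cost_com (put ''s'' (RConst 0)) + (cost_com (put ''H'' (RConst 0)) + (n * (cost_com norms_body + 7) + 5))) (?I n)"
    unfolding norms_def by (intro runs_Seq[OF runs_loop_free]) simp_all
  then show ?thesis by (rule reach_mono) (simp_all add: norms_body_def dot_def)
qed

definition new_center :: "(nat \<Rightarrow> real) \<Rightarrow> (nat \<Rightarrow> nat \<Rightarrow> real) \<Rightarrow> (nat \<Rightarrow> real) \<Rightarrow> real \<Rightarrow> real \<Rightarrow> nat \<Rightarrow> real" where
  "new_center c B h w q i = c i - fapp n B h i / (2 * real n * w * (1 + q))"

definition new_axes :: "(nat \<Rightarrow> nat \<Rightarrow> real) \<Rightarrow> (nat \<Rightarrow> real) \<Rightarrow> real \<Rightarrow> real \<Rightarrow> nat \<Rightarrow> nat \<Rightarrow> real" where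
  "new_axes B h H q i j = (1 + q / (8 * real n)) * (B i j - q / 4 * fapp n B h i * h j / H)"

lemma reach_update:
  assumes n: "nats s ''Delta'' = n"
  defines "c \<equiv> reals s ''c''" and "B \<equiv> \<lambda>i j. reals s ''B'' (i * n + j)" and "h \<equiv> reals s ''h''"
    and "w \<equiv> reals s ''s'' 0" and "H \<equiv> reals s ''H'' 0"
  defines "q \<equiv> H / (w * w) / real n"
  shows "reach update s (n * (n * 80 + 110) + 50)
    (\<lambda>s'. (\<forall>i<n. reals s' ''c'' i = new_center c B h w q i) \<and>
      (\<forall>i<n. \<forall>j<n. reals s' ''B'' (i * n + j) = new_axes B h H q i j))"
proof -
  let ?I = "\<lambda>(k :: nat) (s' :: state). nats s' ''b'' = k * n \<and>
    (\<forall>i<n. reals s' ''c'' i = (if i < k then new_center c B h w q i else c i)) \<and>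
    (\<forall>i<n. \<forall>j<n. reals s' ''B'' (i * n + j) = (if i < k then new_axes B h H q i j else B i j))"
  let ?t = "put ''t'' (RDivide (RDivide (scal ''H'') (RTimes (scal ''s'') (scal ''s''))) (OfNat (NVar ''Delta'')))"
  define s2 where "s2 = eval_com \<sigma> (NAssign ''b'' (NConst 0)) (eval_com \<sigma> ?t s)"
  have "reach (For ''i'' ''Delta'' update_body) s2 (n * ((n * 80 + 100) + 7) + 5) (?I n)"
  proof (rule reach_For[where I = "?I"])
    show "nats s2 ''Delta'' = n" using n by (simp add: s2_def)
    show "?I 0 (s2\<lparr>nats := (nats s2)(''i'' := 0)\<rparr>)" by (simp add: s2_def c_def B_def)
    fix k and s' :: state
    assume k: "k < n" and i: "nats s' ''i'' = k" and I: "?I k s'" and f: "frame (For ''i'' ''Delta'' update_body) s2 s'"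
    have D: "nats s' ''Delta'' = n" using frame_nats[OF f, of "''Delta''"] n by (simp add: s2_def)
    have C: "reals s' ''h'' = h" "reals s' ''s'' 0 = w" "reals s' ''H'' 0 = H" "reals s' ''t'' 0 = q"
      using frame_reals[OF f] n by (simp_all add: s2_def h_def w_def H_def q_def)
    have Bk: "reals s' ''B'' (k * n + j) = B k j" if "j < n" for j using I k that by simp
    let ?r = "fapp n B h k"
    let ?z0 = "put ''r'' (RConst 0)"
    let ?t0 = "eval_com \<sigma> ?z0 s'"
    let ?e = "RTimes (Arr ''B'' bj) (Arr ''h'' (NVar ''j''))"
    define t1 where "t1 = ?t0\<lparr>nats := (nats ?t0)(''j'' := n), reals := (reals ?t0)(''r'' := (reals ?t0 ''r'')(0 := reals ?t0 ''r'' 0 + (\<Sum>j<n. B k j * h j)))\<rparr>"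
    have q1: "runs (For ''j'' ''Delta'' (put ''r'' (RPlus (scal ''r'') ?e))) ?t0 (n * (rcost ?e + 12) + 5) t1"
      unfolding t1_def by (rule runs_sum_loop) (use D I C Bk in simp_all)
    let ?p2 = "RAssign ''c'' (NVar ''i'') (RMinus (Arr ''c'' (NVar ''i'')) (RDivide (scal ''r'')
      (RTimes (RTimes (RTimes (RConst 2) (OfNat (NVar ''Delta''))) (scal ''s'')) (RPlus (RConst 1) (scal ''t'')))))"
    define t2 where "t2 = eval_com \<sigma> ?p2 t1"
    have r2: "runs ?p2 t1 (cost_com ?p2) t2" unfolding t2_def by (rule runs_loop_free) simp
    have t2: "nats t2 ''b'' = k * n" "nats t2 ''Delta'' = n" "reals t2 ''B'' = reals s' ''B''" "reals t2 ''h'' = h"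
      "reals t2 ''t'' 0 = q" "reals t2 ''H'' 0 = H" "reals t2 ''r'' 0 = ?r"
      "reals t2 ''c'' = (reals s' ''c'')(k := new_center c B h w q k)"
      using I D C i k by (simp_all add: t2_def t1_def fapp_def new_center_def)
    let ?e' = "RTimes (RPlus (RConst 1) (RDivide (scal ''t'') (RTimes (RConst 8) (OfNat (NVar ''Delta'')))))
      (RMinus (Arr ''B'' bj) (RDivide (RTimes (RTimes (RDivide (scal ''t'') (RConst 4)) (scal ''r'')) (Arr ''h'' (NVar ''j''))) (scal ''H'')))"
    define t3 where "t3 = t2\<lparr>nats := (nats t2)(''j'' := n), reals := (reals t2)(''B'' := (\<lambda>i. if k * n \<le> i \<and> i < k * n + n
        then new_axes B h H q k (i - k * n) else reals t2 ''B'' i))\<rparr>"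
    have q3: "runs (For ''j'' ''Delta'' (RAssign ''B'' bj ?e')) t2 (n * (ncost bj + rcost ?e' + 8) + 5) t3"
      unfolding t3_def
    proof (rule runs_map_loop)
      fix A and j assume j: "j < n" and A: "A (k * n + j) = reals t2 ''B'' (k * n + j)"
      then have "A (k * n + j) = B k j" using Bk t2(3) by simp
      then show "rval \<sigma> ?e' (t2\<lparr>nats := (nats t2)(''j'' := j), reals := (reals t2)(''B'' := A)\<rparr>) = new_axes B h H q k j"
        using t2 by (simp add: new_axes_def)
    qed (use t2 in simp_all)
    have B3: "reals t3 ''B'' (i * n + j) = (if i < Suc k then new_axes B h H q i j else B i j)" if "i < n" "j < n" for i j
    proof -
      have "reals t3 ''B'' (i * n + j) = (if i = k then new_axes B h H q k (i * n + j - k * n) else reals s' ''B'' (i * n + j))"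
        unfolding t3_def using t2(3) by (simp add: row_index_in_row_iff[OF that(2)])
      then show ?thesis using I that by (auto simp: less_Suc_eq)
    qed
    have c3: "reals t3 ''c'' i = (if i < Suc k then new_center c B h w q i else c i)" if "i < n" for i
      using I that t2(8) by (auto simp: t3_def less_Suc_eq)
    have "reach next_row t3 (cost_com next_row) (\<lambda>s''. ?I (Suc k) (s''\<lparr>nats := (nats s'')(''i'' := Suc k)\<rparr>))"
      by (intro reach_loop_free) (use B3 c3 t2 in \<open>simp_all add: t3_def[THEN arg_cong[where f = nats]]\<close>)
    then have "reach update_body s' (cost_com ?z0 + ((n * (rcost ?e + 12) + 5) + (cost_com ?p2 +
        ((n * (ncost bj + rcost ?e' + 8) + 5) + cost_com next_row))))
        (\<lambda>s''. ?I (Suc k) (s''\<lparr>nats := (nats s'')(''i'' := Suc k)\<rparr>))"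
      unfolding update_body_def
      by (intro runs_Seq[OF runs_loop_free[of ?z0]] runs_Seq[OF q1] runs_Seq[OF r2]
          runs_Seq[OF q3]) simp_all
    then show "reach update_body s' (n * 80 + 100) (\<lambda>s''. ?I (Suc k) (s''\<lparr>nats := (nats s'')(''i'' := Suc k)\<rparr>))"
      by (rule reach_time) simp
  qed simp_all
  then have "reach update s (cost_com ?t + (cost_com (NAssign ''b'' (NConst 0)) + (n * ((n * 80 + 100) + 7) + 5))) (?I n)"
    unfolding update_def s2_def by (intro runs_Seq[OF runs_loop_free]) simp_all
  then show ?thesis by (rule reach_mono) (simp_all add: algebra_simps)
qed

definition axes :: "state \<Rightarrow> nat \<Rightarrow> nat \<Rightarrow> real" where
  "axes s i j = reals s ''B'' (i * n + j)"

lemma reach_iteration: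
  assumes n: "nats s ''Delta'' = n" and m: "nats s ''m'' = m" and st: "stored m s"
  shows "reach iteration s (m * (n * 50 + 70) + n * (n * 110 + 300) + 300)
    (\<lambda>s'. nats s' ''k'' = Suc (nats s ''k'') \<and>
      cut_step n (gradient m (reals s ''c'')) (reals s ''c'') (axes s) (reals s' ''c'') (axes s') \<and>
      (if loss m (reals s ''c'') < reals s ''best'' 0 \<or> nats s ''k'' = 0
       then reals s' ''best'' 0 = loss m (reals s ''c'') \<and> (\<forall>j<n. reals s' ''out'' j = reals s ''c'' j)
       else reals s' ''best'' = reals s ''best'' \<and> reals s' ''out'' = reals s ''out''))" (is "reach _ _ _ ?Q")
proof -
  let ?c = "reals s ''c''"
  obtain t1 s1 where x1: "exec \<sigma> n \<omega> grad s t1 s1" "t1 \<le> m * (n * 50 + 70) + n * 20 + 50"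
    and P1: "reals s1 ''q'' 0 = loss m ?c \<and> (\<forall>j<n. reals s1 ''g'' j = gradient m ?c j)" and f1: "frame grad s s1"
    by (rule reachE[OF reach_grad[OF n m st]])
  have n1: "nats s1 ''Delta'' = n" using frame_nats[OF f1] n by simp
  obtain t2 s2 where x2: "exec \<sigma> n \<omega> record_best s1 t2 s2" "t2 \<le> n * 20 + 50"
    and P2: "if reals s1 ''q'' 0 < reals s1 ''best'' 0 \<or> nats s1 ''k'' = 0
      then reals s2 ''best'' 0 = reals s1 ''q'' 0 \<and> (\<forall>j<n. reals s2 ''out'' j = reals s1 ''c'' j)
      else reals s2 ''best'' = reals s1 ''best'' \<and> reals s2 ''out'' = reals s1 ''out''" and f2: "frame record_best s1 s2"
    by (rule reachE[OF reach_record_best[OF n1]])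
  have n2: "nats s2 ''Delta'' = n" using frame_nats[OF f2] n1 by simp
  obtain t3 s3 where x3: "exec \<sigma> n \<omega> transform s2 t3 s3" "t3 \<le> n * (n * 30 + 50) + n * 20 + 50"
    and P3: "\<forall>j<n. reals s3 ''h'' j = (\<Sum>i<n. reals s2 ''B'' (i * n + j) * reals s2 ''g'' i)" and f3: "frame transform s2 s3"
    by (rule reachE[OF reach_transform[OF n2]])
  have n3: "nats s3 ''Delta'' = n" using frame_nats[OF f3] n2 by simp
  obtain t4 s4 where x4: "exec \<sigma> n \<omega> norms s3 t4 s4" "t4 \<le> n * 60 + 20"
    and P4: "reals s4 ''s'' 0 = (\<Sum>j<n. \<bar>reals s3 ''h'' j\<bar>) \<and> reals s4 ''H'' 0 = dot n (reals s3 ''h'') (reals s3 ''h'')"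
    and f4: "frame norms s3 s4"
    by (rule reachE[OF reach_norms[OF n3]])
  have n4: "nats s4 ''Delta'' = n" using frame_nats[OF f4] n3 by simp
  let ?H = "reals s4 ''H'' 0" and ?w = "reals s4 ''s'' 0" and ?h = "reals s4 ''h''"
  let ?B = "\<lambda>i j. reals s4 ''B'' (i * n + j)"
  let ?q = "?H / (?w * ?w) / real n"
  obtain t5 s5 where x5: "exec \<sigma> n \<omega> update s4 t5 s5" "t5 \<le> n * (n * 80 + 110) + 50"
    and P5: "(\<forall>i<n. reals s5 ''c'' i = new_center (reals s4 ''c'') ?B ?h ?w ?q i) \<and>
      (\<forall>i<n. \<forall>j<n. reals s5 ''B'' (i * n + j) = new_axes ?B ?h ?H ?q i j)" and f5: "frame update s4 s5"
    by (rule reachE[OF reach_update[OF n4]])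
  have e: "reals s4 ''c'' = ?c" "reals s4 ''B'' = reals s ''B''" "reals s2 ''B'' = reals s ''B''"
    "reals s2 ''g'' = reals s1 ''g''" "reals s4 ''h'' = reals s3 ''h''" "reals s1 ''c'' = ?c"
    "reals s1 ''best'' = reals s ''best''" "reals s1 ''out'' = reals s ''out''"
    "reals s5 ''best'' = reals s2 ''best''" "reals s5 ''out'' = reals s2 ''out''"
    using frame_reals[OF f1] frame_reals[OF f2] frame_reals[OF f3] frame_reals[OF f4] frame_reals[OF f5] by simp_all
  have k: "nats s5 ''k'' = nats s ''k''" "nats s1 ''k'' = nats s ''k''"
    using frame_nats[OF f1] frame_nats[OF f2] frame_nats[OF f3] frame_nats[OF f4] frame_nats[OF f5] by simp_all
  define g where "g = gradient m ?c"
  \<comment> \<open>The array agrees with this function only at indices below \<open>n\<close>; the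
    sums over \<open>{..<n}\<close> are transferred by congruence.\<close>
  define h where "h j = (\<Sum>i<n. axes s i j * g i)" for j
  have h: "?h j = h j" if "j < n" for j
    using P3 P1 that by (simp add: h_def e axes_def g_def)
  have hw: "?w = (\<Sum>j<n. \<bar>h j\<bar>)" using P4 h by (simp add: e)
  have hH: "?H = dot n h h" using P4 h by (simp add: e dot_def)
  have hr: "fapp n ?B ?h i = fapp n (axes s) h i" for i using h by (simp add: e axes_def fapp_def)
  have cut: "cut_step n g ?c (axes s) (reals s5 ''c'') (axes s5)"
    unfolding cut_step_def Let_def h_def[symmetric] hw[symmetric] hH[symmetric]
  proof (intro conjI allI impI)
    fix i assume "i < n"
    then have a: "reals s5 ''c'' i = new_center (reals s4 ''c'') ?B ?h ?w ?q i" using P5 by blast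
    show "reals s5 ''c'' i = ?c i - fapp n (axes s) h i / (2 * real n * ?w * (1 + ?q))"
      unfolding a new_center_def hr e(1) by (rule refl)
  next
    fix i j assume ij: "i < n" "j < n"
    then have a: "reals s5 ''B'' (i * n + j) = new_axes ?B ?h ?H ?q i j" using P5 by blast
    have b: "?B i j = axes s i j" by (simp add: axes_def e(2))
    show "axes s5 i j = (1 + ?q / (8 * real n)) * (axes s i j - ?q / 4 * fapp n (axes s) h i * h j / ?H)"
      unfolding axes_def[of s5] a new_axes_def hr h[OF ij(2)] b by (rule refl)
  qed
  have Q: "?Q (eval_com \<sigma> (incr ''k'') s5)"
    using cut P2 P1 by (simp add: e k axes_def[abs_def] g_def)
  have x6: "exec \<sigma> n \<omega> (incr ''k'') s5 4 (eval_com \<sigma> (incr ''k'') s5)"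
    using exec.NAssign[of \<sigma> n \<omega> "''k''" "NPlus (NVar ''k'') (NConst 1)" s5] by (simp add: eval_nat_numeral)
  show ?thesis
  proof (rule reachI[where P = "?Q"])
    show "exec \<sigma> n \<omega> iteration s (t1 + (t2 + (t3 + (t4 + (t5 + 4))))) (eval_com \<sigma> (incr ''k'') s5)"
      unfolding iteration_def
      by (rule exec.Seq[OF x1(1) exec.Seq[OF x2(1) exec.Seq[OF x3(1) exec.Seq[OF x4(1) exec.Seq[OF x5(1) x6]]]]])
    show "t1 + (t2 + (t3 + (t4 + (t5 + 4)))) \<le> m * (n * 50 + 70) + n * (n * 110 + 300) + 300"
      using x1(2) x2(2) x3(2) x4(2) x5(2) by (simp add: algebra_simps)
  qed (rule Q)
qed

lemma loss_cong: "(\<And>j. j < n \<Longrightarrow> c j = c' j) \<Longrightarrow> loss m c = loss m c'"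
  by (simp add: loss_def residual_def dot_def)

definition iteration_time :: "nat \<Rightarrow> nat" where
  "iteration_time m = m * (n * 50 + 70) + n * (n * 110 + 300) + 300"

definition run_of_cuts :: "nat \<Rightarrow> nat \<Rightarrow> (nat \<Rightarrow> nat \<Rightarrow> real) \<Rightarrow> (nat \<Rightarrow> nat \<Rightarrow> nat \<Rightarrow> real) \<Rightarrow> bool" where
  "run_of_cuts m T cs Bs \<longleftrightarrow> (\<forall>l<T. cut_step n (gradient m (cs l)) (cs l) (Bs l) (cs (Suc l)) (Bs (Suc l)))"

definition best_iterate :: "nat \<Rightarrow> nat \<Rightarrow> (nat \<Rightarrow> nat \<Rightarrow> real) \<Rightarrow> (nat \<Rightarrow> real) \<Rightarrow> bool" where
  "best_iterate m T cs v \<longleftrightarrow> (\<forall>l<T. loss m v \<le> loss m (cs l))"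

lemma run_of_cuts_Suc:
  assumes r: "run_of_cuts m k cs Bs" and c: "cut_step n (gradient m (cs k)) (cs k) (Bs k) c B"
  shows "run_of_cuts m (Suc k) (cs(Suc k := c)) (Bs(Suc k := B))"
  unfolding run_of_cuts_def
proof (intro allI impI)
  fix l assume "l < Suc k"
  then consider "l < k" | "l = k" by linarith
  then show "cut_step n (gradient m ((cs(Suc k := c)) l)) ((cs(Suc k := c)) l) ((Bs(Suc k := B)) l)
      ((cs(Suc k := c)) (Suc l)) ((Bs(Suc k := B)) (Suc l))"
    using r c by cases (simp_all add: run_of_cuts_def)
qed

text \<open>The memory keeps only the current ellipsoid, whereas \<open>cutting_planes\<close>
  speaks of the whole history. The invariant therefore carries the history as existentially
  quantified sequences, extended by one entry in each round. Its claim about the best iterate begins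
  with the first completed round.\<close>

lemma reach_search:
  assumes n: "nats s ''Delta'' = n" and m: "nats s ''m'' = m" and st: "stored m s" and T: "reals s ''u'' 0 = real T" "T \<ge> 1"
  shows "reach search s (T * (iteration_time m + 10) + 20) (\<lambda>s'. \<exists>cs Bs. cs 0 = reals s ''c'' \<and> Bs 0 = axes s \<and>
    run_of_cuts m T cs Bs \<and> best_iterate m T cs (reals s' ''out''))"
proof -
  let ?P = "\<lambda>(k :: nat) (s' :: state) cs Bs. cs 0 = reals s ''c'' \<and> Bs 0 = axes s \<and> cs k = reals s' ''c'' \<and> Bs k = axes s' \<and>
    run_of_cuts m k cs Bs \<and> (k > 0 \<longrightarrow> reals s' ''best'' 0 = loss m (reals s' ''out'') \<and> best_iterate m k cs (reals s' ''out''))"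
  let ?I = "\<lambda>(k :: nat) (s' :: state). nats s' ''k'' = k \<and> (\<exists>cs Bs. ?P k s' cs Bs)"
  let ?s = "eval_com \<sigma> (NAssign ''k'' (NConst 0)) s"
  let ?b = "RLess (OfNat (NVar ''k'')) (scal ''u'')"
  have "reach (While ?b iteration) ?s (T * (bcost ?b + iteration_time m) + bcost ?b) (?I T)"
  proof (rule reach_While[where I = "?I"])
    have "?P 0 ?s (\<lambda>_. reals s ''c'') (\<lambda>_. axes s)" by (simp add: run_of_cuts_def axes_def[abs_def])
    then have "\<exists>cs Bs. ?P 0 ?s cs Bs" by (intro exI[of _ "\<lambda>_. reals s ''c''"] exI[of _ "\<lambda>_. axes s"])
    then show "?I 0 ?s" by simp
  next
    fix k and s' :: state
    assume k: "k < T" and I: "?I k s'" and f: "frame iteration ?s s'"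
    have s': "nats s' ''Delta'' = n" "nats s' ''m'' = m" "reals s' ''u'' = reals s ''u''"
      "reals s' ''X'' = reals s ''X''" "reals s' ''Y'' = reals s ''Y''"
      using frame_nats[OF f] frame_reals[OF f] n m by simp_all
    have st': "stored m s'" using st by (simp add: stored_def s')
    have b: "bval \<sigma> ?b s'" using I k T(1) by (simp add: s')
    from conjunct2[OF I] obtain cs Bs where P: "?P k s' cs Bs" by (elim exE) (rule that)
    have "reach iteration s' (iteration_time m) (?I (Suc k))"
      unfolding iteration_time_def
    proof (rule reach_mono[OF reach_iteration[OF s'(1,2) st']])
      fix s'' :: state
      assume Q: "nats s'' ''k'' = Suc (nats s' ''k'') \<and>
        cut_step n (gradient m (reals s' ''c'')) (reals s' ''c'') (axes s') (reals s'' ''c'') (axes s'') \<and>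
        (if loss m (reals s' ''c'') < reals s' ''best'' 0 \<or> nats s' ''k'' = 0
         then reals s'' ''best'' 0 = loss m (reals s' ''c'') \<and> (\<forall>j<n. reals s'' ''out'' j = reals s' ''c'' j)
         else reals s'' ''best'' = reals s' ''best'' \<and> reals s'' ''out'' = reals s' ''out'')"
      let ?cs = "cs(Suc k := reals s'' ''c'')" and ?Bs = "Bs(Suc k := axes s'')"
      have cut: "cut_step n (gradient m (cs k)) (cs k) (Bs k) (reals s'' ''c'') (axes s'')" using Q P by simp
      have run: "run_of_cuts m (Suc k) ?cs ?Bs"
        by (rule run_of_cuts_Suc[of m k cs Bs "reals s'' ''c''" "axes s''", OF _ cut]) (use P in simp)
      have "reals s'' ''best'' 0 = loss m (reals s'' ''out'') \<and> best_iterate m (Suc k) ?cs (reals s'' ''out'')"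
      proof (cases "loss m (reals s' ''c'') < reals s' ''best'' 0 \<or> nats s' ''k'' = 0")
        case True
        then have *: "reals s'' ''best'' 0 = loss m (cs k)" "\<forall>j<n. reals s'' ''out'' j = cs k j" using Q P by simp_all
        have out: "loss m (reals s'' ''out'') = loss m (cs k)" using *(2) by (intro loss_cong) simp
        have "loss m (cs k) \<le> loss m (cs l)" if "l < Suc k" for l
        proof (cases "l = k")
          case False
          then have l: "l < k" "k > 0" using that by auto
          then have "loss m (reals s' ''out'') \<le> loss m (cs l)" "loss m (cs k) < loss m (reals s' ''out'')"
            using P True I by (auto simp: best_iterate_def)
          then show ?thesis by linarith
        qed simp
        then show ?thesis using * out by (simp add: best_iterate_def)
      next
        case False
        then have *: "reals s'' ''best'' = reals s' ''best''" "reals s'' ''out'' = reals s' ''out''" "k > 0"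
          "reals s' ''best'' 0 \<le> loss m (cs k)" using Q I P by simp_all
        then show ?thesis using P by (auto simp: best_iterate_def less_Suc_eq)
      qed
      then have "?P (Suc k) s'' ?cs ?Bs" using P run by simp
      then have "\<exists>cs Bs. ?P (Suc k) s'' cs Bs" by (intro exI[of _ ?cs] exI[of _ ?Bs])
      moreover have "nats s'' ''k'' = Suc k" using Q I by simp
      ultimately show "?I (Suc k) s''" by (rule conjI[rotated])
    qed simp
    with b show "bval \<sigma> ?b s' \<and> reach iteration s' (iteration_time m) (?I (Suc k))" by (rule conjI)
  next
    fix s' :: state assume I: "?I T s'" and f: "frame iteration ?s s'"
    have "reals s' ''u'' = reals s ''u''" using frame_reals[OF f] by simp
    then show "\<not> bval \<sigma> ?b s'" using I T by simp
  qed
  then have "reach search s (cost_com (NAssign ''k'' (NConst 0)) + (T * (bcost ?b + iteration_time m) + bcost ?b)) (?I T)"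
    unfolding search_def by (intro runs_Seq[OF runs_loop_free]) simp_all
  then show ?thesis
  proof (rule reach_mono)
    fix s' :: state assume "?I T s'"
    from conjunct2[OF this] obtain cs Bs where "?P T s' cs Bs" by (elim exE) (rule that)
    then show "\<exists>cs Bs. cs 0 = reals s ''c'' \<and> Bs 0 = axes s \<and>
        run_of_cuts m T cs Bs \<and> best_iterate m T cs (reals s' ''out'')"
      using T(2) by (intro exI[of _ cs] exI[of _ Bs]) simp
  qed (simp add: algebra_simps)
qed

definition sample_size :: "real \<Rightarrow> real \<Rightarrow> nat" where
  "sample_size \<alpha> \<epsilon> = nat \<lceil>65536 * real n * real (doublings (real n * \<alpha> / \<epsilon>)) / (\<epsilon> * \<epsilon>)\<rceil>"

text \<open>The requirement of \<open>cutting_planes\<close> for R = w + 1 and r = \<epsilon> / (2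
  n): the argument of \<open>doublings\<close> is R / r, and the number of doublings is at least its
  natural logarithm because ln 2 \<le> 1.\<close>

definition iterations :: "real \<Rightarrow> real \<Rightarrow> nat" where
  "iterations \<epsilon> w = 8 * n * n * n * doublings (2 * real n * (w + 1) / \<epsilon>) + 1"

definition learn_time :: "real \<Rightarrow> real \<Rightarrow> real \<Rightarrow> nat" where
  "learn_time \<alpha> \<epsilon> w = doublings (real n * \<alpha> / \<epsilon>) * 17 + sample_size \<alpha> \<epsilon> * (n * 20 + 40) +
    doublings (2 * real n * (w + 1) / \<epsilon>) * 17 + n * 20 + iterations \<epsilon> w * (iteration_time (sample_size \<alpha> \<epsilon>) + 10) + 300"

lemma reach_learn:
  "reach learn (initial n \<epsilon> \<alpha> w) (learn_time \<alpha> \<epsilon> w) (\<lambda>s'. draws s' = sample_size \<alpha> \<epsilon> \<and>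
    (\<exists>cs Bs. cs 0 = (\<lambda>_. 0) \<and> (\<forall>i<n. \<forall>j<n. Bs 0 i j = (if i = j then w + 1 else 0)) \<and>
      run_of_cuts (sample_size \<alpha> \<epsilon>) (iterations \<epsilon> w) cs Bs \<and> best_iterate (sample_size \<alpha> \<epsilon>) (iterations \<epsilon> w) cs (reals s' ''out'')))"
    (is "reach _ _ _ ?Q")
proof -
  let ?s = "initial n \<epsilon> \<alpha> w"
  let ?L = "doublings (real n * \<alpha> / \<epsilon>)" and ?J = "doublings (2 * real n * (w + 1) / \<epsilon>)"
  let ?m = "sample_size \<alpha> \<epsilon>" and ?T = "iterations \<epsilon> w"
  let ?p1 = "put ''u'' (RDivide (RTimes Delta_r (scal ''alpha'')) (scal ''eps''))"
  let ?p2 = "put ''u'' (RDivide (RTimes (RTimes (RConst 65536) Delta_r) (OfNat (NVar ''L''))) (RTimes (scal ''eps'') (scal ''eps'')))"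
  let ?p3 = "put ''u'' (RDivide (RTimes (RTimes (RConst 2) Delta_r) (RPlus (scal ''wmax'') (RConst 1))) (scal ''eps''))"
  let ?p4 = "put ''u'' (RPlus (RTimes (RTimes (RTimes (RTimes (RConst 8) Delta_r) Delta_r) Delta_r) (OfNat (NVar ''L''))) (RConst 1))"
  \<comment> \<open>The arguments and the zero array \<open>c\<close>, which is the first centre,
    survive every phase before the search.\<close>
  define keeps where "keeps s \<longleftrightarrow> nats s ''Delta'' = n \<and> reals s ''eps'' 0 = \<epsilon> \<and> reals s ''alpha'' 0 = \<alpha> \<and>
    reals s ''wmax'' 0 = w \<and> reals s ''c'' = (\<lambda>_. 0)" for s :: state
  define s1 where "s1 = eval_com \<sigma> ?p1 ?s"
  have k1: "keeps s1" "reals s1 ''u'' 0 = real n * \<alpha> / \<epsilon>" "reals s1 ''B'' = (\<lambda>_. 0)" "draws s1 = 0"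
    by (simp_all add: s1_def keeps_def initial_def Delta_r_def)
  obtain t2 s2 where x2: "exec \<sigma> n \<omega> (doubling ''L'') s1 t2 s2" "t2 \<le> ?L * 17 + 20"
    and P2: "nats s2 ''L'' = ?L" and f2: "frame (doubling ''L'') s1 s2"
    by (rule reachE[OF reach_doubling[of "''L''" s1, unfolded k1(2)]])
  have k2: "keeps s2" "reals s2 ''B'' = (\<lambda>_. 0)" "draws s2 = 0"
    using k1 frame_nats[OF f2] frame_reals[OF f2] frame_draws[OF f2] by (simp_all add: keeps_def)
  define s3 where "s3 = eval_com \<sigma> ?p2 s2"
  have m3: "nat \<lceil>reals s3 ''u'' 0\<rceil> = ?m"
    using k2 P2 by (simp add: s3_def keeps_def Delta_r_def sample_size_def)
  have k3: "keeps s3" "reals s3 ''B'' = (\<lambda>_. 0)" "draws s3 = 0" "nats s3 ''Delta'' = n" using k2 by (simp_all add: s3_def keeps_def)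
  obtain t4 s4 where x4: "exec \<sigma> n \<omega> sample s3 t4 s4" "t4 \<le> ?m * (n * 20 + 40) + 20"
    and P4: "nats s4 ''m'' = ?m \<and> draws s4 = ?m \<and> stored ?m s4" and f4: "frame sample s3 s4"
    by (rule reachE[OF reach_sample[OF k3(4,3), unfolded m3]])
  have k4: "keeps s4" "reals s4 ''B'' = (\<lambda>_. 0)"
    using k3 frame_nats[OF f4] frame_reals[OF f4] by (simp_all add: keeps_def)
  define s5 where "s5 = eval_com \<sigma> ?p3 s4"
  have u5: "reals s5 ''u'' 0 = 2 * real n * (w + 1) / \<epsilon>" using k4 by (simp add: s5_def keeps_def Delta_r_def)
  have k5: "keeps s5" "reals s5 ''B'' = (\<lambda>_. 0)" "nats s5 ''m'' = ?m" "draws s5 = ?m" "stored ?m s5"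
    using k4 P4 by (simp_all add: s5_def keeps_def stored_def)
  obtain t6 s6 where x6: "exec \<sigma> n \<omega> (doubling ''L'') s5 t6 s6" "t6 \<le> ?J * 17 + 20"
    and P6: "nats s6 ''L'' = ?J" and f6: "frame (doubling ''L'') s5 s6"
    by (rule reachE[OF reach_doubling[of "''L''" s5, unfolded u5]])
  have k6: "keeps s6" "reals s6 ''B'' = (\<lambda>_. 0)" "nats s6 ''m'' = ?m" "draws s6 = ?m" "stored ?m s6" "nats s6 ''Delta'' = n"
    using k5 frame_nats[OF f6] frame_reals[OF f6] frame_draws[OF f6] by (simp_all add: keeps_def stored_def)
  have B6: "reals s6 ''B'' i = 0" for i using k6(2) by simp
  obtain t7 s7 where x7: "exec \<sigma> n \<omega> init_ellipsoid s6 t7 s7" "t7 \<le> n * 20 + 20"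
    and P7: "\<forall>i<n. \<forall>j<n. reals s7 ''B'' (i * n + j) = (if i = j then reals s6 ''wmax'' 0 + 1 else 0)"
    and f7: "frame init_ellipsoid s6 s7"
    by (rule reachE[OF reach_init_ellipsoid[OF k6(6) B6]])
  have k7: "keeps s7" "nats s7 ''L'' = ?J" "nats s7 ''m'' = ?m" "draws s7 = ?m" "stored ?m s7"
    using k6 P6 frame_nats[OF f7] frame_reals[OF f7] frame_draws[OF f7] by (simp_all add: keeps_def stored_def)
  define s8 where "s8 = eval_com \<sigma> ?p4 s7"
  have u8: "reals s8 ''u'' 0 = real ?T" using k7 by (simp add: s8_def keeps_def Delta_r_def iterations_def)
  have k8: "keeps s8" "nats s8 ''m'' = ?m" "draws s8 = ?m" "stored ?m s8" "axes s8 = axes s7" "nats s8 ''Delta'' = n"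
    using k7 by (simp_all add: s8_def keeps_def stored_def axes_def[abs_def])
  have B8: "\<forall>i<n. \<forall>j<n. axes s8 i j = (if i = j then w + 1 else 0)"
    using P7 k6(1) k8(5) by (simp add: axes_def keeps_def)
  have T: "1 \<le> ?T" by (simp add: iterations_def)
  obtain t9 s9 where x9: "exec \<sigma> n \<omega> search s8 t9 s9" "t9 \<le> ?T * (iteration_time ?m + 10) + 20"
    and P9: "\<exists>cs Bs. cs 0 = reals s8 ''c'' \<and> Bs 0 = axes s8 \<and> run_of_cuts ?m ?T cs Bs \<and> best_iterate ?m ?T cs (reals s9 ''out'')"
    and f9: "frame search s8 s9"
    by (rule reachE[OF reach_search[OF k8(6,2,4) u8 T]])
  have Q: "?Q s9"
  proof
    show "draws s9 = ?m" using frame_draws[OF f9] k8(3) by (simp add: search_def)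
    from P9 obtain cs Bs where *: "cs 0 = reals s8 ''c''" "Bs 0 = axes s8"
      "run_of_cuts ?m ?T cs Bs" "best_iterate ?m ?T cs (reals s9 ''out'')" by (elim exE conjE)
    have "cs 0 = (\<lambda>_. 0)" using *(1) k8(1) by (simp add: keeps_def)
    then show "\<exists>cs Bs. cs 0 = (\<lambda>_. 0) \<and> (\<forall>i<n. \<forall>j<n. Bs 0 i j = (if i = j then w + 1 else 0)) \<and>
        run_of_cuts ?m ?T cs Bs \<and> best_iterate ?m ?T cs (reals s9 ''out'')"
      using *(2-4) B8 by (intro exI[of _ cs] exI[of _ Bs]) simp
  qed
  note loop_free_step = runs_Seq[OF runs_loop_free]
  have exec_step: "reach (Seq c d) s0 (t + U) P" if "exec \<sigma> n \<omega> c s0 t s0'" "reach d s0' U P" for c d s0 s0' t U P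
    by (rule runs_Seq[OF reachI[OF that(1)] that(2)]) simp_all
  have "reach learn ?s (cost_com ?p1 + (t2 + (cost_com ?p2 + (t4 + (cost_com ?p3 + (t6 + (t7 + (cost_com ?p4 + t9)))))))) ?Q"
    unfolding learn_def
    by (rule loop_free_step, simp, unfold s1_def[symmetric], rule exec_step[OF x2(1)],
        rule loop_free_step, simp, unfold s3_def[symmetric], rule exec_step[OF x4(1)],
        rule loop_free_step, simp, unfold s5_def[symmetric], rule exec_step[OF x6(1)], rule exec_step[OF x7(1)],
        rule loop_free_step, simp, unfold s8_def[symmetric], rule reachI[where P = "?Q", OF x9(1) order_refl Q])
  then show ?thesis
    by (rule reach_time) (use x2(2) x4(2) x6(2) x7(2) x9(2) in \<open>simp add: learn_time_def Delta_r_def\<close>)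
qed

end

section \<open>Sample size, running time and correctness\<close>

context machine
begin

lemma doublings_less: "1 < u \<Longrightarrow> 2 ^ doublings u < 2 * u"
proof -
  assume u: "1 < u"
  have "doublings u \<noteq> 0" using doublings_le[of u] u by (intro notI) simp
  then have "2 ^ doublings u = 2 * (2 :: real) ^ (doublings u - 1)" by (metis power_eq_if)
  also have "\<dots> < 2 * u" using less_doublings[of "doublings u - 1" u] \<open>doublings u \<noteq> 0\<close> by simp
  finally show ?thesis .
qed

lemma doublings_le_ln:
  assumes "1 < u"
  shows "real (doublings u) \<le> 1 + 2 * ln u"
proof -
  have "real (doublings u) * ln 2 = ln (2 ^ doublings u)" by (simp add: ln_realpow)
  also have "\<dots> \<le> ln (2 * u)" using doublings_less[OF assms] assms by (intro ln_mono) auto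
  also have "\<dots> = ln 2 + ln u" using assms by (simp add: ln_mult)
  finally have *: "(real (doublings u) - 1) * ln 2 \<le> ln u" by (simp add: algebra_simps)
  have l2: "1 / 2 \<le> ln (2 :: real)" using ln_le_minus_one[of "1 / 2 :: real"] by (simp add: ln_div)
  show ?thesis
  proof (cases "doublings u = 0")
    case False
    then have "(real (doublings u) - 1) * (1 / 2) \<le> (real (doublings u) - 1) * ln 2"
      using l2 by (intro mult_left_mono) auto
    from order_trans[OF this *] show ?thesis by simp
  qed (use assms in simp)
qed

lemma doublings_le_double: "1 < u \<Longrightarrow> real (doublings u) \<le> 2 * u"
  using doublings_less[of u] of_nat_less_two_power[of "doublings u", where 'a = real] by linarith

section \<open>Numerical estimates for the case in which the learner runs\<close>

context
  fixes \<alpha> \<epsilon> :: real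
  assumes n: "n \<ge> 1" and alpha: "\<alpha> \<ge> 1" and eps: "\<epsilon> > 0" and small: "6 * \<alpha> * \<epsilon> < 1"
begin

definition "ratio = real n * \<alpha> / \<epsilon>"

lemma eps_less: "\<epsilon> < 1 / 6"
proof -
  have "\<epsilon> \<le> \<alpha> * \<epsilon>" using alpha eps by simp
  then show ?thesis using small by linarith
qed

lemma ratio_ge: "6 \<le> ratio" "1 / \<epsilon> \<le> ratio" "real n / (\<epsilon> * \<epsilon>) \<le> ratio\<^sup>2" "\<alpha> / \<epsilon> \<le> ratio"
proof -
  have na: "1 * 1 \<le> real n * \<alpha>" using n alpha by (intro mult_mono) auto
  have "1 / \<epsilon> \<le> real n * \<alpha> / \<epsilon>" using na eps by (intro divide_right_mono) auto
  then show r: "1 / \<epsilon> \<le> ratio" by (simp add: ratio_def)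
  have "6 \<le> 1 / \<epsilon>" using eps_less eps by (simp add: field_simps)
  then show "6 \<le> ratio" using r by linarith
  have "1 * \<alpha> \<le> real n * \<alpha>" using n alpha by (intro mult_right_mono) auto
  then show "\<alpha> / \<epsilon> \<le> ratio" using eps by (simp add: ratio_def divide_right_mono)
  have "real n * 1 \<le> real n * (real n * (\<alpha> * \<alpha>))"
    using n mult_mono[of 1 "real n" 1 "\<alpha> * \<alpha>"] mult_mono[of 1 \<alpha> 1 \<alpha>] alpha by (intro mult_left_mono) auto
  then have "real n / (\<epsilon> * \<epsilon>) \<le> (real n * (real n * (\<alpha> * \<alpha>))) / (\<epsilon> * \<epsilon>)"
    using eps by (intro divide_right_mono) auto
  then show "real n / (\<epsilon> * \<epsilon>) \<le> ratio\<^sup>2" by (simp add: ratio_def power2_eq_square mult_ac)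
qed

abbreviation "lev \<equiv> doublings ratio"
abbreviation "sz \<equiv> sample_size \<alpha> \<epsilon>"

lemma L_pos: "1 \<le> lev"
proof -
  have "lev \<noteq> 0" using doublings_le[of ratio] ratio_ge(1) by (intro notI) simp
  then show ?thesis by simp
qed

lemma sample_size_ge: "65536 * real n * lev / (\<epsilon> * \<epsilon>) \<le> sz"
  unfolding sample_size_def ratio_def by (rule real_nat_ceiling_ge)

text \<open>Rounding up adds at most 1, which is at most the unscaled quantity; hence 65536 becomes
  65537.\<close>

lemma sample_size_le: "sz \<le> 65537 * (real n / (\<epsilon> * \<epsilon>) * lev)"
proof -
  let ?x = "65536 * real n * lev / (\<epsilon> * \<epsilon>)"
  have x0: "0 \<le> ?x" using eps by simp
  then have "real sz = of_int \<lceil>?x\<rceil>" unfolding sample_size_def ratio_def by simp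
  then have "sz \<le> ?x + 1" by linarith
  moreover have "1 \<le> real n / (\<epsilon> * \<epsilon>) * lev"
  proof -
    have "\<epsilon> * \<epsilon> \<le> 1 * 1" using eps_less eps by (intro mult_mono) auto
    then have "1 \<le> real n / (\<epsilon> * \<epsilon>)" using n eps by (simp add: pos_le_divide_eq)
    then have "1 * 1 \<le> real n / (\<epsilon> * \<epsilon>) * lev" using L_pos by (intro mult_mono) auto
    then show ?thesis by simp
  qed
  moreover have "?x = 65536 * (real n / (\<epsilon> * \<epsilon>) * lev)" by simp
  ultimately show ?thesis by linarith
qed

text \<open>As \<open>ratio\<close> is at least 6 > e, its logarithm is at least 1 and
  \<open>lev\<close> \<le> 1 + 2 ln \<open>ratio\<close> \<le> 3 ln \<open>ratio\<close>. The
  constant is 3 * 65537 = 196611 rounded up, and the factor \<alpha>^2 \<ge> 1 brings the bound into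
  the stated form.\<close>

lemma sample_size_le_ln: "sz \<le> 200000 * (real n * \<alpha>\<^sup>2 / \<epsilon>\<^sup>2 * ln ratio)"
proof -
  have "1 \<le> ln (6 :: real)"
    using exp_le ln_mono[of "exp 1" "6 :: real"] by simp
  also have "\<dots> \<le> ln ratio" using ratio_ge(1) by (intro ln_mono) auto
  finally have ln1: "1 \<le> ln ratio" .
  then have L3: "lev \<le> 3 * ln ratio" using doublings_le_ln[of ratio] ratio_ge(1) by linarith
  have "real n / (\<epsilon> * \<epsilon>) * 1 \<le> real n / (\<epsilon> * \<epsilon>) * \<alpha>\<^sup>2"
    using alpha eps by (intro mult_left_mono) (auto simp: one_le_power)
  then have "real n / (\<epsilon> * \<epsilon>) * lev \<le> real n * \<alpha>\<^sup>2 / \<epsilon>\<^sup>2 * (3 * ln ratio)"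
    using L3 alpha eps by (intro mult_mono) (auto simp: power2_eq_square)
  then have "sz \<le> 65537 * (real n * \<alpha>\<^sup>2 / \<epsilon>\<^sup>2 * (3 * ln ratio))" using sample_size_le by linarith
  also have "\<dots> = 196611 * (real n * \<alpha>\<^sup>2 / \<epsilon>\<^sup>2 * ln ratio)" by simp
  also have "\<dots> \<le> 200000 * (real n * \<alpha>\<^sup>2 / \<epsilon>\<^sup>2 * ln ratio)" using ln1 by (intro mult_right_mono) auto
  finally show ?thesis .
qed

lemma sample_size_poly: "sz \<le> 131074 * ratio ^ 3"
proof -
  have "real n / (\<epsilon> * \<epsilon>) * lev \<le> ratio\<^sup>2 * (2 * ratio)"
    using ratio_ge(1,3) doublings_le_double[of ratio] by (intro mult_mono) auto
  also have "\<dots> = 2 * ratio ^ 3" by (simp add: power2_eq_square power3_eq_cube)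
  finally show ?thesis using sample_size_le by linarith
qed

lemma sample_size_large: "32 \<le> sz * \<epsilon>\<^sup>2" "128 * (real n * lev) \<le> sz * \<epsilon>\<^sup>2 / 512"
proof -
  have "65536 * real n * lev \<le> sz * (\<epsilon> * \<epsilon>)"
    using sample_size_ge eps by (simp add: pos_divide_le_eq)
  then have *: "65536 * (real n * lev) \<le> sz * \<epsilon>\<^sup>2" by (simp add: power2_eq_square)
  then show "128 * (real n * lev) \<le> sz * \<epsilon>\<^sup>2 / 512" by simp
  have "1 * 1 \<le> real n * lev" using n L_pos by (intro mult_mono) auto
  then show "32 \<le> sz * \<epsilon>\<^sup>2" using * by linarith
qed

text \<open>Everything is measured in powers of \<open>ratio\<close>, whose lower bound 6 absorbs
  the constants: the base is at most \<open>ratio ^ 13\<close>, and n + 1 \<le> 2 n turns the count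
  into \<open>ratio ^ (26 * n)\<close>. The sample size makes the exponential at least
  \<open>ratio ^ (128 * n)\<close>, by \<open>ratio \<le> 2 ^ lev\<close> and 2 \<le> e. The surplus
  \<open>ratio ^ (102 * n)\<close> is at least 6^4 > 600.\<close>

lemma tail_bound:
  assumes N: "N = nat \<lceil>32 * \<alpha> / \<epsilon>\<rceil>"
  shows "(2 * sz * N + 1) ^ (n + 1) * exp (- (sz * \<epsilon>\<^sup>2 / 512)) \<le> 1 / 600"
proof -
  let ?Q = "ratio"
  have Q: "6 \<le> ?Q" "1 \<le> ?Q" using ratio_ge(1) by auto
  have "real N = of_int \<lceil>32 * \<alpha> / \<epsilon>\<rceil>" using alpha eps by (simp add: N)
  then have "N \<le> 32 * (\<alpha> / \<epsilon>) + 1" by simp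
  then have N33: "N \<le> 33 * ?Q" using ratio_ge(4) Q by linarith
  have "real sz * real N \<le> (131074 * ?Q ^ 3) * (33 * ?Q)"
    using sample_size_poly N33 Q by (intro mult_mono) auto
  also have "\<dots> = 4325442 * ?Q ^ 4" by (simp add: power_numeral_reduce)
  finally have "2 * (real sz * real N) + 1 \<le> 8650884 * ?Q ^ 4 + 1" by linarith
  also have "\<dots> \<le> 6 ^ 9 * ?Q ^ 4" using one_le_power[OF Q(2), of 4] by simp
  also have "\<dots> \<le> ?Q ^ 9 * ?Q ^ 4" using Q by (intro mult_right_mono power_mono) auto
  finally have base: "real (2 * sz * N + 1) \<le> ?Q ^ 13" by (simp add: power_add[symmetric])
  have "real ((2 * sz * N + 1) ^ (n + 1)) = real (2 * sz * N + 1) ^ (n + 1)" by (rule of_nat_power)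
  also have "\<dots> \<le> (?Q ^ 13) ^ (n + 1)" using base by (intro power_mono) auto
  also have "\<dots> = ?Q ^ (13 * (n + 1))" by (simp only: power_mult)
  also have "\<dots> \<le> ?Q ^ (26 * n)" using Q n by (intro power_increasing) auto
  finally have p: "real ((2 * sz * N + 1) ^ (n + 1)) \<le> ?Q ^ (26 * n)" .
  have "?Q ^ (128 * n) \<le> (2 ^ lev) ^ (128 * n)" using doublings_le[of ?Q] Q by (intro power_mono) auto
  also have "\<dots> = 2 ^ (128 * (n * lev))" by (simp add: power_mult[symmetric] mult_ac)
  also have "\<dots> \<le> exp 1 ^ (128 * (n * lev))"
    using exp_ge_add_one_self[of 1] by (intro power_mono) auto
  also have "\<dots> = exp (128 * (real n * lev))" by (simp add: exp_of_nat_mult[symmetric])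
  also have "\<dots> \<le> exp (sz * \<epsilon>\<^sup>2 / 512)" using sample_size_large(2) by simp
  finally have e: "?Q ^ (128 * n) \<le> exp (sz * \<epsilon>\<^sup>2 / 512)" .
  have "600 \<le> (6 :: real) ^ 4" by simp
  also have "\<dots> \<le> ?Q ^ 4" using Q by (intro power_mono) auto
  also have "\<dots> \<le> ?Q ^ (102 * n)" using Q n by (intro power_increasing) auto
  finally have "600 * ?Q ^ (26 * n) \<le> ?Q ^ (102 * n) * ?Q ^ (26 * n)" using Q by (intro mult_right_mono) auto
  also have "\<dots> = ?Q ^ (128 * n)" by (simp add: power_add[symmetric])
  finally have "600 * real ((2 * sz * N + 1) ^ (n + 1)) \<le> exp (sz * \<epsilon>\<^sup>2 / 512)" using p e by linarith
  then show ?thesis by (simp add: exp_minus field_simps)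
qed

text \<open>The logarithmic factor of \<open>P\<close> is at least 1, so \<open>P\<close> dominates
  \<open>ratio\<close>, \<open>n\<close> and the logarithm itself. The degree 8 comes from the
  search: of order \<open>P ^ 4\<close> iterations, each taking of order \<open>P ^ 4\<close> steps,
  since the sample has size of order \<open>P ^ 3\<close> and each example costs time linear in
  \<open>n\<close>.\<close>

lemma learn_time_poly:
  fixes P w :: real
  assumes P: "P = \<alpha> * real n / \<epsilon> * log 2 (max 2 w)"
  shows "learn_time \<alpha> \<epsilon> w \<le> 10 ^ 9 * P ^ 8"
proof -
  define W where "W = log 2 (max 2 w)"
  have W: "1 \<le> W" using log_mono[of 2 2 "max 2 w"] by (simp add: W_def)
  have PW: "P = ratio * W" by (simp add: P W_def ratio_def mult.commute)
  have rP: "ratio \<le> P" "W \<le> P"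
    using mult_left_mono[OF W, of ratio] mult_right_mono[of 1 ratio W] ratio_ge(1) W by (auto simp: PW)
  have P6: "6 \<le> P" using rP ratio_ge(1) by linarith
  then have P1: "1 \<le> P" by simp
  have pow: "P ^ i \<le> P ^ j" if "i \<le> j" for i j using that P1 by (intro power_increasing) auto
  have nr: "real n / \<epsilon> \<le> ratio"
    using alpha eps n by (simp add: ratio_def divide_right_mono)
  have "real n * 1 \<le> real n * (1 / \<epsilon>)" using eps_less eps by (intro mult_left_mono) (auto simp: field_simps)
  then have nP: "real n \<le> P" using nr rP by simp
  have L: "real lev \<le> 2 * P" using doublings_le_double[of ratio] ratio_ge(1) rP by linarith
  have "ratio ^ 3 \<le> P ^ 3" using rP ratio_ge(1) by (intro power_mono) auto
  then have mP: "real sz \<le> 131074 * P ^ 3" using sample_size_poly by linarith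
  let ?u = "2 * real n * (w + 1) / \<epsilon>"
  \<comment> \<open>One doubling fewer stays below the bound \<open>?u\<close>, which is at most 4 *
    \<open>ratio\<close> * max 2 w; taking logarithms leaves 2 + 2 * \<open>ratio\<close> + W, and
    the omitted doubling is added back.\<close>
  have J: "real (doublings ?u) \<le> 4 * P"
  proof (cases "doublings ?u = 0")
    case False
    let ?M = "max 2 w"
    have lt: "2 ^ (doublings ?u - 1) < ?u" using False by (intro less_doublings) simp
    have "?u \<le> 2 * real n * (2 * ?M) / \<epsilon>" using eps by (intro divide_right_mono mult_left_mono) auto
    also have "\<dots> = 4 * (real n / \<epsilon>) * ?M" by simp
    also have "\<dots> \<le> 4 * ratio * ?M" using nr by (intro mult_right_mono) auto
    finally have "2 ^ (doublings ?u - 1) \<le> 4 * ratio * ?M" using lt by linarith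
    then have "log 2 (2 ^ (doublings ?u - 1)) \<le> log 2 (4 * ratio * ?M)" by (intro log_mono) auto
    also have "\<dots> = log 2 4 + log 2 ratio + W" using ratio_ge(1) by (simp add: log_mult W_def)
    also have "log 2 (4 :: real) = 2" using log_pow_cancel[of 2 2] by simp
    also have "log 2 ratio \<le> 2 * ratio"
    proof -
      have "1 / 2 \<le> ln (2 :: real)" using ln_le_minus_one[of "1 / 2 :: real"] by (simp add: ln_div)
      then have "ln ratio / ln 2 \<le> ln ratio / (1 / 2)" using ratio_ge(1) by (intro divide_left_mono) auto
      then show ?thesis using ln_le_minus_one[of ratio] ratio_ge(1) by (simp add: log_def)
    qed
    finally have "real (doublings ?u - 1) \<le> 2 + 2 * ratio + W" by (simp add: log_nat_power)
    then show ?thesis using False rP P6 by simp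
  qed (use P1 in simp)
  have T: "real (iterations \<epsilon> w) \<le> 33 * P ^ 4"
  proof -
    have "real n * real n * real n * doublings ?u \<le> P * P * P * (4 * P)"
      using nP J P1 by (intro mult_mono) auto
    also have "\<dots> = 4 * P ^ 4" by (simp add: power_numeral_reduce)
    finally have "real (iterations \<epsilon> w) \<le> 32 * P ^ 4 + 1" by (simp add: iterations_def)
    then show ?thesis using one_le_power[OF P1, of 4] by linarith
  qed
  have I: "real (iteration_time sz) + 10 \<le> 16000000 * P ^ 4"
  proof -
    have "real sz * (real n * 50 + 70) \<le> (131074 * P ^ 3) * (120 * P)"
      using mP nP P1 by (intro mult_mono) auto
    also have "\<dots> = 15728880 * P ^ 4" by (simp add: power_numeral_reduce)
    finally have a: "real sz * (real n * 50 + 70) \<le> 15728880 * P ^ 4" .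
    have "real n * (real n * 110 + 300) \<le> P * (410 * P)"
      using nP P1 by (intro mult_mono) auto
    also have "\<dots> = 410 * P ^ 2" by (simp add: power2_eq_square)
    also have "\<dots> \<le> 410 * P ^ 4" using pow[of 2 4] by simp
    finally have b: "real n * (real n * 110 + 300) \<le> 410 * P ^ 4" .
    have "real (iteration_time sz) = real sz * (real n * 50 + 70) + real n * (real n * 110 + 300) + 300"
      by (simp add: iteration_time_def)
    then show ?thesis using a b one_le_power[OF P1, of 4] by linarith
  qed
  have TI: "real (iterations \<epsilon> w) * (real (iteration_time sz) + 10) \<le> 528000000 * P ^ 8"
  proof -
    have "real (iterations \<epsilon> w) * (real (iteration_time sz) + 10) \<le> (33 * P ^ 4) * (16000000 * P ^ 4)"
      using T I by (intro mult_mono) auto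
    also have "\<dots> = 528000000 * P ^ 8" by (simp add: power_add[symmetric])
    finally show ?thesis .
  qed
  have S: "real sz * (real n * 20 + 40) \<le> 7864440 * P ^ 8"
  proof -
    have "real sz * (real n * 20 + 40) \<le> (131074 * P ^ 3) * (60 * P)"
      using mP nP P1 by (intro mult_mono) auto
    also have "\<dots> = 7864440 * P ^ 4" by (simp add: power_numeral_reduce)
    also have "\<dots> \<le> 7864440 * P ^ 8" using pow[of 4 8] by simp
    finally show ?thesis .
  qed
  have "real (learn_time \<alpha> \<epsilon> w) = real lev * 17 + real sz * (real n * 20 + 40) + real (doublings ?u) * 17 + real n * 20
      + real (iterations \<epsilon> w) * (real (iteration_time sz) + 10) + 300"
    by (simp add: learn_time_def ratio_def)
  moreover have "P \<le> P ^ 8" using pow[of 1 8] by simp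
  ultimately have "real (learn_time \<alpha> \<epsilon> w) \<le> 1000000000 * P ^ 8"
    using TI S L J nP one_le_power[OF P1, of 8] by linarith
  then show ?thesis by simp
qed

lemma reach_algorithm_learn:
  assumes "reach learn (initial n \<epsilon> \<alpha> w) T Q"
  shows "reach algorithm (initial n \<epsilon> \<alpha> w) (T + 20) Q"
proof -
  let ?b = "RLess (RTimes (RTimes (RConst 6) (scal ''alpha'')) (scal ''eps'')) (RConst 1)"
  have "reach algorithm (initial n \<epsilon> \<alpha> w) (bcost ?b + T) Q"
    unfolding algorithm_def by (rule reach_Cond) (use assms small in \<open>simp_all add: initial_def\<close>)
  then show ?thesis by (rule reach_time) simp
qed

end

lemma reach_algorithm_skip:
  assumes "1 \<le> 6 * \<alpha> * \<epsilon>"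
  shows "runs algorithm (initial n \<epsilon> \<alpha> w) 20 (initial n \<epsilon> \<alpha> w)"
proof -
  let ?s = "initial n \<epsilon> \<alpha> w"
  let ?b = "RLess (RTimes (RTimes (RConst 6) (scal ''alpha'')) (scal ''eps'')) (RConst 1)"
  have "runs Skip ?s (cost_com Skip) ?s" by (rule reach_loop_free) simp_all
  then have "runs algorithm ?s (bcost ?b + cost_com Skip) ?s"
    unfolding algorithm_def by (intro reach_Cond) (use assms in \<open>simp_all add: initial_def\<close>)
  then show ?thesis by (rule reach_time) simp
qed

lemma L2_set_add_scaled: "L2_set (\<lambda>j. u j + a * x j) {..<n} \<le> L2_set u {..<n} + \<bar>a\<bar> * L2_set x {..<n}"
proof -
  have "L2_set (\<lambda>j. a * x j) {..<n} = sqrt (a\<^sup>2 * dot n x x)"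
    by (simp add: L2_set_dot dot_scale_left dot_scale_right power2_eq_square)
  also have "\<dots> = \<bar>a\<bar> * L2_set x {..<n}" by (simp add: real_sqrt_mult L2_set_dot)
  finally show ?thesis using L2_set_triangle_ineq[of u "\<lambda>j. a * x j" "{..<n}"] by simp
qed

lemma L2_set_gradient_le:
  assumes "\<And>i. i < m \<Longrightarrow> L2_set (fst (\<omega> i)) {..<n} \<le> b" "\<And>i. i < m \<Longrightarrow> \<bar>residual c i\<bar> \<le> 2"
  shows "L2_set (gradient m c) {..<n} \<le> m * (2 * b)"
  using assms
proof (induction m)
  case 0
  then show ?case by (simp add: gradient_def L2_set_def)
next
  case (Suc m)
  have "gradient (Suc m) c = (\<lambda>j. gradient m c j + residual c m * fst (\<omega> m) j)"
    by (simp add: gradient_def fun_eq_iff)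
  then have "L2_set (gradient (Suc m) c) {..<n} \<le> L2_set (gradient m c) {..<n} + \<bar>residual c m\<bar> * L2_set (fst (\<omega> m)) {..<n}"
    using L2_set_add_scaled by simp
  also have "\<dots> \<le> m * (2 * b) + 2 * b"
    using Suc by (intro add_mono mult_mono) auto
  finally show ?case by (simp add: algebra_simps)
qed

text \<open>For \<open>u\<close> the difference of an iterate and the true vector this turns the
  value of a cut into \<open>m\<close> times the empirical gap.\<close>

lemma dot_gradient: "dot n (gradient m c) u = (\<Sum>i<m. residual c i * dot n u (fst (\<omega> i)))"
  unfolding dot_def gradient_def
  by (simp add: sum_distrib_left sum_distrib_right, subst sum.swap) (simp add: mult_ac)

end

section \<open>From a run of the program to the error bound\<close>

context misspecified_glm
begin

text \<open>Residuals are at most 2 and instances have norm at most sqrt n \<le> n, so the gradient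
  has norm at most 2 n m. The radius r = \<epsilon> / (2 n) thus makes the slack of
  \<open>cutting_planes\<close> at most m \<epsilon>, the gap that
  \<open>good_sample_imp_small_error\<close> expects. Since r \<le> 1, the ball around
  \<open>v\<close> fits into the initial ball of radius w + 1.\<close>

lemma learn_correct:
  assumes n: "n \<ge> 1" and small: "6 * \<alpha> * \<epsilon> < 1" and vw: "L2_set v {..<n} \<le> w"
    and \<omega>: "\<And>i. \<omega> i \<in> space D" and good: "good_sample m \<omega>" and m: "m > 0"
    and init: "cs 0 = (\<lambda>_. 0)" "\<forall>i<n. \<forall>j<n. Bs 0 i j = (if i = j then w + 1 else 0)"
    and run: "machine.run_of_cuts \<sigma> n \<omega> m (machine.iterations n \<epsilon> w) cs Bs"
    and best: "machine.best_iterate \<sigma> n \<omega> m (machine.iterations n \<epsilon> w) cs u"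
  shows "(LINT x | marginal n D. (\<sigma>' (dot n x v) - \<sigma>' (dot n x u))\<^sup>2) \<le> 24 * \<alpha> * \<epsilon>"
proof -
  interpret machine \<sigma> n \<omega> .
  let ?T = "iterations \<epsilon> w"
  define r where "r = \<epsilon> / (2 * n)"
  have e1: "\<epsilon> < 1 / 6" by (rule eps_less[OF n alpha eps small])
  have r: "r > 0" "r \<le> 1"
  proof -
    show "r > 0" using eps n by (simp add: r_def)
    have "\<epsilon> / (2 * n) \<le> 1 / 1" using e1 eps n by (intro frac_le) auto
    then show "r \<le> 1" by (simp add: r_def)
  qed
  have w0: "0 \<le> w" using vw L2_set_nonneg order_trans by blast
  have "\<exists>k<?T. dot n (gradient m (cs k)) (\<lambda>i. cs k i - v i) \<le> r * L2_set (gradient m (cs k)) {..<n}"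
  proof (rule cutting_planes[OF n r(1)])
    show "L2_set v {..<n} \<le> (w + 1) - r" using vw r by linarith
    show "cs 0 i = 0" for i using init(1) by simp
    show "Bs 0 i j = (if i = j then w + 1 else 0)" if "i < n" "j < n" for i j using init(2) that by blast
    show "cut_step n (gradient m (cs k)) (cs k) (Bs k) (cs (Suc k)) (Bs (Suc k))" if "k < ?T" for k
      using run that by (simp add: run_of_cuts_def)
    let ?J = "doublings (2 * real n * (w + 1) / \<epsilon>)"
    have q: "(w + 1) / r = 2 * real n * (w + 1) / \<epsilon>" by (simp add: r_def)
    have "ln ((w + 1) / r) \<le> ln (2 ^ ?J)"
      unfolding q using doublings_le[of "2 * real n * (w + 1) / \<epsilon>"] w0 n eps by (intro ln_mono) auto
    also have "\<dots> = real ?J * ln 2" by (simp add: ln_realpow)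
    also have "\<dots> \<le> real ?J * 1" using ln_le_minus_one[of "2 :: real"] by (intro mult_left_mono) auto
    finally have "8 * real n ^ 3 * ln ((w + 1) / r) \<le> 8 * real n ^ 3 * ?J" by (intro mult_left_mono) auto
    then show "8 * real n ^ 3 * ln ((w + 1) / r) < ?T" by (simp add: iterations_def power3_eq_cube)
  qed
  then obtain k where k: "k < ?T"
    and gap: "dot n (gradient m (cs k)) (\<lambda>i. cs k i - v i) \<le> r * L2_set (gradient m (cs k)) {..<n}" by blast
  have "L2_set (gradient m (cs k)) {..<n} \<le> real m * (2 * real n)"
  proof (rule L2_set_gradient_le)
    fix i
    have "fst (\<omega> i) \<in> space (instance_space n)" using \<omega>[of i] by (auto simp: space_D)
    then have "L2_set (fst (\<omega> i)) {..<n} \<le> sqrt n" by (simp add: instance_space_def space_restrict_space)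
    also have "\<dots> \<le> n" using n by (intro real_le_lsqrt) (auto simp: power2_eq_square)
    finally show "L2_set (fst (\<omega> i)) {..<n} \<le> n" .
    show "\<bar>residual (cs k) i\<bar> \<le> 2"
      using sigma_bounds(1)[of "dot n (cs k) (fst (\<omega> i))"] label_abs[OF \<omega>[of i]] unfolding residual_def by linarith
  qed
  then have "r * L2_set (gradient m (cs k)) {..<n} \<le> r * (real m * (2 * real n))" using r by (intro mult_left_mono) auto
  also have "\<dots> = m * \<epsilon>" using n by (simp add: r_def)
  finally have "(\<Sum>i<m. (\<sigma> (score (cs k) (\<omega> i)) - snd (\<omega> i)) * (score (cs k) (\<omega> i) - score v (\<omega> i))) \<le> m * \<epsilon>"
    using gap unfolding dot_gradient dot_diff_left residual_def by linarith
  then show ?thesis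
  proof (rule good_sample_imp_small_error[OF small m \<omega> good])
    show "(\<Sum>i<m. sqloss u (\<omega> i)) \<le> (\<Sum>i<m. sqloss (cs k) (\<omega> i))"
      using best k by (simp add: best_iterate_def loss_def residual_def)
  qed
qed

end

lemma dot_out_vec: "dot n x (out_vec n s) = dot n x (reals s ''out'')"
  by (simp add: dot_def out_vec_def)

theorem theorem5p5:
  "\<exists>(A :: com) (C :: real) (p :: real poly).
    \<forall>(\<alpha> :: real) (\<sigma> :: real \<Rightarrow> real) (\<Delta> :: nat) (\<epsilon> :: real) (w :: real).
      \<alpha> \<ge> 1 \<longrightarrow> mono \<sigma> \<longrightarrow> lipschitz_on 1 UNIV \<sigma> \<longrightarrow> (\<forall>z. \<sigma> z \<in> {-1..1}) \<longrightarrow>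
      saturates_at \<alpha> \<sigma> \<longrightarrow> \<Delta> \<ge> 1 \<longrightarrow> \<epsilon> > 0 \<longrightarrow>
        (\<forall>\<omega> \<in> UNIV \<rightarrow> space (example_space \<Delta>). \<exists>t s.
            exec \<sigma> \<Delta> \<omega> A (initial \<Delta> \<epsilon> \<alpha> w) t s \<and>
            real (draws s) \<le> C * \<bar>\<Delta> * \<alpha>\<^sup>2 / \<epsilon>\<^sup>2 * ln (\<Delta> * \<alpha> / \<epsilon>)\<bar> \<and>
            real t \<le> poly p (\<alpha> * \<Delta> / \<epsilon> * log 2 (max 2 w))) \<and>
        (\<forall>D \<sigma>' v.
            glm \<Delta> D \<sigma>' v \<longrightarrow> mono \<sigma>' \<longrightarrow> L2_set v {..<\<Delta>} \<le> w \<longrightarrow>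
            saturates_at \<alpha> \<sigma>' \<longrightarrow> (\<forall>z. \<bar>\<sigma>' z - \<sigma> z\<bar> \<le> \<epsilon>) \<longrightarrow>
              (\<exists>E \<in> sets (\<Pi>\<^sub>M k\<in>(UNIV :: nat set). D).
                 measure (\<Pi>\<^sub>M k\<in>(UNIV :: nat set). D) E \<ge> 0.99 \<and>
                 (\<forall>\<omega>\<in>E. \<exists>t s.
                    exec \<sigma> \<Delta> \<omega> A (initial \<Delta> \<epsilon> \<alpha> w) t s \<and>
                    (LINT x | marginal \<Delta> D.
                       (\<sigma>' (dot \<Delta> x v) - \<sigma>' (dot \<Delta> x (out_vec \<Delta> s)))\<^sup>2) \<le> 24 * \<alpha> * \<epsilon>)))"
\<comment> \<open>The constant 20 pays for the initial test and the early exit, the monomial for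
  \<open>learn\<close>.\<close>
proof (rule exI[of _ algorithm], rule exI[of _ 200000], rule exI[of _ "[:20:] + monom (10 ^ 9) 8"],
    intro allI impI conjI ballI)
  fix \<alpha> :: real and \<sigma> :: "real \<Rightarrow> real" and n :: nat and \<epsilon> w :: real and \<omega>
  assume a: "\<alpha> \<ge> 1" and n: "n \<ge> 1" and e: "\<epsilon> > 0"
  let ?P = "\<alpha> * n / \<epsilon> * log 2 (max 2 w)"
  have P: "poly ([:20:] + monom (10 ^ 9) 8) ?P = 20 + 10 ^ 9 * ?P ^ 8" by (simp add: poly_monom)
  interpret machine \<sigma> n \<omega> .
  show "\<exists>t s. exec \<sigma> n \<omega> algorithm (initial n \<epsilon> \<alpha> w) t s \<and>
      real (draws s) \<le> 200000 * \<bar>n * \<alpha>\<^sup>2 / \<epsilon>\<^sup>2 * ln (n * \<alpha> / \<epsilon>)\<bar> \<and>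
      real t \<le> poly ([:20:] + monom (10 ^ 9) 8) ?P"
  proof (cases "6 * \<alpha> * \<epsilon> < 1")
    case True
    obtain t s where ex: "exec \<sigma> n \<omega> algorithm (initial n \<epsilon> \<alpha> w) t s" and t: "t \<le> learn_time \<alpha> \<epsilon> w + 20"
      and d: "draws s = sample_size \<alpha> \<epsilon>"
      using reach_algorithm_learn[OF n a e True reach_learn[of \<epsilon> \<alpha> w]] unfolding reach_def by (elim exE conjE) (rule that)
    have "real t \<le> real (learn_time \<alpha> \<epsilon> w) + 20" using t by linarith
    then have "real t \<le> poly ([:20:] + monom (10 ^ 9) 8) ?P"
      unfolding P using learn_time_poly[OF n a e True refl, of w] by linarith
    moreover have "real (draws s) \<le> 200000 * \<bar>n * \<alpha>\<^sup>2 / \<epsilon>\<^sup>2 * ln (n * \<alpha> / \<epsilon>)\<bar>"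
      unfolding d using sample_size_le_ln[OF n a e True] unfolding ratio_def[OF n a e True]
      by (rule order_trans) (rule mult_left_mono[OF abs_ge_self], simp)
    ultimately show ?thesis using ex by blast
  next
    case False
    then obtain t where ex: "exec \<sigma> n \<omega> algorithm (initial n \<epsilon> \<alpha> w) t (initial n \<epsilon> \<alpha> w)" and t: "t \<le> 20"
      using reach_algorithm_skip[of \<alpha> \<epsilon> w] unfolding reach_def by auto
    have "0 \<le> 10 ^ 9 * ?P ^ 8" using a e by (intro mult_nonneg_nonneg zero_le_power) simp_all
    moreover have "real t \<le> 20" using t by simp
    ultimately have "real t + 0 \<le> 20 + 10 ^ 9 * ?P ^ 8" by (rule add_mono[rotated])
    then have "real t \<le> poly ([:20:] + monom (10 ^ 9) 8) ?P" unfolding P by (simp only: add_0_right)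
    moreover have "real (draws (initial n \<epsilon> \<alpha> w)) \<le> 200000 * \<bar>n * \<alpha>\<^sup>2 / \<epsilon>\<^sup>2 * ln (n * \<alpha> / \<epsilon>)\<bar>"
      by (simp add: initial_def)
    ultimately show ?thesis using ex by blast
  qed
next
  fix \<alpha> :: real and \<sigma> :: "real \<Rightarrow> real" and n :: nat and \<epsilon> w :: real and D \<sigma>' v
  assume a: "\<alpha> \<ge> 1" and s: "mono \<sigma>" "lipschitz_on 1 UNIV \<sigma>" "saturates_at \<alpha> \<sigma>" and n: "n \<ge> 1" and e: "\<epsilon> > 0"
    and g: "glm n D \<sigma>' v" and s': "mono \<sigma>'" "saturates_at \<alpha> \<sigma>'" and v: "L2_set v {..<n} \<le> w"
    and close: "\<forall>z. \<bar>\<sigma>' z - \<sigma> z\<bar> \<le> \<epsilon>"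
  interpret misspecified_glm n D \<alpha> \<epsilon> \<sigma> \<sigma>' v
    using a s e g s' close by unfold_locales auto
  show "\<exists>E \<in> sets (\<Pi>\<^sub>M k\<in>(UNIV :: nat set). D). measure (\<Pi>\<^sub>M k\<in>(UNIV :: nat set). D) E \<ge> 0.99 \<and>
     (\<forall>\<omega>\<in>E. \<exists>t s. exec \<sigma> n \<omega> algorithm (initial n \<epsilon> \<alpha> w) t s \<and>
        (LINT x | marginal n D. (\<sigma>' (dot n x v) - \<sigma>' (dot n x (out_vec n s)))\<^sup>2) \<le> 24 * \<alpha> * \<epsilon>)"
  proof (cases "6 * \<alpha> * \<epsilon> < 1")
    case True
    define m where "m = machine.sample_size n \<alpha> \<epsilon>"
    define N where "N = nat \<lceil>32 * \<alpha> / \<epsilon>\<rceil>"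
    have m: "32 \<le> m * \<epsilon>\<^sup>2" unfolding m_def by (rule machine.sample_size_large(1)[OF n a e True])
    have N: "32 * \<alpha> \<le> N * \<epsilon>"
      using real_nat_ceiling_ge[of "32 * \<alpha> / \<epsilon>"] e unfolding N_def by (simp add: pos_divide_le_eq)
    have "(2 * m * N + 1) ^ (n + 1) * exp (- (m * \<epsilon>\<^sup>2 / 512)) \<le> 1 / 600"
      unfolding m_def by (rule machine.tail_bound[OF n a e True N_def])
    from good_sample_probable[OF m N this] obtain E where E: "E \<in> sets S" "measure S E \<ge> 0.99"
      and good: "\<forall>\<omega>\<in>E. good_sample m \<omega>" by (elim bexE conjE) (rule that)
    have "\<exists>t s. exec \<sigma> n \<omega> algorithm (initial n \<epsilon> \<alpha> w) t s \<and>
        (LINT x | marginal n D. (\<sigma>' (dot n x v) - \<sigma>' (dot n x (out_vec n s)))\<^sup>2) \<le> 24 * \<alpha> * \<epsilon>" if w: "\<omega> \<in> E" for \<omega>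
    proof -
      interpret mc: machine \<sigma> n \<omega> .
      have \<omega>: "\<omega> i \<in> space D" for i
        using sets.sets_into_space[OF E(1)] w by (auto simp: space_PiM)
      have m0: "m > 0" using m by (cases "m = 0") auto
      obtain t s cs Bs where ex: "exec \<sigma> n \<omega> algorithm (initial n \<epsilon> \<alpha> w) t s"
        and c: "cs 0 = (\<lambda>_. 0)" "\<forall>i<n. \<forall>j<n. Bs 0 i j = (if i = j then w + 1 else 0)"
          "mc.run_of_cuts m (mc.iterations \<epsilon> w) cs Bs" "mc.best_iterate m (mc.iterations \<epsilon> w) cs (reals s ''out'')"
        using mc.reach_algorithm_learn[OF n a e True mc.reach_learn[of \<epsilon> \<alpha> w], folded m_def]
        unfolding mc.reach_def by (elim exE conjE) (rule that)
      have "(LINT x | marginal n D. (\<sigma>' (dot n x v) - \<sigma>' (dot n x (out_vec n s)))\<^sup>2) \<le> 24 * \<alpha> * \<epsilon>"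
        unfolding dot_out_vec
        by (rule learn_correct[OF n True v \<omega> bspec[OF good w] m0 c])
      then show ?thesis using ex by blast
    qed
    then show ?thesis using E by blast
  next
    case False
    have "\<exists>t s. exec \<sigma> n \<omega> algorithm (initial n \<epsilon> \<alpha> w) t s \<and>
        (LINT x | marginal n D. (\<sigma>' (dot n x v) - \<sigma>' (dot n x (out_vec n s)))\<^sup>2) \<le> 24 * \<alpha> * \<epsilon>" for \<omega>
    proof -
      interpret mc: machine \<sigma> n \<omega> .
      obtain t where "exec \<sigma> n \<omega> algorithm (initial n \<epsilon> \<alpha> w) t (initial n \<epsilon> \<alpha> w)"
        using mc.reach_algorithm_skip[of \<alpha> \<epsilon> w] False unfolding mc.reach_def by auto
      moreover have "(LINT x | marginal n D. (\<sigma>' (dot n x v) - \<sigma>' (dot n x (out_vec n (initial n \<epsilon> \<alpha> w))))\<^sup>2) \<le> 24 * \<alpha> * \<epsilon>"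
        using False by (intro order_trans[OF error_le_4]) simp
      ultimately show ?thesis by blast
    qed
    then show ?thesis using P.prob_space by (intro bexI[of _ "space S"]) auto
  qed
qed

end
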